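(* There is an isomorphism $\phi:\mathcal{T}(\mathbb{N}\rtimes\mathbb{N}^\times)\to C^*(\mathbb{N}\rtimes\mathbb{N}^\times)$ satisfying $\phi(s)=s_{(1,1)}$ and $\phi(v_p)=t_{(0,p)}$ for all primes $p$. The isomorphism $\phi$ descends to an isomorphism of $\mathcal{Q}_{\mathbb{N}}$ onto the boundary quotient $\mathcal{Q}(\mathbb{N}\rtimes\mathbb{N}^\times)$.
   Context: $\mathbb{N}=\{0,1,2,\dots\}$ under addition, $\mathbb{N}^\times=\{1,2,\dots\}$ under multiplication, and $\mathbb{N}\rtimes\mathbb{N}^\times$ is the semigroup $\mathbb{N}\times\mathbb{N}^\times$ with $(m,a)(n,b)=(m+an,ab)$ and identity $(0,1)$. $\mathcal{T}(\mathbb{N}\rtimes\mathbb{N}^\times)$ is the universal $C^*$-algebra generated by an isometry $s$ and isometries $v_p$, one for each prime $p$, satisfying, for primes $p,q$: (T1) $v_ps=s^pv_p$; (T2) $v_pv_q=v_qv_p$; (T3) $v_p^*v_q=v_qv_p^*$ for $p\ne q$; (T4) $s^*v_p=s^{p-1}v_ps^*$; (T5) $v_p^*s^kv_p=0$ for $1\le k<p$. $\mathcal{Q}_{\mathbb{N}}$ (Cuntz's algebra) is the quotient of $\mathcal{T}(\mathbb{N}\rtimes\mathbb{N}^\times)$ obtained by adding the relations: (Q5) $\sum_{k=0}^{p-1}(s^kv_p)(s^kv_p)^*=1$ for all primes $p$; (Q6) $ss^*=1$. For a discrete left-cancellative semigroup $P$ with identity, $X\subseteq P$ and $p\in P$,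 put $pX=\{px:x\in X\}$ and $p^{-1}X=\{y\in P:py\in X\}$. $\mathcal{J}(P)$ is the smallest family of right ideals of $P$ containing $P$ and $\varnothing$ and closed under $X\mapsto pX$, $X\mapsto p^{-1}X$ ($p\in P$), and finite intersections. $C^*(P)$ is the universal $C^*$-algebra generated by isometries $\{v_p:p\in P\}$ and projections $\{e_X:X\in\mathcal{J}(P)\}$ satisfying $v_pv_q=v_{pq}$; $v_pe_Xv_p^*=e_{pX}$; $e_P=1$, $e_\varnothing=0$; $e_Xe_Y=e_{X\cap Y}$. A subset $F\subseteq P$ is a foundation set if it is finite and for each $p\in P$ there is $q\in F$ with $pP\cap qP\ne\varnothing$. The boundary quotient $\mathcal{Q}(P)$ is the quotient of $C^*(P)$ obtained by adding the relations $\prod_{p\in F}(1-e_{pP})=0$ for all foundation sets $F\subseteq P$. For $P=\mathbb{N}\rtimes\mathbb{N}^\times$ the nonempty elements of $\mathcal{J}(P)$ are the principal right ideals $pP$. $\mathbb{N}\rtimes\mathbb{N}^\times$ is the internal Zappa--Szép product of its subsemigroups $U=\{(r,x):x\in\mathbb{N}^\times,\,0\le r\le x-1\}$ and $A=\{(m,1):m\in\mathbb{N}\}$: every element is uniquely a product $ua$ with $u\in U$, $a\in A$. In $C^*(\mathbb{N}\rtimes\mathbb{N}^\times)$ (and its quotient) write $t_u:=v_u$ for $u\in U$ and $s_a:=v_a$ for $a\in A$; in particular $s_{(1,1)}$ and $t_{(0,p)}$ denote the canonical generating isometries $v_{(1,1)}$ and $v_{(0,p)}$ of $C^*(\mathbb{N}\rtimes\mathbb{N}^\times)$.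 *)

theory Defs
  imports
    "HOL-Analysis.Analysis"
    "HOL-Algebra.QuotRing"
    "HOL-Library.Poly_Mapping"
    "HOL-Computational_Algebra.Primes"
begin

section \<open>The free unital *-algebra\<close>

text \<open>
  A letter is a generator or the formal adjoint of a generator.  Words form a monoid under
  concatenation, so finitely supported functions from words to the complex numbers form, with the
  convolution product of \<^theory>\<open>HOL-Library.Poly_Mapping\<close>, the free unital complex algebra on
  the letters.
\<close>

datatype 'g letter = Gen 'g | Adj 'g

datatype 'g word = Word (letters: "'g letter list")

instantiation word :: (type) monoid_add
begin
definition zero_word :: "'a word" where "0 = Word []"
definition plus_word :: "'a word \<Rightarrow> 'a word \<Rightarrow> 'a word"
  where "u + v = Word (letters u @ letters v)"
instance
  by standard (simp_all add: zero_word_def plus_word_def)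
end

type_synonym 'g poly_star = "'g word \<Rightarrow>\<^sub>0 complex"

fun letter_star :: "'g letter \<Rightarrow> 'g letter" where
  "letter_star (Gen g) = Adj g"
| "letter_star (Adj g) = Gen g"

definition word_star :: "'g word \<Rightarrow> 'g word"
  where "word_star w = Word (rev (map letter_star (letters w)))"

lemma letter_star_letter_star [simp]: "letter_star (letter_star l) = l"
  by (cases l) simp_all

lemma word_star_word_star [simp]: "word_star (word_star w) = w"
  by (cases w) (simp add: word_star_def rev_map comp_def)

lift_definition fstar :: "'g poly_star \<Rightarrow> 'g poly_star"
  is "\<lambda>f w. cnj (f (word_star w))"
proof -
  fix f :: "'g word \<Rightarrow> complex"
  assume "finite {w. f w \<noteq> 0}"
  moreover have "{w. cnj (f (word_star w)) \<noteq> 0} \<subseteq> word_star ` {w. f w \<noteq> 0}"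
  proof
    fix w assume "w \<in> {w. cnj (f (word_star w)) \<noteq> 0}"
    then have "word_star w \<in> {w. f w \<noteq> 0}" by simp
    then have "word_star (word_star w) \<in> word_star ` {w. f w \<noteq> 0}" by (rule imageI)
    then show "w \<in> word_star ` {w. f w \<noteq> 0}" by simp
  qed
  ultimately show "finite {w. cnj (f (word_star w)) \<noteq> 0}"
    using finite_subset by blast
qed

definition fscale :: "complex \<Rightarrow> 'g poly_star \<Rightarrow> 'g poly_star"
  where "fscale c x = Poly_Mapping.single 0 c * x"

definition fgen :: "'g \<Rightarrow> 'g poly_star"
  where "fgen g = Poly_Mapping.single (Word [Gen g]) 1"

definition free_star_alg :: "'g set \<Rightarrow> 'g poly_star set"
  where "free_star_alg G =
    {x. \<forall>w \<in> Poly_Mapping.keys x. set (letters w) \<subseteq> Gen ` G \<union> Adj ` G}"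


section \<open>C*-algebras\<close>

record 'a star_algebra = "'a ring" +
  cscale :: "complex \<Rightarrow> 'a \<Rightarrow> 'a"
  adj :: "'a \<Rightarrow> 'a"
  cnorm :: "'a \<Rightarrow> real"

locale cstar_algebra = ring A for A :: "('a, 'm) star_algebra_scheme" (structure) +
  assumes scale_closed: "x \<in> carrier A \<Longrightarrow> cscale A c x \<in> carrier A"
    and scale_one: "x \<in> carrier A \<Longrightarrow> cscale A 1 x = x"
    and scale_scale: "x \<in> carrier A \<Longrightarrow> cscale A c (cscale A d x) = cscale A (c * d) x"
    and scale_add_left: "x \<in> carrier A \<Longrightarrow> cscale A (c + d) x = cscale A c x \<oplus> cscale A d x"
    and scale_add_right:
      "x \<in> carrier A \<Longrightarrow> y \<in> carrier A \<Longrightarrow> cscale A c (x \<oplus> y) = cscale A c x \<oplus> cscale A c y"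
    and scale_mult_left:
      "x \<in> carrier A \<Longrightarrow> y \<in> carrier A \<Longrightarrow> cscale A c x \<otimes> y = cscale A c (x \<otimes> y)"
    and scale_mult_right:
      "x \<in> carrier A \<Longrightarrow> y \<in> carrier A \<Longrightarrow> x \<otimes> cscale A c y = cscale A c (x \<otimes> y)"
    and adj_closed: "x \<in> carrier A \<Longrightarrow> adj A x \<in> carrier A"
    and adj_adj: "x \<in> carrier A \<Longrightarrow> adj A (adj A x) = x"
    and adj_add: "x \<in> carrier A \<Longrightarrow> y \<in> carrier A \<Longrightarrow> adj A (x \<oplus> y) = adj A x \<oplus> adj A y"
    and adj_mult: "x \<in> carrier A \<Longrightarrow> y \<in> carrier A \<Longrightarrow> adj A (x \<otimes> y) = adj A y \<otimes> adj A x"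
    and adj_scale: "x \<in> carrier A \<Longrightarrow> adj A (cscale A c x) = cscale A (cnj c) (adj A x)"
    and norm_zero_iff: "x \<in> carrier A \<Longrightarrow> cnorm A x = 0 \<longleftrightarrow> x = \<zero>"
    and norm_triangle:
      "x \<in> carrier A \<Longrightarrow> y \<in> carrier A \<Longrightarrow> cnorm A (x \<oplus> y) \<le> cnorm A x + cnorm A y"
    and norm_scale: "x \<in> carrier A \<Longrightarrow> cnorm A (cscale A c x) = cmod c * cnorm A x"
    and norm_mult:
      "x \<in> carrier A \<Longrightarrow> y \<in> carrier A \<Longrightarrow> cnorm A (x \<otimes> y) \<le> cnorm A x * cnorm A y"
    and norm_adj_mult: "x \<in> carrier A \<Longrightarrow> cnorm A (adj A x \<otimes> x) = (cnorm A x)\<^sup>2"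
    and complete: "range X \<subseteq> carrier A \<Longrightarrow>
      (\<forall>e>0. \<exists>N. \<forall>m\<ge>N. \<forall>n\<ge>N. cnorm A (X m \<ominus> X n) < e) \<Longrightarrow>
      \<exists>x\<in>carrier A. (\<lambda>n. cnorm A (X n \<ominus> x)) \<longlonglongrightarrow> 0"

definition star_hom ::
  "('a, 'm) star_algebra_scheme \<Rightarrow> ('b, 'n) star_algebra_scheme \<Rightarrow> ('a \<Rightarrow> 'b) set"
  where "star_hom A B = {\<phi> \<in> ring_hom A B.
    (\<forall>c. \<forall>x\<in>carrier A. \<phi> (cscale A c x) = cscale B c (\<phi> x)) \<and>
    (\<forall>x\<in>carrier A. \<phi> (adj A x) = adj B (\<phi> x))}"

text \<open>Between C*-algebras, bijective *-homomorphisms are automatically isometric.\<close>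

definition star_iso ::
  "('a, 'm) star_algebra_scheme \<Rightarrow> ('b, 'n) star_algebra_scheme \<Rightarrow> ('a \<Rightarrow> 'b) set"
  where "star_iso A B = {\<phi> \<in> star_hom A B. bij_betw \<phi> (carrier A) (carrier B)}"


section \<open>Universal C*-algebras of generators and relations\<close>

definition cstar_seminorm :: "'g set \<Rightarrow> ('g poly_star \<Rightarrow> real) \<Rightarrow> bool"
  where "cstar_seminorm G p \<longleftrightarrow>
    (\<forall>x\<in>free_star_alg G. \<forall>y\<in>free_star_alg G. p (x + y) \<le> p x + p y) \<and>
    (\<forall>c. \<forall>x\<in>free_star_alg G. p (fscale c x) = cmod c * p x) \<and>
    (\<forall>x\<in>free_star_alg G. \<forall>y\<in>free_star_alg G. p (x * y) \<le> p x * p y) \<and>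
    (\<forall>x\<in>free_star_alg G. p (fstar x * x) = (p x)\<^sup>2)"

text \<open>
  A set of relations is a set of elements of the free unital *-algebra; \<open>r \<in> R\<close> stands
  for the relation \<open>r = 0\<close>.  The universal C*-algebra on generators \<open>G\<close> and relations \<open>R\<close> is the
  Hausdorff completion of the free unital *-algebra on \<open>G\<close> for the largest C*-seminorm vanishing
  on \<open>R\<close>.  The supremum below is meaningful only if these seminorms are bounded at each generator,
  which is the predicate \<open>admissible\<close> below; in that case \<open>univ_cstar_universal\<close>, \<open>univ_elt_rel\<close> and
  \<open>univ_elt_dense\<close> give the usual universal property.
\<close>

definition rel_seminorms :: "'g set \<Rightarrow> 'g poly_star set \<Rightarrow> ('g poly_star \<Rightarrow> real) set"
  where "rel_seminorms G R = {p. cstar_seminorm G p \<and> (\<forall>r\<in>R. p r = 0)}"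

definition univ_norm :: "'g set \<Rightarrow> 'g poly_star set \<Rightarrow> 'g poly_star \<Rightarrow> real"
  where "univ_norm G R x = (SUP p\<in>rel_seminorms G R. p x)"

definition cauchy_seqs :: "'g set \<Rightarrow> 'g poly_star set \<Rightarrow> (nat \<Rightarrow> 'g poly_star) set"
  where "cauchy_seqs G R = {X. range X \<subseteq> free_star_alg G \<and>
    (\<forall>e>0. \<exists>N. \<forall>m\<ge>N. \<forall>n\<ge>N. univ_norm G R (X m - X n) < e)}"

definition seq_class ::
  "'g set \<Rightarrow> 'g poly_star set \<Rightarrow> (nat \<Rightarrow> 'g poly_star) \<Rightarrow> (nat \<Rightarrow> 'g poly_star) set"
  where "seq_class G R X =
    {Y \<in> cauchy_seqs G R. (\<lambda>n. univ_norm G R (X n - Y n)) \<longlonglongrightarrow> 0}"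

definition univ_cstar ::
  "'g set \<Rightarrow> 'g poly_star set \<Rightarrow> (nat \<Rightarrow> 'g poly_star) set star_algebra"
  where "univ_cstar G R =
    \<lparr>carrier = seq_class G R ` cauchy_seqs G R,
     mult = (\<lambda>a b. \<Union>X\<in>a. \<Union>Y\<in>b. seq_class G R (\<lambda>n. X n * Y n)),
     one = seq_class G R (\<lambda>n. 1),
     zero = seq_class G R (\<lambda>n. 0),
     add = (\<lambda>a b. \<Union>X\<in>a. \<Union>Y\<in>b. seq_class G R (\<lambda>n. X n + Y n)),
     cscale = (\<lambda>c a. \<Union>X\<in>a. seq_class G R (\<lambda>n. fscale c (X n))),
     adj = (\<lambda>a. \<Union>X\<in>a. seq_class G R (\<lambda>n. fstar (X n))),
     cnorm = (\<lambda>a. lim (\<lambda>n. univ_norm G R ((SOME X. X \<in> a) n)))\<rparr>"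

definition univ_elt ::
  "'g set \<Rightarrow> 'g poly_star set \<Rightarrow> 'g poly_star \<Rightarrow> (nat \<Rightarrow> 'g poly_star) set"
  where "univ_elt G R x = seq_class G R (\<lambda>n. x)"


section \<open>Quotients\<close>

text \<open>
  The operations on cosets are those induced by representatives; \<open>I +> z\<close> is the coset of \<open>z\<close>.
  Adding relations to a C*-algebra means passing to the quotient by the closed two-sided ideal that
  they generate.
\<close>

definition closed_ideal :: "'a set \<Rightarrow> ('a, 'm) star_algebra_scheme \<Rightarrow> bool"
  where "closed_ideal I A \<longleftrightarrow> ideal I A \<and>
    (\<forall>x\<in>carrier A. (\<forall>e>0. \<exists>y\<in>I. cnorm A (x \<ominus>\<^bsub>A\<^esub> y) < e) \<longrightarrow> x \<in> I)"

definition gen_closed_ideal :: "('a, 'm) star_algebra_scheme \<Rightarrow> 'a set \<Rightarrow> 'a set"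
  where "gen_closed_ideal A S = \<Inter>{I. closed_ideal I A \<and> S \<subseteq> I}"

definition cstar_quot ::
  "('a, 'm) star_algebra_scheme \<Rightarrow> 'a set \<Rightarrow> 'a set star_algebra"  (infixl \<open>CQuot\<close> 65)
  where "A CQuot I = ring.extend (A Quot I) (star_algebra.fields
    (\<lambda>c a. \<Union>x\<in>a. I +>\<^bsub>A\<^esub> cscale A c x)
    (\<lambda>a. \<Union>x\<in>a. I +>\<^bsub>A\<^esub> adj A x)
    (\<lambda>a. INF x\<in>a. cnorm A x))"


section \<open>The additive boundary quotient of Cuntz\<close>

text \<open>
  \<open>GS\<close> is the isometry \<open>s\<close> and \<open>GV p\<close> is \<open>v\<^sub>p\<close>; only \<open>GV p\<close> with \<open>p\<close> prime is a generator.
\<close>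

datatype toeplitz_gen = GS | GV nat

definition toeplitz_gens :: "toeplitz_gen set"
  where "toeplitz_gens = insert GS (GV ` {p. prime p})"

abbreviation fs :: "toeplitz_gen poly_star" where "fs \<equiv> fgen GS"
abbreviation fv :: "nat \<Rightarrow> toeplitz_gen poly_star" where "fv p \<equiv> fgen (GV p)"

definition toeplitz_rels :: "toeplitz_gen poly_star set"
  where "toeplitz_rels =
      {fstar fs * fs - 1}
    \<union> {fstar (fv p) * fv p - 1 |p. prime p}
    \<union> {fv p * fs - fs ^ p * fv p |p. prime p}
    \<union> {fv p * fv q - fv q * fv p |p q. prime p \<and> prime q}
    \<union> {fstar (fv p) * fv q - fv q * fstar (fv p) |p q. prime p \<and> prime q \<and> p \<noteq> q}
    \<union> {fstar fs * fv p - fs ^ (p - 1) * fv p * fstar fs |p. prime p}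
    \<union> {fstar (fv p) * fs ^ k * fv p |p k. prime p \<and> 1 \<le> k \<and> k < p}"

definition cuntz_rels :: "toeplitz_gen poly_star set"
  where "cuntz_rels =
      {(\<Sum>k<p. (fs ^ k * fv p) * fstar (fs ^ k * fv p)) - 1 |p. prime p}
    \<union> {fs * fstar fs - 1}"

definition toeplitz_alg :: "(nat \<Rightarrow> toeplitz_gen poly_star) set star_algebra"
  where "toeplitz_alg = univ_cstar toeplitz_gens toeplitz_rels"

definition toeplitz_s :: "(nat \<Rightarrow> toeplitz_gen poly_star) set"
  where "toeplitz_s = univ_elt toeplitz_gens toeplitz_rels fs"

definition toeplitz_v :: "nat \<Rightarrow> (nat \<Rightarrow> toeplitz_gen poly_star) set"
  where "toeplitz_v p = univ_elt toeplitz_gens toeplitz_rels (fv p)"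

definition cuntz_ideal :: "(nat \<Rightarrow> toeplitz_gen poly_star) set set"
  where "cuntz_ideal =
    gen_closed_ideal toeplitz_alg (univ_elt toeplitz_gens toeplitz_rels ` cuntz_rels)"

definition cuntz_QN :: "(nat \<Rightarrow> toeplitz_gen poly_star) set set star_algebra"
  where "cuntz_QN = toeplitz_alg CQuot cuntz_ideal"


section \<open>The C*-algebra of a left-cancellative semigroup and its boundary quotient\<close>

definition left_quot :: "('p, 'm) monoid_scheme \<Rightarrow> 'p \<Rightarrow> 'p set \<Rightarrow> 'p set"
  where "left_quot P p X = {y \<in> carrier P. p \<otimes>\<^bsub>P\<^esub> y \<in> X}"

inductive_set constructible_ideals :: "('p, 'm) monoid_scheme \<Rightarrow> 'p set set"
  for P :: "('p, 'm) monoid_scheme" where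
  whole: "carrier P \<in> constructible_ideals P"
| empty: "{} \<in> constructible_ideals P"
| left_mult: "p \<in> carrier P \<Longrightarrow> X \<in> constructible_ideals P \<Longrightarrow>
    p <#\<^bsub>P\<^esub> X \<in> constructible_ideals P"
| left_quot: "p \<in> carrier P \<Longrightarrow> X \<in> constructible_ideals P \<Longrightarrow>
    left_quot P p X \<in> constructible_ideals P"
| inter: "X \<in> constructible_ideals P \<Longrightarrow> Y \<in> constructible_ideals P \<Longrightarrow>
    X \<inter> Y \<in> constructible_ideals P"

datatype 'p sgrp_gen = SV 'p | SE "'p set"

definition sgrp_gens :: "('p, 'm) monoid_scheme \<Rightarrow> 'p sgrp_gen set"
  where "sgrp_gens P = SV ` carrier P \<union> SE ` constructible_ideals P"

abbreviation gv :: "'p \<Rightarrow> 'p sgrp_gen poly_star" where "gv p \<equiv> fgen (SV p)"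
abbreviation ge :: "'p set \<Rightarrow> 'p sgrp_gen poly_star" where "ge X \<equiv> fgen (SE X)"

definition sgrp_rels :: "('p, 'm) monoid_scheme \<Rightarrow> 'p sgrp_gen poly_star set"
  where "sgrp_rels P =
      {fstar (gv p) * gv p - 1 |p. p \<in> carrier P}
    \<union> {fstar (ge X) - ge X |X. X \<in> constructible_ideals P}
    \<union> {ge X * ge X - ge X |X. X \<in> constructible_ideals P}
    \<union> {gv p * gv q - gv (p \<otimes>\<^bsub>P\<^esub> q) |p q. p \<in> carrier P \<and> q \<in> carrier P}
    \<union> {gv p * ge X * fstar (gv p) - ge (p <#\<^bsub>P\<^esub> X) |p X.
          p \<in> carrier P \<and> X \<in> constructible_ideals P}
    \<union> {ge (carrier P) - 1, ge {}}
    \<union> {ge X * ge Y - ge (X \<inter> Y) |X Y.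
          X \<in> constructible_ideals P \<and> Y \<in> constructible_ideals P}"

definition foundation_set :: "('p, 'm) monoid_scheme \<Rightarrow> 'p set \<Rightarrow> bool"
  where "foundation_set P F \<longleftrightarrow> finite F \<and> F \<subseteq> carrier P \<and>
    (\<forall>p\<in>carrier P. \<exists>q\<in>F. (p <#\<^bsub>P\<^esub> carrier P) \<inter> (q <#\<^bsub>P\<^esub> carrier P) \<noteq> {})"

text \<open>
  The factors of the product over a foundation set commute only in the semigroup C*-algebra, not in
  the free *-algebra, so the product is taken along every enumeration of the set; all of these have
  the same image in the semigroup C*-algebra.
\<close>

definition boundary_rels :: "('p, 'm) monoid_scheme \<Rightarrow> 'p sgrp_gen poly_star set"
  where "boundary_rels P =
    {prod_list (map (\<lambda>p. 1 - ge (p <#\<^bsub>P\<^esub> carrier P)) ps) |ps.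
      distinct ps \<and> foundation_set P (set ps)}"

definition sgrp_alg :: "('p, 'm) monoid_scheme \<Rightarrow> (nat \<Rightarrow> 'p sgrp_gen poly_star) set star_algebra"
  where "sgrp_alg P = univ_cstar (sgrp_gens P) (sgrp_rels P)"

definition sgrp_v :: "('p, 'm) monoid_scheme \<Rightarrow> 'p \<Rightarrow> (nat \<Rightarrow> 'p sgrp_gen poly_star) set"
  where "sgrp_v P p = univ_elt (sgrp_gens P) (sgrp_rels P) (gv p)"

definition boundary_ideal :: "('p, 'm) monoid_scheme \<Rightarrow> (nat \<Rightarrow> 'p sgrp_gen poly_star) set set"
  where "boundary_ideal P =
    gen_closed_ideal (sgrp_alg P) (univ_elt (sgrp_gens P) (sgrp_rels P) ` boundary_rels P)"

definition boundary_quot ::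
  "('p, 'm) monoid_scheme \<Rightarrow> (nat \<Rightarrow> 'p sgrp_gen poly_star) set set star_algebra"
  where "boundary_quot P = sgrp_alg P CQuot boundary_ideal P"


section \<open>The semigroup of affine maps of the natural numbers\<close>

definition affN :: "(nat \<times> nat) monoid"
  where "affN =
    \<lparr>carrier = UNIV \<times> {1..}, mult = (\<lambda>(m, a) (n, b). (m + a * n, a * b)), one = (0, 1)\<rparr>"


section \<open>The universal property\<close>

text \<open>
  None of what follows enters the statement; it shows that \<^const>\<open>univ_cstar\<close> is the universal
  C*-algebra whenever the presentation is admissible, and that the presentations above are.
\<close>

lemma poly_star_induct [case_names zero add]:
  fixes x :: "'k \<Rightarrow>\<^sub>0 'c::ab_group_add"
  assumes "P 0"
    and step: "\<And>k c y. c \<noteq> 0 \<Longrightarrow> k \<in> Poly_Mapping.keys x \<Longrightarrow>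
      Poly_Mapping.keys y \<subseteq> Poly_Mapping.keys x \<Longrightarrow> P y \<Longrightarrow> P (Poly_Mapping.single k c + y)"
  shows "P x"
proof -
  have "finite S \<Longrightarrow> (\<forall>y. Poly_Mapping.keys y = S \<and> S \<subseteq> Poly_Mapping.keys x \<longrightarrow> P y)" for S
  proof (induction S rule: finite_induct)
    case empty
    then show ?case using assms(1) by simp
  next
    case (insert k S)
    show ?case
    proof (intro allI impI)
      fix y :: "'k \<Rightarrow>\<^sub>0 'c" assume y: "Poly_Mapping.keys y = insert k S \<and> insert k S \<subseteq> Poly_Mapping.keys x"
      define z where "z = y - Poly_Mapping.single k (Poly_Mapping.lookup y k)"
      have z: "Poly_Mapping.keys z = S"
        using y insert.hyps
        by (auto simp: z_def in_keys_iff lookup_minus lookup_single when_def split: if_splits)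
      have yk: "Poly_Mapping.lookup y k \<noteq> 0" using y by (metis in_keys_iff insertI1)
      have "P (Poly_Mapping.single k (Poly_Mapping.lookup y k) + z)"
        using insert.IH z y yk by (intro step) auto
      then show "P y" by (simp add: z_def)
    qed
  qed
  from this[of "Poly_Mapping.keys x"] show ?thesis by simp
qed

lemma word_star_plus: "word_star (u + v) = word_star v + word_star u"
  by (simp add: word_star_def plus_word_def)

lemma word_star_0 [simp]: "word_star 0 = 0"
  by (simp add: word_star_def zero_word_def)

lemma letters_word_star: "set (letters (word_star w)) = letter_star ` set (letters w)"
  by (simp add: word_star_def)

lemma lookup_fstar [simp]: "Poly_Mapping.lookup (fstar x) w = cnj (Poly_Mapping.lookup x (word_star w))"
  by transfer simp

lemma fstar_add: "fstar (x + y) = fstar x + fstar y"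
  by (rule poly_mapping_eqI) (simp add: lookup_add)

lemma fstar_0 [simp]: "fstar 0 = 0"
  by (rule poly_mapping_eqI) simp

lemma fstar_minus: "fstar (x - y) = fstar x - fstar y"
  by (rule poly_mapping_eqI) (simp add: lookup_minus)

lemma fstar_fstar [simp]: "fstar (fstar x) = x"
  by (rule poly_mapping_eqI) simp

lemma fstar_single: "fstar (Poly_Mapping.single w c) = Poly_Mapping.single (word_star w) (cnj c)"
  by (rule poly_mapping_eqI) (auto simp: lookup_single when_def)

lemma fstar_mult: "fstar (x * y) = fstar y * fstar x"
proof (induction x rule: poly_star_induct)
  case (add k c x')
  have "fstar (Poly_Mapping.single k c * y) = fstar y * fstar (Poly_Mapping.single k c)"
  proof (induction y rule: poly_star_induct)
    case (add l d y')
    then show ?case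
      by (simp add: distrib_left distrib_right fstar_add fstar_single mult_single word_star_plus mult.commute)
  qed simp
  with add show ?case by (simp add: distrib_left distrib_right fstar_add)
qed simp

lemma fstar_1 [simp]: "fstar 1 = 1"
  by (metis fstar_single complex_cnj_one single_one word_star_0)

lemma single0_comm: "Poly_Mapping.single 0 c * x = x * Poly_Mapping.single 0 (c::complex)"
  for x :: "'g poly_star"
proof (induction x rule: poly_star_induct)
  case (add k d y)
  then show ?case by (simp add: distrib_left distrib_right mult_single mult.commute)
qed simp

lemma fscale_mult_left: "fscale c x * y = fscale c (x * y)"
  by (simp add: fscale_def mult.assoc)
lemma fscale_mult_right: "x * fscale c y = fscale c (x * y)"
  unfolding fscale_def by (metis mult.assoc single0_comm)
lemma fscale_add: "fscale c (x + y) = fscale c x + fscale c y"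
  by (simp add: fscale_def distrib_left)
lemma fscale_diff: "fscale c (x - y) = fscale c x - fscale c y"
  by (simp add: fscale_def right_diff_distrib)
lemma fscale_add_left: "fscale (c + d) x = fscale c x + fscale d x"
  by (simp add: fscale_def single_add distrib_right)
lemma fscale_fscale: "fscale c (fscale d x) = fscale (c * d) x"
  by (simp add: fscale_def mult.assoc[symmetric] mult_single)
lemma fscale_1 [simp]: "fscale 1 x = x"
  by (simp add: fscale_def)
lemma fscale_0 [simp]: "fscale 0 x = 0" "fscale c 0 = 0"
  by (simp_all add: fscale_def)
lemma fscale_m1: "fscale (-1) x = - x"
  by (simp add: fscale_def single_uminus)
lemma fstar_fscale: "fstar (fscale c x) = fscale (cnj c) (fstar x)"
  by (simp add: fscale_def fstar_mult fstar_single single0_comm)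
lemma fscale_single: "fscale c (Poly_Mapping.single w d) = Poly_Mapping.single w (c * d)"
  by (simp add: fscale_def mult_single)

lemma fstar_fgen: "fstar (fgen g) = Poly_Mapping.single (Word [Adj g]) 1"
  by (simp add: fgen_def fstar_single word_star_def)

lemma free_0 [simp]: "0 \<in> free_star_alg G" by (simp add: free_star_alg_def)
lemma free_1 [simp]: "1 \<in> free_star_alg G" by (simp add: free_star_alg_def zero_word_def)
lemma free_add [simp]: "x \<in> free_star_alg G \<Longrightarrow> y \<in> free_star_alg G \<Longrightarrow> x + y \<in> free_star_alg G"
  using keys_add[of x y] unfolding free_star_alg_def by blast
lemma free_uminus [simp]: "x \<in> free_star_alg G \<Longrightarrow> - x \<in> free_star_alg G"
  by (auto simp: free_star_alg_def in_keys_iff)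
lemma free_diff [simp]: "x \<in> free_star_alg G \<Longrightarrow> y \<in> free_star_alg G \<Longrightarrow> x - y \<in> free_star_alg G"
  using free_add[OF _ free_uminus, of x G y] by simp
lemma free_mult [simp]: assumes "x \<in> free_star_alg G" "y \<in> free_star_alg G" shows "x * y \<in> free_star_alg G"
  unfolding free_star_alg_def mem_Collect_eq
proof
  fix w assume "w \<in> Poly_Mapping.keys (x * y)"
  then obtain a b where "w = a + b" "a \<in> Poly_Mapping.keys x" "b \<in> Poly_Mapping.keys y"
    using keys_mult[of x y] by blast
  with assms show "set (letters w) \<subseteq> Gen ` G \<union> Adj ` G"
    by (auto simp: free_star_alg_def plus_word_def dest!: bspec)
qed
lemma free_const [simp]: "Poly_Mapping.single 0 c \<in> free_star_alg G"
  by (simp add: free_star_alg_def zero_word_def)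
lemma free_fscale [simp]: "x \<in> free_star_alg G \<Longrightarrow> fscale c x \<in> free_star_alg G"
  by (simp add: fscale_def)
lemma free_fstar [simp]: assumes "x \<in> free_star_alg G" shows "fstar x \<in> free_star_alg G"
  unfolding free_star_alg_def mem_Collect_eq
proof
  fix w assume "w \<in> Poly_Mapping.keys (fstar x)"
  then have "word_star w \<in> Poly_Mapping.keys x" by (simp add: in_keys_iff)
  with assms have "set (letters (word_star w)) \<subseteq> Gen ` G \<union> Adj ` G"
    by (auto simp: free_star_alg_def)
  then have *: "letter_star ` set (letters w) \<subseteq> Gen ` G \<union> Adj ` G" by (simp add: letters_word_star)
  show "set (letters w) \<subseteq> Gen ` G \<union> Adj ` G"
  proof
    fix l assume l: "l \<in> set (letters w)"
    with * have "letter_star l \<in> Gen ` G \<union> Adj ` G" by blast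
    then show "l \<in> Gen ` G \<union> Adj ` G" by (cases l) auto
  qed
qed
lemma free_fgen [simp]: "g \<in> G \<Longrightarrow> fgen g \<in> free_star_alg G"
  by (simp add: free_star_alg_def fgen_def)
lemma free_power [simp]: "x \<in> free_star_alg G \<Longrightarrow> x ^ n \<in> free_star_alg G"
  by (induction n) auto
lemma free_sum [simp]: "(\<And>i. i \<in> I \<Longrightarrow> f i \<in> free_star_alg G) \<Longrightarrow> sum f I \<in> free_star_alg G"
  by (induction I rule: infinite_finite_induct) auto
lemma free_prod_list: "(\<And>i. i \<in> set xs \<Longrightarrow> i \<in> free_star_alg G) \<Longrightarrow> prod_list xs \<in> free_star_alg G"
  by (induction xs) auto

lemma free_induct [consumes 1, case_names one gen adj scale add mult]:
  assumes x: "x \<in> free_star_alg G"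
    and one: "P 1"
    and gen: "\<And>g. g \<in> G \<Longrightarrow> P (fgen g)"
    and adj: "\<And>x. x \<in> free_star_alg G \<Longrightarrow> P x \<Longrightarrow> P (fstar x)"
    and sca: "\<And>c x. x \<in> free_star_alg G \<Longrightarrow> P x \<Longrightarrow> P (fscale c x)"
    and add: "\<And>x y. x \<in> free_star_alg G \<Longrightarrow> y \<in> free_star_alg G \<Longrightarrow> P x \<Longrightarrow> P y \<Longrightarrow> P (x + y)"
    and mul: "\<And>x y. x \<in> free_star_alg G \<Longrightarrow> y \<in> free_star_alg G \<Longrightarrow> P x \<Longrightarrow> P y \<Longrightarrow> P (x * y)"
  shows "P x"
proof -
  have w: "set ls \<subseteq> Gen ` G \<union> Adj ` G \<Longrightarrow> P (Poly_Mapping.single (Word ls) 1) \<and> Poly_Mapping.single (Word ls) (1::complex) \<in> free_star_alg G" for ls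
  proof (induction ls)
    case Nil
    then show ?case using one by (simp add: zero_word_def[symmetric])
  next
    case (Cons l ls)
    have "Poly_Mapping.single (Word (l # ls)) (1::complex)
        = Poly_Mapping.single (Word [l]) 1 * Poly_Mapping.single (Word ls) 1"
      by (simp add: mult_single plus_word_def)
    moreover have "P (Poly_Mapping.single (Word [l]) 1) \<and> Poly_Mapping.single (Word [l]) (1::complex) \<in> free_star_alg G"
    proof -
      from Cons.prems consider g where "g \<in> G" "l = Gen g" | g where "g \<in> G" "l = Adj g" by auto
      then show ?thesis
      proof cases
        case 1
        then show ?thesis using gen[of g] by (simp add: fgen_def free_star_alg_def)
      next
        case 2
        then show ?thesis using adj[OF _ gen[of g]] fstar_fgen[of g]
          by (auto simp add: free_star_alg_def fgen_def)
      qed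
    qed
    ultimately show ?case using Cons by (auto intro: mul)
  qed
  have "x \<in> free_star_alg G \<longrightarrow> P x"
  proof (induction x rule: poly_star_induct)
    case zero
    then show ?case using sca[OF _ one, of 0 ] by simp
  next
    case (add k c y)
    have y: "y \<in> free_star_alg G" using x add by (auto simp: free_star_alg_def)
    have k: "set (letters k) \<subseteq> Gen ` G \<union> Adj ` G" using x add by (auto simp: free_star_alg_def)
    have s: "Poly_Mapping.single k c = fscale c (Poly_Mapping.single (Word (letters k)) 1)"
      by (simp add: fscale_single)
    have "P (Poly_Mapping.single k c)" "Poly_Mapping.single k c \<in> free_star_alg G" using w[OF k] sca s by auto
    then show ?case using y add assms(6) by auto
  qed
  with x show ?thesis by blast
qed

definition admissible :: "'g set \<Rightarrow> 'g poly_star set \<Rightarrow> bool"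
  where "admissible G R \<longleftrightarrow> (\<forall>g\<in>G. \<exists>c. \<forall>p\<in>rel_seminorms G R. p (fgen g) \<le> c)"

context
  fixes G :: "'g set" and p :: "'g poly_star \<Rightarrow> real"
  assumes p: "cstar_seminorm G p"
begin

lemma sn_add: "x \<in> free_star_alg G \<Longrightarrow> y \<in> free_star_alg G \<Longrightarrow> p (x + y) \<le> p x + p y"
  and sn_scale: "x \<in> free_star_alg G \<Longrightarrow> p (fscale c x) = cmod c * p x"
  and sn_mult: "x \<in> free_star_alg G \<Longrightarrow> y \<in> free_star_alg G \<Longrightarrow> p (x * y) \<le> p x * p y"
  and sn_star: "x \<in> free_star_alg G \<Longrightarrow> p (fstar x * x) = (p x)\<^sup>2"
  using p by (auto simp: cstar_seminorm_def)

lemma sn_0: "p 0 = 0"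
  using sn_scale[of 0 0] by simp

lemma sn_uminus: "x \<in> free_star_alg G \<Longrightarrow> p (- x) = p x"
  using sn_scale[of x "-1"] by (simp add: fscale_m1)

lemma sn_nonneg: "x \<in> free_star_alg G \<Longrightarrow> 0 \<le> p x"
  using sn_add[of x "-x"] by (simp add: sn_uminus sn_0)

lemma sn_minus_commute: "x \<in> free_star_alg G \<Longrightarrow> y \<in> free_star_alg G \<Longrightarrow> p (x - y) = p (y - x)"
  using sn_uminus[of "x - y"] by simp

lemma sn_diff: "x \<in> free_star_alg G \<Longrightarrow> y \<in> free_star_alg G \<Longrightarrow> p (x - y) \<le> p x + p y"
  using sn_add[of x "-y"] by (simp add: sn_uminus)

lemma sn_diff_ge: "x \<in> free_star_alg G \<Longrightarrow> y \<in> free_star_alg G \<Longrightarrow> \<bar>p x - p y\<bar> \<le> p (x - y)"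
  using sn_add[of "x - y" y] sn_add[of "y - x" x] sn_minus_commute[of x y] by simp

lemma sn_tri: "x \<in> free_star_alg G \<Longrightarrow> y \<in> free_star_alg G \<Longrightarrow> z \<in> free_star_alg G \<Longrightarrow> p (x - z) \<le> p (x - y) + p (y - z)"
  using sn_add[of "x - y" "y - z"] by simp

lemma sn_1: "p 1 \<le> 1"
proof -
  have "p 1 = (p 1)\<^sup>2" using sn_star[of 1] by simp
  then show ?thesis by (metis dual_order.refl mult_cancel_right1 power2_eq_square zero_le_one)
qed

lemma sn_fstar_le: assumes "x \<in> free_star_alg G" shows "p x \<le> p (fstar x)"
proof -
  have "(p x)\<^sup>2 \<le> p (fstar x) * p x" using sn_star[of x] sn_mult[of "fstar x" x] assms by simp
  then show ?thesis using sn_nonneg[of x] sn_nonneg[of "fstar x"] assms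
    by (cases "p x = 0") (auto simp: power2_eq_square)
qed

lemma sn_fstar: "x \<in> free_star_alg G \<Longrightarrow> p (fstar x) = p x"
  using sn_fstar_le[of x] sn_fstar_le[of "fstar x"] by simp

end

lemma zero_sn: "(\<lambda>_. 0) \<in> rel_seminorms G R"
  by (simp add: rel_seminorms_def cstar_seminorm_def)

lemma admissible_bdd:
  assumes "admissible G R" "x \<in> free_star_alg G"
  shows "bdd_above ((\<lambda>p. p x) ` rel_seminorms G R)"
proof -
  have "\<exists>c\<ge>0. \<forall>p\<in>rel_seminorms G R. p x \<le> c"
    using assms(2)
  proof (induction x rule: free_induct)
    case one
    then show ?case by (intro exI[of _ 1]) (auto simp: rel_seminorms_def intro: sn_1)
  next
    case (gen g)
    with assms(1) obtain c where "\<forall>p\<in>rel_seminorms G R. p (fgen g) \<le> c"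
      unfolding admissible_def by blast
    then show ?case by (intro exI[of _ "max c 0"]) auto
  next
    case (adj x)
    then obtain c where "c \<ge> 0" "\<forall>p\<in>rel_seminorms G R. p x \<le> c" by blast
    with adj show ?case by (intro exI[of _ c]) (auto simp: rel_seminorms_def sn_fstar)
  next
    case (scale d x)
    then obtain c where "c \<ge> 0" "\<forall>p\<in>rel_seminorms G R. p x \<le> c" by blast
    with scale show ?case
      by (intro exI[of _ "cmod d * c"]) (auto simp: rel_seminorms_def sn_scale mult_left_mono)
  next
    case (add x y)
    then obtain c d where "c \<ge> 0" "\<forall>p\<in>rel_seminorms G R. p x \<le> c"
      "d \<ge> 0" "\<forall>p\<in>rel_seminorms G R. p y \<le> d" by blast
    with add show ?case
      by (intro exI[of _ "c + d"]) (fastforce simp: rel_seminorms_def dest: sn_add)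
  next
    case (mult x y)
    then obtain c d where c: "c \<ge> 0" "\<forall>p\<in>rel_seminorms G R. p x \<le> c"
      "d \<ge> 0" "\<forall>p\<in>rel_seminorms G R. p y \<le> d" by blast
    show ?case
    proof (intro exI[of _ "c * d"] conjI ballI)
      fix p assume "p \<in> rel_seminorms G R"
      then have p: "cstar_seminorm G p" and le: "p x \<le> c" "p y \<le> d"
        using c by (auto simp: rel_seminorms_def)
      have "p (x * y) \<le> p x * p y" using sn_mult[OF p] mult by blast
      also have "\<dots> \<le> c * d" using le c mult sn_nonneg[OF p] by (intro mult_mono) auto
      finally show "p (x * y) \<le> c * d" .
    qed (use c in auto)
  qed
  then show ?thesis by (auto simp: bdd_above_def)
qed

locale admissible_presentation =
  fixes G :: "'g set" and R :: "'g poly_star set"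
  assumes adm: "admissible G R"
begin

abbreviation "N \<equiv> univ_norm G R"

lemma le_N: "p \<in> rel_seminorms G R \<Longrightarrow> x \<in> free_star_alg G \<Longrightarrow> p x \<le> N x"
  unfolding univ_norm_def by (rule cSUP_upper[OF _ admissible_bdd[OF adm]])

lemma N_le: "(\<And>p. p \<in> rel_seminorms G R \<Longrightarrow> p x \<le> c) \<Longrightarrow> N x \<le> c"
  unfolding univ_norm_def using zero_sn by (intro cSUP_least) auto

lemma N_nonneg: "x \<in> free_star_alg G \<Longrightarrow> 0 \<le> N x"
  using le_N[OF zero_sn] by simp

lemma N_seminorm: "cstar_seminorm G N"
  unfolding cstar_seminorm_def
proof (intro conjI ballI allI)
  fix x y assume xy: "x \<in> free_star_alg G" "y \<in> free_star_alg G"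
  show "N (x + y) \<le> N x + N y"
  proof (rule N_le)
    fix p assume p: "p \<in> rel_seminorms G R"
    then have "p (x + y) \<le> p x + p y" using xy by (auto simp: rel_seminorms_def intro: sn_add)
    also have "\<dots> \<le> N x + N y" using le_N[OF p] xy by (intro add_mono) auto
    finally show "p (x + y) \<le> N x + N y" .
  qed
  show "N (x * y) \<le> N x * N y"
  proof (rule N_le)
    fix p assume p: "p \<in> rel_seminorms G R"
    then have c: "cstar_seminorm G p" by (simp add: rel_seminorms_def)
    have "p (x * y) \<le> p x * p y" using xy sn_mult[OF c] by auto
    also have "\<dots> \<le> N x * N y" using le_N[OF p] xy sn_nonneg[OF c] N_nonneg by (intro mult_mono) auto
    finally show "p (x * y) \<le> N x * N y" .
  qed
next
  fix c x assume x: "x \<in> free_star_alg G"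
  have le: "N (fscale c x) \<le> cmod c * N x" if x: "x \<in> free_star_alg G" for c x
  proof (rule N_le)
    fix p assume p: "p \<in> rel_seminorms G R"
    then have "p (fscale c x) = cmod c * p x" using x by (auto simp: rel_seminorms_def intro: sn_scale)
    also have "\<dots> \<le> cmod c * N x" using le_N[OF p] x by (intro mult_left_mono) auto
    finally show "p (fscale c x) \<le> cmod c * N x" .
  qed
  show "N (fscale c x) = cmod c * N x"
  proof (cases "c = 0")
    case True
    have "N 0 \<le> 0" by (rule N_le) (auto simp: rel_seminorms_def intro: eq_refl sn_0)
    then show ?thesis using N_nonneg[of 0] True by simp
  next
    case False
    have "N x \<le> cmod (1/c) * N (fscale c x)"
      using le[of "fscale c x" "1/c"] x False by (simp add: fscale_fscale)
    then have "cmod c * N x \<le> N (fscale c x)" using False by (simp add: norm_divide field_simps)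
    with le[OF x, of c] show ?thesis by simp
  qed
next
  fix x assume x: "x \<in> free_star_alg G"
  show "N (fstar x * x) = (N x)\<^sup>2"
  proof (rule antisym)
    show "N (fstar x * x) \<le> (N x)\<^sup>2"
    proof (rule N_le)
      fix p assume p: "p \<in> rel_seminorms G R"
      then have c: "cstar_seminorm G p" by (simp add: rel_seminorms_def)
      show "p (fstar x * x) \<le> (N x)\<^sup>2"
        using sn_star[OF c x] le_N[OF p x] sn_nonneg[OF c x] by (simp add: power_mono)
    qed
    have "N x \<le> sqrt (N (fstar x * x))"
    proof (rule N_le)
      fix p assume p: "p \<in> rel_seminorms G R"
      then have c: "cstar_seminorm G p" by (simp add: rel_seminorms_def)
      have "(p x)\<^sup>2 \<le> N (fstar x * x)" using sn_star[OF c x] le_N[OF p, of "fstar x * x"] x by simp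
      then show "p x \<le> sqrt (N (fstar x * x))" by (rule real_le_rsqrt)
    qed
    then have "(N x)\<^sup>2 \<le> (sqrt (N (fstar x * x)))\<^sup>2" using N_nonneg x by (intro power_mono) auto
    then show "(N x)\<^sup>2 \<le> N (fstar x * x)" using N_nonneg[of "fstar x * x"] x by simp
  qed
qed

lemmas N = sn_add[OF N_seminorm] sn_scale[OF N_seminorm] sn_mult[OF N_seminorm] sn_star[OF N_seminorm]
  sn_0[OF N_seminorm] sn_uminus[OF N_seminorm] sn_1[OF N_seminorm] sn_fstar[OF N_seminorm]
  and N_tri = sn_tri[OF N_seminorm] and N_comm = sn_minus_commute[OF N_seminorm]
  and N_abs = sn_diff_ge[OF N_seminorm]

lemma N_rel: "r \<in> R \<Longrightarrow> r \<in> free_star_alg G \<Longrightarrow> N r = 0"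
  using N_le[of r 0] N_nonneg[of r] by (force simp: rel_seminorms_def)

abbreviation "CS \<equiv> cauchy_seqs G R"
abbreviation "cl \<equiv> seq_class G R"

lemma CS_F [simp]: "X \<in> CS \<Longrightarrow> X n \<in> free_star_alg G"
  by (auto simp: cauchy_seqs_def)

lemma CS_D: "X \<in> CS \<Longrightarrow> e > 0 \<Longrightarrow> \<exists>n0. \<forall>m\<ge>n0. \<forall>n\<ge>n0. N (X m - X n) < e"
  by (auto simp: cauchy_seqs_def)

lemma CS_I: "(\<And>n. X n \<in> free_star_alg G) \<Longrightarrow> (\<And>e. e > 0 \<Longrightarrow> \<exists>n0. \<forall>m\<ge>n0. \<forall>n\<ge>n0. N (X m - X n) < e) \<Longrightarrow> X \<in> CS"
  by (auto simp: cauchy_seqs_def)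

lemma CS_const [simp]: "x \<in> free_star_alg G \<Longrightarrow> (\<lambda>n. x) \<in> CS"
  by (rule CS_I) (auto simp: N)

lemma CS_add [simp]: assumes X: "X \<in> CS" and Y: "Y \<in> CS" shows "(\<lambda>n. X n + Y n) \<in> CS"
proof (rule CS_I)
  fix e :: real assume "e > 0"
  then obtain a b where a: "\<forall>m\<ge>a. \<forall>n\<ge>a. N (X m - X n) < e/2" and b: "\<forall>m\<ge>b. \<forall>n\<ge>b. N (Y m - Y n) < e/2"
    using CS_D[OF X, of "e/2"] CS_D[OF Y, of "e/2"] by auto
  show "\<exists>n0. \<forall>m\<ge>n0. \<forall>n\<ge>n0. N (X m + Y m - (X n + Y n)) < e"
  proof (intro exI[of _ "max a b"] allI impI)
    fix m n assume mn: "max a b \<le> m" "max a b \<le> n"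
    have "N (X m + Y m - (X n + Y n)) \<le> N (X m - X n) + N (Y m - Y n)"
      using N(1)[of "X m - X n" "Y m - Y n"] X Y by (simp add: algebra_simps)
    also have "\<dots> < e/2 + e/2" using a b mn by (intro add_strict_mono) auto
    finally show "N (X m + Y m - (X n + Y n)) < e" by simp
  qed
qed (use X Y in auto)

lemma CS_fstar [simp]: assumes X: "X \<in> CS" shows "(\<lambda>n. fstar (X n)) \<in> CS"
proof (rule CS_I)
  fix e :: real assume "e > 0"
  then show "\<exists>n0. \<forall>m\<ge>n0. \<forall>n\<ge>n0. N (fstar (X m) - fstar (X n)) < e"
    using CS_D[OF X, of e] X by (simp add: fstar_minus[symmetric] N)
qed (use X in auto)

lemma CS_bounded: assumes X: "X \<in> CS" shows "\<exists>B>0. \<forall>n. N (X n) \<le> B"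
proof -
  obtain n0 where n0: "\<forall>m\<ge>n0. \<forall>n\<ge>n0. N (X m - X n) < 1" using CS_D[OF X, of 1] by auto
  define B where "B = Max ((\<lambda>n. N (X n)) ` {..n0}) + 1"
  have fin: "N (X n) \<le> B - 1" if "n \<le> n0" for n using that unfolding B_def by (simp add: Max_ge)
  have "N (X n) \<le> B" for n
  proof (cases "n \<le> n0")
    case True then show ?thesis using fin[of n] by simp
  next
    case False
    then have "N (X n - X n0) < 1" using n0 by auto
    then have "N (X n) \<le> N (X n0) + 1" using N_abs[of "X n" "X n0"] X by simp
    then show ?thesis using fin[of n0] by simp
  qed
  moreover have "B > 0" using fin[of 0] N_nonneg[of "X 0"] X by simp
  ultimately show ?thesis by blast
qed

lemma CS_mult [simp]: assumes X: "X \<in> CS" and Y: "Y \<in> CS" shows "(\<lambda>n. X n * Y n) \<in> CS"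
proof (rule CS_I)
  fix e :: real assume e: "e > 0"
  obtain A B where A: "A > 0" "\<forall>n. N (X n) \<le> A" and B: "B > 0" "\<forall>n. N (Y n) \<le> B"
    using CS_bounded X Y by metis
  obtain a b where a: "\<forall>m\<ge>a. \<forall>n\<ge>a. N (X m - X n) < e/(2*B)" and b: "\<forall>m\<ge>b. \<forall>n\<ge>b. N (Y m - Y n) < e/(2*A)"
    using CS_D[OF X, of "e/(2*B)"] CS_D[OF Y, of "e/(2*A)"] A B e by auto
  show "\<exists>n0. \<forall>m\<ge>n0. \<forall>n\<ge>n0. N (X m * Y m - X n * Y n) < e"
  proof (intro exI[of _ "max a b"] allI impI)
    fix m n assume mn: "max a b \<le> m" "max a b \<le> n"
    have "N (X m * Y m - X n * Y n) = N ((X m - X n) * Y m + X n * (Y m - Y n))"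
      by (simp add: algebra_simps)
    also have "\<dots> \<le> N ((X m - X n) * Y m) + N (X n * (Y m - Y n))" using X Y by (intro N) auto
    also have "\<dots> \<le> N (X m - X n) * N (Y m) + N (X n) * N (Y m - Y n)"
      using X Y by (intro add_mono N) auto
    also have "\<dots> \<le> N (X m - X n) * B + A * N (Y m - Y n)"
      using A B X Y by (intro add_mono mult_left_mono mult_right_mono N_nonneg) auto
    also have "\<dots> < e/(2*B) * B + A * (e/(2*A))"
      using a b mn A B by (intro add_strict_mono mult_strict_left_mono mult_strict_right_mono) auto
    finally show "N (X m * Y m - X n * Y n) < e" using A B by simp
  qed
qed (use X Y in auto)

lemma CS_scale [simp]: assumes X: "X \<in> CS" shows "(\<lambda>n. fscale c (X n)) \<in> CS"
  unfolding fscale_def by (intro CS_mult CS_const X free_const)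

definition eqv where "eqv X Y \<longleftrightarrow> (\<lambda>n. N (X n - Y n)) \<longlonglongrightarrow> 0"

lemma eqvI: assumes "f \<longlonglongrightarrow> 0" "\<And>n. N (X n - Y n) \<le> f n" "\<And>n. X n \<in> free_star_alg G" "\<And>n. Y n \<in> free_star_alg G"
  shows "eqv X Y"
  unfolding eqv_def
  by (rule tendsto_sandwich[OF _ _ tendsto_const assms(1)]) (use assms N_nonneg in auto)

lemma eqv_refl [simp]: "eqv X X" by (simp add: eqv_def N)
lemma eqv_sym: "X \<in> CS \<Longrightarrow> Y \<in> CS \<Longrightarrow> eqv X Y \<Longrightarrow> eqv Y X"
  by (simp add: eqv_def N_comm)
lemma eqv_trans: assumes "X \<in> CS" "Y \<in> CS" "Z \<in> CS" "eqv X Y" "eqv Y Z" shows "eqv X Z"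
proof (rule eqvI)
  show "(\<lambda>n. N (X n - Y n) + N (Y n - Z n)) \<longlonglongrightarrow> 0"
    using assms by (auto simp: eqv_def intro!: tendsto_add_zero)
qed (use assms N_tri in auto)

lemma cl_iff: "Y \<in> cl X \<longleftrightarrow> Y \<in> CS \<and> eqv X Y"
  by (simp add: seq_class_def eqv_def)

lemma cl_eq: assumes "X \<in> CS" "Y \<in> CS" shows "cl X = cl Y \<longleftrightarrow> eqv X Y"
proof
  assume "cl X = cl Y" then have "Y \<in> cl X" using assms cl_iff by auto
  then show "eqv X Y" by (simp add: cl_iff)
next
  assume "eqv X Y"
  then have "Z \<in> cl X \<longleftrightarrow> Z \<in> cl Y" for Z
    using assms eqv_trans[of X Y Z] eqv_trans[of Y X Z] eqv_sym[of X Y] cl_iff[of Z] by blast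
  then show "cl X = cl Y" by blast
qed

lemma cl_eqI: "X \<in> CS \<Longrightarrow> Y \<in> CS \<Longrightarrow> Y \<in> cl X \<Longrightarrow> cl Y = cl X"
  using cl_eq cl_iff by metis

lemma eqv_add: assumes "X \<in> CS" "X' \<in> CS" "Y \<in> CS" "Y' \<in> CS" "eqv X X'" "eqv Y Y'"
  shows "eqv (\<lambda>n. X n + Y n) (\<lambda>n. X' n + Y' n)"
proof (rule eqvI)
  show "(\<lambda>n. N (X n - X' n) + N (Y n - Y' n)) \<longlonglongrightarrow> 0"
    using assms by (auto simp: eqv_def intro!: tendsto_add_zero)
  fix n show "N (X n + Y n - (X' n + Y' n)) \<le> N (X n - X' n) + N (Y n - Y' n)"
    using N(1)[of "X n - X' n" "Y n - Y' n"] assms by (simp add: algebra_simps)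
qed (use assms in auto)

lemma eqv_mult: assumes X: "X \<in> CS" "X' \<in> CS" "Y \<in> CS" "Y' \<in> CS" and e: "eqv X X'" "eqv Y Y'"
  shows "eqv (\<lambda>n. X n * Y n) (\<lambda>n. X' n * Y' n)"
proof -
  obtain A B where A: "A > 0" "\<forall>n. N (X' n) \<le> A" and B: "B > 0" "\<forall>n. N (Y n) \<le> B"
    using CS_bounded X by metis
  show ?thesis
  proof (rule eqvI)
    show "(\<lambda>n. N (X n - X' n) * B + A * N (Y n - Y' n)) \<longlonglongrightarrow> 0"
      using e by (auto simp: eqv_def intro!: tendsto_add_zero tendsto_mult_left_zero tendsto_mult_right_zero)
    fix n
    have "N (X n * Y n - X' n * Y' n) = N ((X n - X' n) * Y n + X' n * (Y n - Y' n))"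
      by (simp add: algebra_simps)
    also have "\<dots> \<le> N ((X n - X' n) * Y n) + N (X' n * (Y n - Y' n))" using X by (intro N) auto
    also have "\<dots> \<le> N (X n - X' n) * N (Y n) + N (X' n) * N (Y n - Y' n)"
      using X by (intro add_mono N) auto
    also have "\<dots> \<le> N (X n - X' n) * B + A * N (Y n - Y' n)"
      using A B X by (intro add_mono mult_left_mono mult_right_mono N_nonneg) auto
    finally show "N (X n * Y n - X' n * Y' n) \<le> N (X n - X' n) * B + A * N (Y n - Y' n)" .
  qed (use X in auto)
qed

lemma eqv_fstar: assumes "X \<in> CS" "X' \<in> CS" "eqv X X'"
  shows "eqv (\<lambda>n. fstar (X n)) (\<lambda>n. fstar (X' n))"
  using assms by (simp add: eqv_def fstar_minus[symmetric] N)

lemma eqv_fscale: assumes "X \<in> CS" "X' \<in> CS" "eqv X X'"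
  shows "eqv (\<lambda>n. fscale c (X n)) (\<lambda>n. fscale c (X' n))"
  unfolding fscale_def by (intro eqv_mult CS_const free_const assms eqv_refl)

abbreviation "UA \<equiv> univ_cstar G R"

lemma UN_cl1: assumes X: "X \<in> CS" and f: "\<And>X'. X' \<in> CS \<Longrightarrow> eqv X X' \<Longrightarrow> f X' \<in> CS \<and> eqv (f X) (f X')"
  shows "(\<Union>Z\<in>cl X. cl (f Z)) = cl (f X)"
proof -
  have "cl (f Z) = cl (f X)" if "Z \<in> cl X" for Z
  proof -
    have Z: "Z \<in> CS" "eqv X Z" using that cl_iff by blast+
    show ?thesis using cl_eq[of "f X" "f Z"] f[OF Z] f[OF X eqv_refl] by simp
  qed
  then have "(\<Union>Z\<in>cl X. cl (f Z)) = (\<Union>Z\<in>cl X. cl (f X))" by (rule SUP_cong[OF refl])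
  moreover have "X \<in> cl X" using X cl_iff by simp
  ultimately show ?thesis by auto
qed

lemma mult_cl: assumes "X \<in> CS" "Y \<in> CS"
  shows "cl X \<otimes>\<^bsub>UA\<^esub> cl Y = cl (\<lambda>n. X n * Y n)"
proof -
  have "cl X \<otimes>\<^bsub>UA\<^esub> cl Y = (\<Union>X'\<in>cl X. cl (\<lambda>n. X' n * Y n))"
  proof -
    have "(\<Union>Y'\<in>cl Y. cl (\<lambda>n. X' n * Y' n)) = cl (\<lambda>n. X' n * Y n)" if "X' \<in> cl X" for X'
      using that assms by (intro UN_cl1) (auto simp: cl_iff intro!: eqv_mult)
    then show ?thesis by (simp add: univ_cstar_def)
  qed
  also have "\<dots> = cl (\<lambda>n. X n * Y n)" using assms by (intro UN_cl1) (auto intro!: eqv_mult)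
  finally show ?thesis .
qed

lemma add_cl: assumes "X \<in> CS" "Y \<in> CS"
  shows "cl X \<oplus>\<^bsub>UA\<^esub> cl Y = cl (\<lambda>n. X n + Y n)"
proof -
  have "cl X \<oplus>\<^bsub>UA\<^esub> cl Y = (\<Union>X'\<in>cl X. cl (\<lambda>n. X' n + Y n))"
  proof -
    have "(\<Union>Y'\<in>cl Y. cl (\<lambda>n. X' n + Y' n)) = cl (\<lambda>n. X' n + Y n)" if "X' \<in> cl X" for X'
      using that assms by (intro UN_cl1) (auto simp: cl_iff intro!: eqv_add)
    then show ?thesis by (simp add: univ_cstar_def)
  qed
  also have "\<dots> = cl (\<lambda>n. X n + Y n)" using assms by (intro UN_cl1) (auto intro!: eqv_add)
  finally show ?thesis .
qed

lemma scale_cl: "X \<in> CS \<Longrightarrow> cscale UA c (cl X) = cl (\<lambda>n. fscale c (X n))"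
  by (simp add: univ_cstar_def) (rule UN_cl1[where f="\<lambda>X n. fscale c (X n)"], auto intro!: eqv_fscale)

lemma adj_cl: "X \<in> CS \<Longrightarrow> adj UA (cl X) = cl (\<lambda>n. fstar (X n))"
  by (simp add: univ_cstar_def) (rule UN_cl1[where f="\<lambda>X n. fstar (X n)"], auto intro!: eqv_fstar)

lemma one_cl: "\<one>\<^bsub>UA\<^esub> = cl (\<lambda>n. 1)" and zero_cl: "\<zero>\<^bsub>UA\<^esub> = cl (\<lambda>n. 0)"
  and carrier_cl: "carrier UA = cl ` CS"
  by (simp_all add: univ_cstar_def)

lemma N_conv: assumes X: "X \<in> CS" shows "convergent (\<lambda>n. N (X n))"
proof -
  have "Cauchy (\<lambda>n. N (X n))"
  proof (rule metric_CauchyI)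
    fix e :: real assume "e > 0"
    then obtain n0 where "\<forall>m\<ge>n0. \<forall>n\<ge>n0. N (X m - X n) < e" using CS_D[OF X] by blast
    then show "\<exists>M. \<forall>m\<ge>M. \<forall>n\<ge>M. dist (N (X m)) (N (X n)) < e"
      unfolding dist_real_def using le_less_trans[OF N_abs] CS_F[OF X] by blast
  qed
  then show ?thesis by (simp add: real_Cauchy_convergent)
qed

lemma norm_cl: assumes X: "X \<in> CS" shows "(\<lambda>n. N (X n)) \<longlonglongrightarrow> cnorm UA (cl X)"
proof -
  define Z where "Z = (SOME Z. Z \<in> cl X)"
  have "Z \<in> cl X" unfolding Z_def by (rule someI[of _ X]) (use X in \<open>simp add: cl_iff\<close>)
  then have Z: "Z \<in> CS" "eqv X Z" by (auto simp: cl_iff)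
  have l: "(\<lambda>n. N (Z n)) \<longlonglongrightarrow> lim (\<lambda>n. N (Z n))"
    using N_conv[OF Z(1)] convergent_LIMSEQ_iff by blast
  have "(\<lambda>n. N (X n) - N (Z n)) \<longlonglongrightarrow> 0"
  proof (rule tendsto_rabs_zero_cancel, rule tendsto_sandwich[OF _ _ tendsto_const])
    show "(\<lambda>n. N (X n - Z n)) \<longlonglongrightarrow> 0" using Z by (simp add: eqv_def)
  qed (use N_abs X Z in auto)
  from tendsto_add[OF this l] have "(\<lambda>n. N (X n)) \<longlonglongrightarrow> lim (\<lambda>n. N (Z n))" by simp
  then show ?thesis by (simp add: univ_cstar_def Z_def)
qed

lemma norm_cl_const: "x \<in> free_star_alg G \<Longrightarrow> cnorm UA (cl (\<lambda>_. x)) = N x"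
  using LIMSEQ_unique[OF tendsto_const norm_cl[of "\<lambda>_. x"]] by simp

lemma cl_cases: assumes "x \<in> carrier UA" obtains X where "X \<in> CS" "x = cl X"
  using assms carrier_cl by auto

lemma CS_zero [simp]: "(\<lambda>n. 0) \<in> CS" and CS_one [simp]: "(\<lambda>n. 1) \<in> CS" by auto

lemma UA_ring: "ring UA"
proof (rule ringI)
  show "abelian_group UA"
  proof (rule abelian_groupI)
    fix x assume "x \<in> carrier UA"
    then obtain X where X: "X \<in> CS" "x = cl X" by (rule cl_cases)
    have "cl (\<lambda>n. fscale (-1) (X n)) \<oplus>\<^bsub>UA\<^esub> x = \<zero>\<^bsub>UA\<^esub>"
      using X add_cl[OF CS_scale[OF X(1), of "-1"] X(1)] by (simp add: zero_cl fscale_m1)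
    then show "\<exists>y\<in>carrier UA. y \<oplus>\<^bsub>UA\<^esub> x = \<zero>\<^bsub>UA\<^esub>"
      using X carrier_cl by auto
  qed (auto elim!: cl_cases simp: add_cl zero_cl carrier_cl algebra_simps)
  show "monoid UA"
    by (rule monoidI) (auto elim!: cl_cases simp: mult_cl one_cl carrier_cl mult.assoc)
qed (auto elim!: cl_cases simp: add_cl mult_cl carrier_cl algebra_simps)

lemma UA_uminus: assumes "X \<in> CS" shows "\<ominus>\<^bsub>UA\<^esub> cl X = cl (\<lambda>n. - X n)"
proof -
  interpret ring UA by (rule UA_ring)
  have m: "(\<lambda>n. - X n) \<in> CS" using CS_scale[OF assms, of "-1"] by (simp add: fscale_m1)
  have "cl (\<lambda>n. - X n) \<oplus>\<^bsub>UA\<^esub> cl X = \<zero>\<^bsub>UA\<^esub>" using assms m by (simp add: add_cl zero_cl)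
  then show ?thesis using minus_equality[of "cl (\<lambda>n. - X n)" "cl X"] assms m carrier_cl by auto
qed

lemma UA_minus: assumes "X \<in> CS" "Y \<in> CS" shows "cl X \<ominus>\<^bsub>UA\<^esub> cl Y = cl (\<lambda>n. X n - Y n)"
proof -
  have m: "(\<lambda>n. - Y n) \<in> CS" using CS_scale[OF assms(2), of "-1"] by (simp add: fscale_m1)
  show ?thesis using assms m by (simp add: a_minus_def UA_uminus add_cl)
qed

lemma CS_diff [simp]: assumes "X \<in> CS" "Y \<in> CS" shows "(\<lambda>n. X n - Y n) \<in> CS"
  using CS_add[OF assms(1) CS_scale[OF assms(2), of "-1"]] by (simp add: fscale_m1)

lemma UA_complete: assumes X: "range X \<subseteq> carrier UA"
  and C: "\<forall>e>0. \<exists>n0. \<forall>m\<ge>n0. \<forall>n\<ge>n0. cnorm UA (X m \<ominus>\<^bsub>UA\<^esub> X n) < e"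
  shows "\<exists>x\<in>carrier UA. (\<lambda>n. cnorm UA (X n \<ominus>\<^bsub>UA\<^esub> x)) \<longlonglongrightarrow> 0"
proof -
  have "\<forall>k. \<exists>Y. Y \<in> CS \<and> X k = cl Y" using X cl_cases by (metis rangeI subsetD)
  then obtain Y where Y: "\<And>k. Y k \<in> CS" "\<And>k. X k = cl (Y k)" by metis
  have "\<forall>k. \<exists>n0. \<forall>m\<ge>n0. \<forall>n\<ge>n0. N (Y k m - Y k n) < 1 / Suc k"
    using CS_D[OF Y(1)] by simp
  then obtain r where r: "\<And>k m n. m \<ge> r k \<Longrightarrow> n \<ge> r k \<Longrightarrow> N (Y k m - Y k n) < 1 / Suc k" by metis
  define Z where "Z k = Y k (r k)" for k
  have ZF [simp]: "Z k \<in> free_star_alg G" for k using Y by (simp add: Z_def)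
  have YF [simp]: "Y k n \<in> free_star_alg G" for k n using Y by simp
  have N_Z: "N (Z k - Z l) \<le> cnorm UA (X k \<ominus>\<^bsub>UA\<^esub> X l) + 1 / Suc k + 1 / Suc l" for k l
  proof (rule LIMSEQ_le_const)
    show "(\<lambda>n. N (Y k n - Y l n) + 1 / Suc k + 1 / Suc l) \<longlonglongrightarrow> cnorm UA (X k \<ominus>\<^bsub>UA\<^esub> X l) + 1 / Suc k + 1 / Suc l"
      using norm_cl[of "\<lambda>n. Y k n - Y l n"] Y by (intro tendsto_add tendsto_const) (simp add: UA_minus)
    have "N (Z k - Z l) \<le> N (Y k n - Y l n) + 1 / Suc k + 1 / Suc l" if "n \<ge> max (r k) (r l)" for n
    proof -
      have "N (Z k - Z l) \<le> N (Z k - Y k n) + (N (Y k n - Y l n) + N (Y l n - Z l))"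
        using N_tri[of "Z k" "Y k n" "Z l"] N_tri[of "Y k n" "Y l n" "Z l"] by simp
      moreover have "N (Z k - Y k n) < 1 / Suc k" "N (Y l n - Z l) < 1 / Suc l"
        using r[of k "r k" n] r[of l n "r l"] that by (auto simp: Z_def)
      ultimately show ?thesis by linarith
    qed
    then show "\<exists>n0. \<forall>n\<ge>n0. N (Z k - Z l) \<le> N (Y k n - Y l n) + 1 / Suc k + 1 / Suc l" by blast
  qed
  have ZC: "\<exists>n0. \<forall>m\<ge>n0. \<forall>n\<ge>n0. N (Z m - Z n) < e" if e: "e > 0" for e
  proof -
    obtain a where a: "\<forall>m\<ge>a. \<forall>n\<ge>a. cnorm UA (X m \<ominus>\<^bsub>UA\<^esub> X n) < e/3" using C e by (meson divide_pos_pos zero_less_numeral)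
    obtain b where b: "1 / Suc b < e/3" using e by (metis divide_pos_pos nat_approx_posE zero_less_numeral)
    have "N (Z m - Z n) < e" if "m \<ge> max a b" "n \<ge> max a b" for m n
    proof -
      have "1 / Suc m \<le> 1 / Suc b" "1 / Suc n \<le> 1 / Suc b" using that by (auto simp: frac_le)
      moreover have "cnorm UA (X m \<ominus>\<^bsub>UA\<^esub> X n) < e/3" using a that by auto
      ultimately show ?thesis using N_Z[of m n] b by linarith
    qed
    then show ?thesis by blast
  qed
  then have Z: "Z \<in> CS" by (intro CS_I) auto
  have "(\<lambda>k. cnorm UA (X k \<ominus>\<^bsub>UA\<^esub> cl Z)) \<longlonglongrightarrow> 0"
  proof (rule LIMSEQ_I)
    fix e :: real assume e: "e > 0"
    obtain a where a: "\<forall>m\<ge>a. \<forall>n\<ge>a. N (Z m - Z n) < e/3" using ZC[of "e/3"] e by auto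
    obtain b where b: "1 / Suc b < e/3" using e by (metis divide_pos_pos nat_approx_posE zero_less_numeral)
    have "norm (cnorm UA (X k \<ominus>\<^bsub>UA\<^esub> cl Z) - 0) < e" if k: "k \<ge> max a b" for k
    proof -
      have l: "(\<lambda>n. N (Y k n - Z n)) \<longlonglongrightarrow> cnorm UA (X k \<ominus>\<^bsub>UA\<^esub> cl Z)"
        using norm_cl[of "\<lambda>n. Y k n - Z n"] Y Z by (simp add: UA_minus)
      have "N (Y k n - Z n) \<le> 2*e/3" if n: "n \<ge> max (r k) a" for n
      proof -
        have "N (Y k n - Z k) < 1 / Suc k" using r[of k n "r k"] n by (simp add: Z_def)
        moreover have "1 / Suc k \<le> 1 / Suc b" using k by (auto simp: frac_le)
        moreover have "N (Z k - Z n) < e/3" using a k n by auto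
        ultimately show ?thesis using N_tri[of "Y k n" "Z k" "Z n"] b by simp
      qed
      then have "cnorm UA (X k \<ominus>\<^bsub>UA\<^esub> cl Z) \<le> 2*e/3" by (intro LIMSEQ_le_const2[OF l]) blast
      moreover have "0 \<le> cnorm UA (X k \<ominus>\<^bsub>UA\<^esub> cl Z)"
        by (intro LIMSEQ_le_const[OF l]) (intro exI allI impI N_nonneg; use Z in simp)
      ultimately show ?thesis using e by simp
    qed
    then show "\<exists>no. \<forall>n\<ge>no. norm (cnorm UA (X n \<ominus>\<^bsub>UA\<^esub> cl Z) - 0) < e" by blast
  qed
  then show ?thesis using Z carrier_cl by auto
qed

lemma UA_cstar: "cstar_algebra UA"
proof -
  interpret ring UA by (rule UA_ring)
  show ?thesis
  proof
    fix x assume "x \<in> carrier UA"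
    then obtain X where X [simp]: "X \<in> CS" and x: "x = cl X" by (rule cl_cases)
    show "cnorm UA x = 0 \<longleftrightarrow> x = \<zero>\<^bsub>UA\<^esub>"
      using norm_cl[OF X] cl_eq[of X "\<lambda>n. 0"] LIMSEQ_unique
      by (auto simp: x zero_cl eqv_def)
    show "cnorm UA (adj UA x \<otimes>\<^bsub>UA\<^esub> x) = (cnorm UA x)\<^sup>2"
    proof (rule LIMSEQ_unique)
      show "(\<lambda>n. N (fstar (X n) * X n)) \<longlonglongrightarrow> cnorm UA (adj UA x \<otimes>\<^bsub>UA\<^esub> x)"
        using norm_cl[of "\<lambda>n. fstar (X n) * X n"] by (simp add: x adj_cl mult_cl)
      show "(\<lambda>n. N (fstar (X n) * X n)) \<longlonglongrightarrow> (cnorm UA x)\<^sup>2"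
        using tendsto_power[OF norm_cl[OF X], of 2] by (simp add: x N)
    qed
    fix c
    show "cnorm UA (cscale UA c x) = cmod c * cnorm UA x"
    proof (rule LIMSEQ_unique)
      show "(\<lambda>n. N (fscale c (X n))) \<longlonglongrightarrow> cnorm UA (cscale UA c x)"
        using norm_cl[of "\<lambda>n. fscale c (X n)"] by (simp add: x scale_cl)
      show "(\<lambda>n. N (fscale c (X n))) \<longlonglongrightarrow> cmod c * cnorm UA x"
        using tendsto_mult_left[OF norm_cl[OF X], of "cmod c"] by (simp add: x N)
    qed
  next
    fix x y assume "x \<in> carrier UA" "y \<in> carrier UA"
    then obtain X Y where X [simp]: "X \<in> CS" and x: "x = cl X" and Y [simp]: "Y \<in> CS" and y: "y = cl Y"
      by (metis cl_cases)
    show "cnorm UA (x \<oplus>\<^bsub>UA\<^esub> y) \<le> cnorm UA x + cnorm UA y"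
    proof (rule LIMSEQ_le)
      show "(\<lambda>n. N (X n + Y n)) \<longlonglongrightarrow> cnorm UA (x \<oplus>\<^bsub>UA\<^esub> y)"
        using norm_cl[of "\<lambda>n. X n + Y n"] by (simp add: x y add_cl)
      show "(\<lambda>n. N (X n) + N (Y n)) \<longlonglongrightarrow> cnorm UA x + cnorm UA y"
        by (simp add: x y tendsto_add norm_cl)
    qed (intro exI allI impI N; simp)
    show "cnorm UA (x \<otimes>\<^bsub>UA\<^esub> y) \<le> cnorm UA x * cnorm UA y"
    proof (rule LIMSEQ_le)
      show "(\<lambda>n. N (X n * Y n)) \<longlonglongrightarrow> cnorm UA (x \<otimes>\<^bsub>UA\<^esub> y)"
        using norm_cl[of "\<lambda>n. X n * Y n"] by (simp add: x y mult_cl)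
      show "(\<lambda>n. N (X n) * N (Y n)) \<longlonglongrightarrow> cnorm UA x * cnorm UA y"
        by (simp add: x y tendsto_mult norm_cl)
    qed (intro exI allI impI N; simp)
  next
    fix X :: "nat \<Rightarrow> (nat \<Rightarrow> 'g poly_star) set"
    assume "range X \<subseteq> carrier UA" "\<forall>e>0. \<exists>N. \<forall>m\<ge>N. \<forall>n\<ge>N. cnorm UA (X m \<ominus>\<^bsub>UA\<^esub> X n) < e"
    then show "\<exists>x\<in>carrier UA. (\<lambda>n. cnorm UA (X n \<ominus>\<^bsub>UA\<^esub> x)) \<longlonglongrightarrow> 0" by (rule UA_complete)
  qed (auto elim!: cl_cases simp: add_cl mult_cl scale_cl adj_cl carrier_cl fscale_fscale fscale_add
        fscale_add_left fscale_mult_left fscale_mult_right fstar_add fstar_mult fstar_fscale)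
qed

end

fun letter_eval :: "('a, 'm) star_algebra_scheme \<Rightarrow> ('g \<Rightarrow> 'a) \<Rightarrow> 'g letter \<Rightarrow> 'a" where
  "letter_eval B f (Gen g) = f g"
| "letter_eval B f (Adj g) = adj B (f g)"

definition word_eval :: "('a, 'm) star_algebra_scheme \<Rightarrow> ('g \<Rightarrow> 'a) \<Rightarrow> 'g word \<Rightarrow> 'a"
  where "word_eval B f w = foldr (\<lambda>l b. letter_eval B f l \<otimes>\<^bsub>B\<^esub> b) (letters w) \<one>\<^bsub>B\<^esub>"

definition free_eval :: "('a, 'm) star_algebra_scheme \<Rightarrow> ('g \<Rightarrow> 'a) \<Rightarrow> 'g poly_star \<Rightarrow> 'a"
  where "free_eval B f x =
    (\<Oplus>\<^bsub>B\<^esub>w\<in>Poly_Mapping.keys x. cscale B (Poly_Mapping.lookup x w) (word_eval B f w))"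

context cstar_algebra
begin

lemma idem_zero: "x \<in> carrier A \<Longrightarrow> x \<oplus> x = x \<oplus> \<zero> \<Longrightarrow> x = \<zero>"
  using add.l_cancel_one[of x x] by simp

lemma scale_zero_right: "cscale A c \<zero> = \<zero>"
proof -
  have "cscale A c \<zero> \<oplus> cscale A c \<zero> = cscale A c \<zero> \<oplus> \<zero>"
    using scale_add_right[of \<zero> \<zero> c] scale_closed by simp
  then show ?thesis by (intro idem_zero scale_closed) auto
qed

lemma scale_zero_left: assumes "x \<in> carrier A" shows "cscale A 0 x = \<zero>"
proof -
  have "cscale A 0 x \<oplus> cscale A 0 x = cscale A 0 x \<oplus> \<zero>"
    using scale_add_left[of x 0 0] scale_closed assms by simp
  then show ?thesis using assms by (intro idem_zero scale_closed) auto
qed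

lemma adj_one: "adj A \<one> = \<one>"
proof -
  have "adj A (adj A \<one> \<otimes> \<one>) = adj A \<one> \<otimes> adj A (adj A \<one>)"
    by (rule adj_mult) (auto intro: adj_closed)
  then show ?thesis using adj_closed[of \<one>] adj_adj[of \<one>] by simp
qed

lemma adj_zero: "adj A \<zero> = \<zero>"
proof -
  have "adj A \<zero> \<oplus> adj A \<zero> = adj A \<zero> \<oplus> \<zero>"
    using adj_add[of \<zero> \<zero>] adj_closed by simp
  then show ?thesis by (intro idem_zero adj_closed) auto
qed

lemma uminus_scale: assumes "x \<in> carrier A" shows "\<ominus> x = cscale A (-1) x"
proof -
  have "cscale A (-1) x \<oplus> x = \<zero>"
    using scale_add_left[of x "-1" 1] scale_one scale_zero_left assms by simp
  then show ?thesis using minus_equality scale_closed assms by simp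
qed

lemma norm_zero: "cnorm A \<zero> = 0" by (simp add: norm_zero_iff)

lemma norm_uminus: "x \<in> carrier A \<Longrightarrow> cnorm A (\<ominus> x) = cnorm A x"
  by (simp add: uminus_scale norm_scale)

lemma norm_nonneg: "x \<in> carrier A \<Longrightarrow> 0 \<le> cnorm A x"
  using norm_triangle[of x "\<ominus> x"] by (simp add: norm_uminus norm_zero r_neg)

lemma norm_minus_commute: assumes "x \<in> carrier A" "y \<in> carrier A"
  shows "cnorm A (x \<ominus> y) = cnorm A (y \<ominus> x)"
  using norm_uminus[of "x \<ominus> y"] assms by (simp add: a_minus_def minus_add a_comm)

lemma norm_minus_triangle: assumes "x \<in> carrier A" "y \<in> carrier A" "z \<in> carrier A"
  shows "cnorm A (x \<ominus> z) \<le> cnorm A (x \<ominus> y) + cnorm A (y \<ominus> z)"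
proof -
  have "x \<ominus> z = (x \<ominus> y) \<oplus> (y \<ominus> z)" using assms by algebra
  then show ?thesis using norm_triangle[of "x \<ominus> y" "y \<ominus> z"] assms by simp
qed

lemma minus_unique_diff: assumes "x \<in> carrier A" "y \<in> carrier A" "x \<ominus> y = \<zero>" shows "x = y"
proof -
  have "x = (x \<ominus> y) \<oplus> y" using assms(1,2) by (simp add: a_minus_def a_assoc l_neg)
  then show ?thesis using assms by simp
qed

lemma norm_minus_zero: "x \<in> carrier A \<Longrightarrow> y \<in> carrier A \<Longrightarrow> cnorm A (x \<ominus> y) = 0 \<Longrightarrow> x = y"
  using norm_zero_iff[of "x \<ominus> y"] minus_unique_diff by simp

definition lim_to where "lim_to X x \<longleftrightarrow> range X \<subseteq> carrier A \<and> x \<in> carrier A \<and> (\<lambda>n. cnorm A (X n \<ominus> x)) \<longlonglongrightarrow> 0"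

lemma lim_toI: assumes "f \<longlonglongrightarrow> 0" "\<And>n. cnorm A (X n \<ominus> x) \<le> f n" "\<And>n. X n \<in> carrier A" "x \<in> carrier A"
  shows "lim_to X x"
  unfolding lim_to_def
  using tendsto_sandwich[OF _ _ tendsto_const assms(1), of "\<lambda>n. cnorm A (X n \<ominus> x)"] assms norm_nonneg by auto

lemma lim_to_unique: assumes "lim_to X x" "lim_to X y" shows "x = y"
proof -
  have c: "\<And>n. X n \<in> carrier A" "x \<in> carrier A" "y \<in> carrier A" using assms by (auto simp: lim_to_def)
  have "(\<lambda>n. cnorm A (X n \<ominus> x) + cnorm A (X n \<ominus> y)) \<longlonglongrightarrow> 0"
    using assms by (auto simp: lim_to_def intro!: tendsto_add_zero)
  moreover have "cnorm A (x \<ominus> y) \<le> cnorm A (X n \<ominus> x) + cnorm A (X n \<ominus> y)" for n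
    using norm_minus_triangle[of x "X n" y] norm_minus_commute[of x "X n"] c by simp
  ultimately have "cnorm A (x \<ominus> y) \<le> 0" by (intro LIMSEQ_le_const) auto
  then show ?thesis using norm_minus_zero norm_nonneg[of "x \<ominus> y"] c by auto
qed

lemma lim_to_const: "x \<in> carrier A \<Longrightarrow> lim_to (\<lambda>n. x) x"
  by (auto simp: lim_to_def norm_zero a_minus_def r_neg)

lemma lim_to_add: assumes "lim_to X x" "lim_to Y y" shows "lim_to (\<lambda>n. X n \<oplus> Y n) (x \<oplus> y)"
proof -
  have c: "\<And>n. X n \<in> carrier A" "x \<in> carrier A" "\<And>n. Y n \<in> carrier A" "y \<in> carrier A"
    using assms by (auto simp: lim_to_def)
  show ?thesis
  proof (rule lim_toI)
    show "(\<lambda>n. cnorm A (X n \<ominus> x) + cnorm A (Y n \<ominus> y)) \<longlonglongrightarrow> 0"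
      using assms by (auto simp: lim_to_def intro!: tendsto_add_zero)
    fix n
    have "X n \<oplus> Y n \<ominus> (x \<oplus> y) = (X n \<ominus> x) \<oplus> (Y n \<ominus> y)" 
      using c by (simp add: a_minus_def minus_add a_ac)
    then show "cnorm A (X n \<oplus> Y n \<ominus> (x \<oplus> y)) \<le> cnorm A (X n \<ominus> x) + cnorm A (Y n \<ominus> y)"
      using norm_triangle c by simp
  qed (use c in auto)
qed

lemma scale_minus: assumes "x \<in> carrier A" "y \<in> carrier A"
  shows "cscale A c (x \<ominus> y) = cscale A c x \<ominus> cscale A c y"
  using assms by (simp add: a_minus_def uminus_scale scale_add_right scale_closed scale_scale mult.commute)

lemma adj_minus: assumes "x \<in> carrier A" "y \<in> carrier A"
  shows "adj A (x \<ominus> y) = adj A x \<ominus> adj A y"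
  using assms by (simp add: a_minus_def uminus_scale adj_add adj_closed adj_scale scale_closed)

lemma norm_adj_le: assumes x: "x \<in> carrier A" shows "cnorm A x \<le> cnorm A (adj A x)"
proof -
  have "(cnorm A x)\<^sup>2 \<le> cnorm A (adj A x) * cnorm A x"
    using norm_adj_mult[of x] norm_mult[of "adj A x" x] x adj_closed by simp
  then show ?thesis using norm_nonneg[of x] norm_nonneg[of "adj A x"] x adj_closed
    by (cases "cnorm A x = 0") (auto simp: power2_eq_square)
qed

lemma norm_adj: "x \<in> carrier A \<Longrightarrow> cnorm A (adj A x) = cnorm A x"
  using norm_adj_le[of x] norm_adj_le[of "adj A x"] by (simp add: adj_closed adj_adj)

lemma lim_to_scale: assumes "lim_to X x" shows "lim_to (\<lambda>n. cscale A c (X n)) (cscale A c x)"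
proof -
  have c: "\<And>n. X n \<in> carrier A" "x \<in> carrier A" using assms by (auto simp: lim_to_def)
  show ?thesis
    using assms c unfolding lim_to_def
    by (auto simp: scale_closed scale_minus[symmetric] norm_scale intro!: tendsto_mult_right_zero)
qed

lemma lim_to_adj: assumes "lim_to X x" shows "lim_to (\<lambda>n. adj A (X n)) (adj A x)"
proof -
  have c: "\<And>n. X n \<in> carrier A" "x \<in> carrier A" using assms by (auto simp: lim_to_def)
  show ?thesis
    using assms c unfolding lim_to_def
    by (auto simp: adj_closed adj_minus[symmetric] norm_adj)
qed

lemma lim_to_mult: assumes "lim_to X x" "lim_to Y y" shows "lim_to (\<lambda>n. X n \<otimes> Y n) (x \<otimes> y)"
proof -
  have c: "\<And>n. X n \<in> carrier A" "x \<in> carrier A" "\<And>n. Y n \<in> carrier A" "y \<in> carrier A"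
    using assms by (auto simp: lim_to_def)
  have l: "(\<lambda>n. cnorm A (X n \<ominus> x)) \<longlonglongrightarrow> 0" "(\<lambda>n. cnorm A (Y n \<ominus> y)) \<longlonglongrightarrow> 0"
    using assms by (auto simp: lim_to_def)
  show ?thesis
  proof (rule lim_toI)
    show "(\<lambda>n. cnorm A (X n \<ominus> x) * (cnorm A (Y n \<ominus> y) + cnorm A y) + cnorm A x * cnorm A (Y n \<ominus> y)) \<longlonglongrightarrow> 0"
      using tendsto_add[OF tendsto_mult[OF l(1) tendsto_add[OF l(2) tendsto_const[of "cnorm A y"]]]
          tendsto_mult[OF tendsto_const[of "cnorm A x"] l(2)]] by simp
    fix n
    have "X n \<otimes> Y n \<ominus> x \<otimes> y = (X n \<ominus> x) \<otimes> Y n \<oplus> x \<otimes> (Y n \<ominus> y)"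
    proof -
      have "(X n \<ominus> x) \<otimes> Y n \<oplus> x \<otimes> (Y n \<ominus> y)
        = (X n \<otimes> Y n \<oplus> \<ominus> (x \<otimes> Y n)) \<oplus> (x \<otimes> Y n \<oplus> \<ominus> (x \<otimes> y))"
        using c by (simp add: a_minus_def l_distr r_distr l_minus r_minus)
      also have "\<dots> = X n \<otimes> Y n \<ominus> x \<otimes> y"
        using c by (simp add: a_minus_def a_assoc r_neg1)
      finally show ?thesis by simp
    qed
    then have "cnorm A (X n \<otimes> Y n \<ominus> x \<otimes> y) \<le> cnorm A ((X n \<ominus> x) \<otimes> Y n) + cnorm A (x \<otimes> (Y n \<ominus> y))"
      using norm_triangle c by simp
    also have "\<dots> \<le> cnorm A (X n \<ominus> x) * cnorm A (Y n) + cnorm A x * cnorm A (Y n \<ominus> y)"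
      using c by (intro add_mono norm_mult) auto
    also have "\<dots> \<le> cnorm A (X n \<ominus> x) * (cnorm A (Y n \<ominus> y) + cnorm A y) + cnorm A x * cnorm A (Y n \<ominus> y)"
    proof -
      have "Y n = (Y n \<ominus> y) \<oplus> y" using c by (simp add: a_minus_def a_assoc l_neg)
      then have "cnorm A (Y n) \<le> cnorm A (Y n \<ominus> y) + cnorm A y"
        using norm_triangle[of "Y n \<ominus> y" y] c by simp
      then show ?thesis using c norm_nonneg by (intro add_mono mult_left_mono) auto
    qed
    finally show "cnorm A (X n \<otimes> Y n \<ominus> x \<otimes> y) \<le> \<dots>" .
  qed (use c in auto)
qed

end

locale gen_map = cstar_algebra B for B :: "('a, 'm) star_algebra_scheme" (structure) +
  fixes G :: "'g set" and f :: "'g \<Rightarrow> 'a"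
  assumes f: "\<And>g. g \<in> G \<Longrightarrow> f g \<in> carrier B"
begin

abbreviation "ev \<equiv> free_eval B f"
abbreviation "wev \<equiv> word_eval B f"

definition "FW = {w::'g word. set (letters w) \<subseteq> Gen ` G \<union> Adj ` G}"

lemma letter_closed: "l \<in> Gen ` G \<union> Adj ` G \<Longrightarrow> letter_eval B f l \<in> carrier B"
  using f adj_closed by auto

lemma wev_closed [simp]: assumes "w \<in> FW" shows "wev w \<in> carrier B"
proof -
  have "set ls \<subseteq> Gen ` G \<union> Adj ` G \<Longrightarrow> foldr (\<lambda>l b. letter_eval B f l \<otimes> b) ls \<one> \<in> carrier B" for ls
    by (induction ls) (auto intro!: letter_closed)
  then show ?thesis using assms by (simp add: FW_def word_eval_def)
qed

lemma FW_plus: "u \<in> FW \<Longrightarrow> v \<in> FW \<Longrightarrow> u + v \<in> FW"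
  by (auto simp: FW_def plus_word_def)

lemma wev_plus: assumes "u \<in> FW" "v \<in> FW" shows "wev (u + v) = wev u \<otimes> wev v"
proof -
  have "set ls \<subseteq> Gen ` G \<union> Adj ` G \<Longrightarrow> wev (Word (ls @ letters v)) = wev (Word ls) \<otimes> wev v" for ls
  proof (induction ls)
    case Nil
    then show ?case using assms by (simp add: word_eval_def[of _ _ "Word []"])
  next
    case (Cons l ls)
    then have "Word ls \<in> FW" "letter_eval B f l \<in> carrier B" by (auto simp: FW_def intro!: letter_closed)
    with Cons assms show ?case
      using wev_closed[of "Word ls"] wev_closed[of v] by (auto simp: word_eval_def m_assoc)
  qed
  then show ?thesis using assms by (simp add: plus_word_def FW_def)
qed

lemma letter_star_eval: "l \<in> Gen ` G \<union> Adj ` G \<Longrightarrow> letter_eval B f (letter_star l) = adj B (letter_eval B f l)"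
  by (auto simp: adj_adj f)

lemma wev_star: assumes "w \<in> FW" shows "wev (word_star w) = adj B (wev w) \<and> word_star w \<in> FW"
proof -
  have "set ls \<subseteq> Gen ` G \<union> Adj ` G \<Longrightarrow> wev (word_star (Word ls)) = adj B (wev (Word ls)) \<and> word_star (Word ls) \<in> FW" for ls
  proof (induction ls)
    case Nil
    then show ?case by (simp add: word_eval_def word_star_def adj_one FW_def)
  next
    case (Cons l ls)
    then have w: "Word ls \<in> FW" "letter_eval B f l \<in> carrier B" by (auto simp: FW_def intro!: letter_closed)
    have ls: "word_star (Word (l # ls)) = word_star (Word ls) + Word [letter_star l]"
      by (simp add: word_star_def plus_word_def)
    have l: "letter_star l \<in> Gen ` G \<union> Adj ` G" using Cons.prems by (cases l) auto
    then have "Word [letter_star l] \<in> FW" by (simp add: FW_def)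
    moreover have "wev (Word [letter_star l]) = adj B (letter_eval B f l)"
      using letter_closed[OF l] Cons.prems letter_star_eval[of l] by (simp add: word_eval_def)
    moreover have "wev (Word (l # ls)) = letter_eval B f l \<otimes> wev (Word ls)" by (simp add: word_eval_def)
    ultimately show ?case using Cons w by (auto simp: ls wev_plus adj_mult FW_plus)
  qed
  from this[of "letters w"] show ?thesis using assms by (simp add: FW_def)
qed

lemma F_FW: "x \<in> free_star_alg G \<longleftrightarrow> Poly_Mapping.keys x \<subseteq> FW"
  by (auto simp: free_star_alg_def FW_def)

lemma ev_superset: assumes "x \<in> free_star_alg G" "finite S" "Poly_Mapping.keys x \<subseteq> S" "S \<subseteq> FW"
  shows "ev x = (\<Oplus>w\<in>S. cscale B (Poly_Mapping.lookup x w) (wev w))"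
  unfolding free_eval_def
  by (rule add.finprod_mono_neutral_cong_left)
     (use assms in \<open>auto simp: in_keys_iff scale_zero_left scale_closed subset_iff\<close>)

lemma ev_closed [simp]: "x \<in> free_star_alg G \<Longrightarrow> ev x \<in> carrier B"
  unfolding free_eval_def F_FW by (rule finsum_closed) (auto intro!: scale_closed)

lemma ev_add: assumes "x \<in> free_star_alg G" "y \<in> free_star_alg G" shows "ev (x + y) = ev x \<oplus> ev y"
proof -
  let ?S = "Poly_Mapping.keys x \<union> Poly_Mapping.keys y"
  have S: "finite ?S" "?S \<subseteq> FW" using assms F_FW by auto
  have cl: "\<And>w c. w \<in> ?S \<Longrightarrow> cscale B c (wev w) \<in> carrier B" using S by (auto intro!: scale_closed)
  have "ev (x + y) = (\<Oplus>w\<in>?S. cscale B (Poly_Mapping.lookup (x + y) w) (wev w))"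
    using assms S keys_add[of x y] by (intro ev_superset) auto
  also have "\<dots> = (\<Oplus>w\<in>?S. cscale B (Poly_Mapping.lookup x w) (wev w) \<oplus> cscale B (Poly_Mapping.lookup y w) (wev w))"
    using S cl by (intro add.finprod_cong') (auto simp: lookup_add intro!: scale_add_left)
  also have "\<dots> = (\<Oplus>w\<in>?S. cscale B (Poly_Mapping.lookup x w) (wev w)) \<oplus> (\<Oplus>w\<in>?S. cscale B (Poly_Mapping.lookup y w) (wev w))"
    using cl by (intro finsum_addf) auto
  also have "\<dots> = ev x \<oplus> ev y" using assms S by (simp add: ev_superset[of _ ?S])
  finally show ?thesis .
qed

lemma ev_0: "ev 0 = \<zero>" by (simp add: free_eval_def)

lemma ev_single: "w \<in> FW \<Longrightarrow> ev (Poly_Mapping.single w c) = cscale B c (wev w)"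
  using ev_superset[of "Poly_Mapping.single w c" "{w}"] by (simp add: F_FW scale_closed split: if_splits)

lemma single_F: "w \<in> FW \<Longrightarrow> Poly_Mapping.single w c \<in> free_star_alg G"
  by (simp add: F_FW split: if_splits)

lemma ev_mult: assumes "x \<in> free_star_alg G" "y \<in> free_star_alg G" shows "ev (x * y) = ev x \<otimes> ev y"
proof -
  have 1: "ev (Poly_Mapping.single k c * y) = ev (Poly_Mapping.single k c) \<otimes> ev y" if k: "k \<in> FW" for k c
  proof -
    have "y \<in> free_star_alg G \<longrightarrow> ev (Poly_Mapping.single k c * y) = ev (Poly_Mapping.single k c) \<otimes> ev y"
    proof (induction y rule: poly_star_induct)
      case zero
      then show ?case using k by (simp add: ev_0 single_F)
    next
      case (add l d z)
      show ?case
      proof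
        have z: "z \<in> free_star_alg G" using add assms F_FW by blast
        have l: "l \<in> FW" using add assms F_FW by blast
        have "ev (Poly_Mapping.single k c * Poly_Mapping.single l d) = ev (Poly_Mapping.single k c) \<otimes> ev (Poly_Mapping.single l d)"
          using k l by (simp add: mult_single ev_single FW_plus wev_plus scale_mult_left scale_mult_right scale_closed scale_scale mult.commute)
        then show "ev (Poly_Mapping.single k c * (Poly_Mapping.single l d + z)) = ev (Poly_Mapping.single k c) \<otimes> ev (Poly_Mapping.single l d + z)"
          using add z k l by (simp add: distrib_left ev_add single_F r_distr)
      qed
    qed
    then show ?thesis using assms by simp
  qed
  have "x \<in> free_star_alg G \<longrightarrow> ev (x * y) = ev x \<otimes> ev y"
  proof (induction x rule: poly_star_induct)
    case zero
    then show ?case using assms by (simp add: ev_0)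
  next
    case (add l d z)
    have z: "z \<in> free_star_alg G" using add assms F_FW by blast
    have l: "l \<in> FW" using add assms F_FW by blast
    show ?case using 1[OF l] add z l assms by (simp add: distrib_right ev_add single_F l_distr)
  qed
  then show ?thesis using assms by simp
qed

lemma ev_star: assumes "x \<in> free_star_alg G" shows "ev (fstar x) = adj B (ev x)"
proof -
  have "x \<in> free_star_alg G \<longrightarrow> ev (fstar x) = adj B (ev x)"
  proof (induction x rule: poly_star_induct)
    case zero
    then show ?case by (simp add: ev_0 adj_zero)
  next
    case (add l d z)
    have z: "z \<in> free_star_alg G" using add assms F_FW by blast
    have l: "l \<in> FW" using add assms F_FW by blast
    show ?case using add z l assms wev_star[OF l]
      by (simp add: fstar_add fstar_single ev_add single_F ev_single adj_scale adj_add scale_closed)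
  qed
  then show ?thesis using assms by simp
qed

lemma zero_FW: "0 \<in> FW" by (simp add: FW_def zero_word_def)

lemma wev_0: "wev 0 = \<one>" by (simp add: word_eval_def zero_word_def)

lemma ev_one: "ev 1 = \<one>"
  using ev_single[OF zero_FW, of 1] by (simp add: wev_0 scale_one)

lemma ev_scale: assumes "x \<in> free_star_alg G" shows "ev (fscale c x) = cscale B c (ev x)"
  unfolding fscale_def using assms
  by (simp add: ev_mult ev_single zero_FW wev_0 scale_mult_left)

lemma ev_gen: "g \<in> G \<Longrightarrow> ev (fgen g) = f g"
  unfolding fgen_def using ev_single[of "Word [Gen g]" 1] f
  by (simp add: FW_def word_eval_def scale_one)

lemma ev_diff: assumes "x \<in> free_star_alg G" "y \<in> free_star_alg G" shows "ev (x - y) = ev x \<ominus> ev y"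
  using ev_add[of x "fscale (-1) y"] assms
  by (simp add: ev_scale fscale_m1 a_minus_def uminus_scale del: fscale_m1) (simp add: fscale_m1)

lemma ev_seminorm: "cstar_seminorm G (\<lambda>x. cnorm B (ev x))"
  unfolding cstar_seminorm_def
  by (auto simp: ev_add ev_scale ev_mult ev_star norm_triangle norm_scale norm_mult norm_adj_mult)

end

theorem univ_cstar_universal:
  assumes adm: "admissible G R" and "cstar_algebra B"
    and f: "\<And>g. g \<in> G \<Longrightarrow> f g \<in> carrier B" and R: "\<And>r. r \<in> R \<Longrightarrow> free_eval B f r = \<zero>\<^bsub>B\<^esub>"
  shows "\<exists>\<phi>\<in>star_hom (univ_cstar G R) B. (\<forall>g\<in>G. \<phi> (univ_elt G R (fgen g)) = f g)"
proof -
  interpret gen_map B G f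
    using assms(2) f by (simp add: gen_map_def gen_map_axioms_def)
  interpret admissible_presentation G R by unfold_locales (rule adm)
  have evR: "(\<lambda>x. cnorm B (ev x)) \<in> rel_seminorms G R"
    using ev_seminorm R by (simp add: rel_seminorms_def norm_zero)
  have le: "cnorm B (ev x) \<le> univ_norm G R x" if "x \<in> free_star_alg G" for x
    using le_N[OF evR that] .
  have ex: "\<exists>b. lim_to (\<lambda>n. ev (X n)) b" if X: "X \<in> cauchy_seqs G R" for X
  proof -
    have XF: "\<And>n. X n \<in> free_star_alg G" using CS_F[OF X] .
    have "\<forall>e>0. \<exists>N. \<forall>m\<ge>N. \<forall>n\<ge>N. cnorm B (ev (X m) \<ominus>\<^bsub>B\<^esub> ev (X n)) < e"
    proof (intro allI impI)
      fix e :: real assume "e > 0"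
      then obtain N where N: "\<forall>m\<ge>N. \<forall>n\<ge>N. univ_norm G R (X m - X n) < e" using CS_D[OF X] by blast
      have "cnorm B (ev (X m) \<ominus>\<^bsub>B\<^esub> ev (X n)) < e" if "m \<ge> N" "n \<ge> N" for m n
        using le[of "X m - X n"] N that XF by (fastforce simp: ev_diff)
      then show "\<exists>N. \<forall>m\<ge>N. \<forall>n\<ge>N. cnorm B (ev (X m) \<ominus>\<^bsub>B\<^esub> ev (X n)) < e" by blast
    qed
    moreover have r: "range (\<lambda>n. ev (X n)) \<subseteq> carrier B" using XF by auto
    ultimately obtain b where "b \<in> carrier B" "(\<lambda>n. cnorm B (ev (X n) \<ominus>\<^bsub>B\<^esub> b)) \<longlonglongrightarrow> 0"
      using complete[of "\<lambda>n. ev (X n)"] by blast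
    with r show ?thesis unfolding lim_to_def by blast
  qed
  define \<phi> where "\<phi> a = (THE b. \<exists>X\<in>a. lim_to (\<lambda>n. ev (X n)) b)" for a
  have phi: "\<phi> (seq_class G R X) = b" if X: "X \<in> cauchy_seqs G R" and b: "lim_to (\<lambda>n. ev (X n)) b" for X b
    unfolding \<phi>_def
  proof (rule the_equality)
    show "\<exists>X\<in>seq_class G R X. lim_to (\<lambda>n. ev (X n)) b"
      using b X by (intro bexI[of _ X]) (auto simp: cl_iff eqv_refl)
    fix c assume "\<exists>Y\<in>seq_class G R X. lim_to (\<lambda>n. ev (Y n)) c"
    then obtain Y where Y: "Y \<in> cauchy_seqs G R" "(\<lambda>n. univ_norm G R (X n - Y n)) \<longlonglongrightarrow> 0"
      and c: "lim_to (\<lambda>n. ev (Y n)) c" by (auto simp: seq_class_def)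
    have F: "\<And>n. X n \<in> free_star_alg G" "\<And>n. Y n \<in> free_star_alg G" using CS_F[OF X] CS_F[OF Y(1)] by auto
    have bc: "b \<in> carrier B" "c \<in> carrier B" using b c by (auto simp: lim_to_def)
    have "lim_to (\<lambda>n. ev (X n)) c"
    proof (rule lim_toI)
      show "(\<lambda>n. univ_norm G R (X n - Y n) + cnorm B (ev (Y n) \<ominus>\<^bsub>B\<^esub> c)) \<longlonglongrightarrow> 0"
        using Y(2) c by (auto simp: lim_to_def intro!: tendsto_add_zero)
      fix n
      have "cnorm B (ev (X n) \<ominus>\<^bsub>B\<^esub> c) \<le> cnorm B (ev (X n) \<ominus>\<^bsub>B\<^esub> ev (Y n)) + cnorm B (ev (Y n) \<ominus>\<^bsub>B\<^esub> c)"
        using F bc by (intro norm_minus_triangle) auto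
      then show "cnorm B (ev (X n) \<ominus>\<^bsub>B\<^esub> c) \<le> univ_norm G R (X n - Y n) + cnorm B (ev (Y n) \<ominus>\<^bsub>B\<^esub> c)"
        using le[of "X n - Y n"] F by (simp add: ev_diff)
    qed (use F bc in auto)
    then show "c = b" using lim_to_unique b by blast
  qed
  have L: "lim_to (\<lambda>n. ev (X n)) (\<phi> (seq_class G R X))" if X: "X \<in> cauchy_seqs G R" for X
    using ex[OF X] phi[OF X] by metis
  have Lc: "\<phi> (seq_class G R X) \<in> carrier B" if X: "X \<in> cauchy_seqs G R" for X
    using L[OF X] by (simp add: lim_to_def)
  have "\<phi> \<in> star_hom (univ_cstar G R) B"
    unfolding star_hom_def mem_Collect_eq
  proof (intro conjI allI ballI ring_hom_memI)
    fix a assume "a \<in> carrier (univ_cstar G R)"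
    then obtain X where X: "X \<in> cauchy_seqs G R" "a = seq_class G R X" by (rule cl_cases)
    have F: "\<And>n. X n \<in> free_star_alg G" using CS_F[OF X(1)] .
    show "\<phi> a \<in> carrier B" using Lc X by simp
    show "\<phi> (cscale (univ_cstar G R) c a) = cscale B c (\<phi> a)" for c
      using lim_to_scale[OF L[OF X(1)], of c] F
      by (simp add: X scale_cl phi CS_scale ev_scale)
    show "\<phi> (adj (univ_cstar G R) a) = adj B (\<phi> a)"
      using lim_to_adj[OF L[OF X(1)]] F
      by (simp add: X adj_cl phi CS_fstar ev_star)
    fix b assume "b \<in> carrier (univ_cstar G R)"
    then obtain Y where Y: "Y \<in> cauchy_seqs G R" "b = seq_class G R Y" by (rule cl_cases)
    have FY: "\<And>n. Y n \<in> free_star_alg G" using CS_F[OF Y(1)] .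
    show "\<phi> (a \<otimes>\<^bsub>univ_cstar G R\<^esub> b) = \<phi> a \<otimes>\<^bsub>B\<^esub> \<phi> b"
      using lim_to_mult[OF L[OF X(1)] L[OF Y(1)]] F FY
      by (simp add: X Y mult_cl phi CS_mult ev_mult)
    show "\<phi> (a \<oplus>\<^bsub>univ_cstar G R\<^esub> b) = \<phi> a \<oplus>\<^bsub>B\<^esub> \<phi> b"
      using lim_to_add[OF L[OF X(1)] L[OF Y(1)]] F FY
      by (simp add: X Y add_cl phi CS_add ev_add)
  next
    show "\<phi> \<one>\<^bsub>univ_cstar G R\<^esub> = \<one>\<^bsub>B\<^esub>"
      using lim_to_const[of "\<one>\<^bsub>B\<^esub>"] by (simp add: one_cl phi CS_const ev_one)
  qed
  moreover have "\<phi> (univ_elt G R (fgen g)) = f g" if "g \<in> G" for g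
    using that lim_to_const[of "f g"] f
    by (simp add: univ_elt_def phi CS_const ev_gen)
  ultimately show ?thesis by blast
qed

lemma univ_elt_rel:
  assumes "admissible G R" and "r \<in> R" and "r \<in> free_star_alg G"
  shows "univ_elt G R r = \<zero>\<^bsub>univ_cstar G R\<^esub>"
proof -
  interpret admissible_presentation G R by unfold_locales fact
  show ?thesis
    using assms N_rel[of r] cl_eq[of "\<lambda>n. r" "\<lambda>n. 0"] by (simp add: univ_elt_def zero_cl eqv_def)
qed

lemma univ_elt_dense:
  assumes "admissible G R" and "a \<in> carrier (univ_cstar G R)" and "e > 0"
  shows "\<exists>x\<in>free_star_alg G. cnorm (univ_cstar G R) (a \<ominus>\<^bsub>univ_cstar G R\<^esub> univ_elt G R x) < e"
proof -
  interpret admissible_presentation G R by unfold_locales fact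
  obtain X where X: "X \<in> cauchy_seqs G R" "a = seq_class G R X" using assms(2) by (rule cl_cases)
  obtain m where m: "\<forall>i\<ge>m. \<forall>j\<ge>m. univ_norm G R (X i - X j) < e / 2"
    using CS_D[OF X(1), of "e / 2"] assms(3) by auto
  have "cnorm (univ_cstar G R) (a \<ominus>\<^bsub>univ_cstar G R\<^esub> univ_elt G R (X m)) \<le> e / 2"
  proof (rule LIMSEQ_le_const2)
    show "(\<lambda>n. univ_norm G R (X n - X m)) \<longlonglongrightarrow>
        cnorm (univ_cstar G R) (a \<ominus>\<^bsub>univ_cstar G R\<^esub> univ_elt G R (X m))"
      using norm_cl[of "\<lambda>n. X n - X m"] X by (simp add: univ_elt_def UA_minus)
    show "\<exists>n0. \<forall>n\<ge>n0. univ_norm G R (X n - X m) \<le> e / 2"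
      using m by (intro exI[of _ m]) (auto intro: less_imp_le)
  qed
  then show ?thesis using X(1) assms(3) by (intro bexI[of _ "X m"]) auto
qed

lemma rel_isometry_bound:
  assumes "p \<in> rel_seminorms G R" and "g \<in> G" and "fstar (fgen g) * fgen g - 1 \<in> R"
  shows "p (fgen g) \<le> 1"
proof -
  have p: "cstar_seminorm G p" "p (fstar (fgen g) * fgen g - 1) = 0"
    using assms by (auto simp: rel_seminorms_def)
  have "(p (fgen g))\<^sup>2 \<le> p (fstar (fgen g) * fgen g - 1) + p 1"
    using sn_star[OF p(1), of "fgen g"] sn_add[OF p(1), of "fstar (fgen g) * fgen g - 1" 1] assms(2)
    by simp
  then have "(p (fgen g))\<^sup>2 \<le> 1" using p(2) sn_1[OF p(1)] by simp
  then show ?thesis by (simp add: abs_square_le_1)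
qed

lemma rel_projection_bound:
  assumes "p \<in> rel_seminorms G R" and "g \<in> G"
    and "fstar (fgen g) - fgen g \<in> R" and "fgen g * fgen g - fgen g \<in> R"
  shows "p (fgen g) \<le> 1"
proof -
  let ?x = "fgen g"
  have p: "cstar_seminorm G p" "p (fstar ?x - ?x) = 0" "p (?x * ?x - ?x) = 0"
    using assms by (auto simp: rel_seminorms_def)
  have "fstar ?x * ?x = (fstar ?x - ?x) * ?x + ((?x * ?x - ?x) + ?x)"
    by (simp add: algebra_simps)
  then have "(p ?x)\<^sup>2 \<le> p ((fstar ?x - ?x) * ?x) + p ((?x * ?x - ?x) + ?x)"
    using sn_star[OF p(1), of ?x] sn_add[OF p(1), of "(fstar ?x - ?x) * ?x" "(?x * ?x - ?x) + ?x"] assms(2)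
    by simp
  also have "\<dots> \<le> p (fstar ?x - ?x) * p ?x + (p (?x * ?x - ?x) + p ?x)"
    using assms(2) by (intro add_mono sn_mult[OF p(1)] sn_add[OF p(1)]) auto
  finally have "(p ?x)\<^sup>2 \<le> p ?x" using p by simp
  moreover have False if "1 < p ?x" using mult_strict_right_mono[OF that, of "p ?x"] that calculation
    by (simp add: power2_eq_square)
  ultimately show ?thesis by fastforce
qed


section \<open>Admissibility of the presentations\<close>

lemma toeplitz_rels_free: "toeplitz_rels \<subseteq> free_star_alg toeplitz_gens"
proof -
  have "GS \<in> toeplitz_gens" "\<And>p. prime p \<Longrightarrow> GV p \<in> toeplitz_gens"
    by (auto simp: toeplitz_gens_def)
  then show ?thesis unfolding toeplitz_rels_def by auto
qed

lemma toeplitz_admissible: "admissible toeplitz_gens toeplitz_rels"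
  unfolding admissible_def
proof
  fix g assume g: "g \<in> toeplitz_gens"
  then have "fstar (fgen g) * fgen g - 1 \<in> toeplitz_rels"
    by (auto simp: toeplitz_gens_def toeplitz_rels_def)
  then show "\<exists>c. \<forall>p\<in>rel_seminorms toeplitz_gens toeplitz_rels. p (fgen g) \<le> c"
    using rel_isometry_bound[OF _ g] by blast
qed

lemma cuntz_rels_free: "cuntz_rels \<subseteq> free_star_alg toeplitz_gens"
proof -
  have "GS \<in> toeplitz_gens" "\<And>p. prime p \<Longrightarrow> GV p \<in> toeplitz_gens"
    by (auto simp: toeplitz_gens_def)
  then show ?thesis unfolding cuntz_rels_def by (auto intro!: free_diff free_sum)
qed

lemma sgrp_rels_free: assumes "monoid P" shows "sgrp_rels P \<subseteq> free_star_alg (sgrp_gens P)"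
proof -
  interpret monoid P by fact
  have "\<And>p. p \<in> carrier P \<Longrightarrow> SV p \<in> sgrp_gens P"
    "\<And>X. X \<in> constructible_ideals P \<Longrightarrow> SE X \<in> sgrp_gens P"
    by (auto simp: sgrp_gens_def)
  then show ?thesis unfolding sgrp_rels_def
    by (auto simp: constructible_ideals.intros)
qed

lemma sgrp_admissible: "admissible (sgrp_gens P) (sgrp_rels P)"
  unfolding admissible_def
proof
  fix g assume g: "g \<in> sgrp_gens P"
  have "p (fgen g) \<le> 1" if p: "p \<in> rel_seminorms (sgrp_gens P) (sgrp_rels P)" for p
  proof (cases g)
    case (SV x)
    then have "x \<in> carrier P" using g by (auto simp: sgrp_gens_def)
    then have "fstar (fgen g) * fgen g - 1 \<in> sgrp_rels P"
      unfolding SV sgrp_rels_def by blast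
    with p g show ?thesis by (rule rel_isometry_bound)
  next
    case (SE X)
    then have "X \<in> constructible_ideals P" using g by (auto simp: sgrp_gens_def)
    then have "fstar (fgen g) - fgen g \<in> sgrp_rels P" "fgen g * fgen g - fgen g \<in> sgrp_rels P"
      unfolding SE sgrp_rels_def by blast+
    with p g show ?thesis by (rule rel_projection_bound)
  qed
  then show "\<exists>c. \<forall>p\<in>rel_seminorms (sgrp_gens P) (sgrp_rels P). p (fgen g) \<le> c"
    by blast
qed

lemma boundary_rels_free: "boundary_rels P \<subseteq> free_star_alg (sgrp_gens P)"
proof -
  have "ge (p <#\<^bsub>P\<^esub> carrier P) \<in> free_star_alg (sgrp_gens P)" if "p \<in> carrier P" for p
    using that by (intro free_fgen) (auto simp: sgrp_gens_def constructible_ideals.intros)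
  then show ?thesis
    unfolding boundary_rels_def by (auto simp: foundation_set_def subset_iff intro!: free_prod_list free_diff)
qed

lemma monoid_affN: "monoid affN"
  by (rule monoidI) (auto simp: affN_def algebra_simps)

theorem toeplitz_alg_cstar: "cstar_algebra toeplitz_alg"
  unfolding toeplitz_alg_def
  by (rule admissible_presentation.UA_cstar) (unfold_locales, rule toeplitz_admissible)

theorem sgrp_alg_cstar: "cstar_algebra (sgrp_alg P)"
  unfolding sgrp_alg_def
  by (rule admissible_presentation.UA_cstar) (unfold_locales, rule sgrp_admissible)
end

theory Submission
  imports Defs "HOL-Number_Theory.Cong"
begin

text \<open>
  Write \<open>P\<close> for the affine semigroup, \<open>V\<^sub>x\<close> for the isometries of its C*-algebra and \<open>s\<close>, \<open>v\<^sub>p\<close> for the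
  generators of the Toeplitz algebra.  Both algebras are given by presentations, so a homomorphism
  out of either of them amounts to elements of the target that satisfy the relations.  It therefore
  suffices to find the relations of each algebra inside the other one.

  The heart of the matter is the covariance relation \<open>e\<^sub>X e\<^sub>Y = e\<^bsub>X \<inter> Y\<^esub>\<close>.  The nonempty
  constructible ideals are the principal ones, and \<open>e\<^bsub>xP\<^esub> = V\<^sub>x V\<^sub>x\<^sup>*\<close>.  If \<open>xP \<inter> yP = zP\<close> with
  \<open>z = xp = yq\<close>, the relation for \<open>xP\<close> and \<open>yP\<close> says exactly that \<open>V\<^sub>x\<^sup>* V\<^sub>y = V\<^sub>p V\<^sub>q\<^sup>*\<close>; if \<open>xP\<close> and
  \<open>yP\<close> are disjoint, it says that \<open>V\<^sub>x\<^sup>* V\<^sub>y = 0\<close>.  The three mixed Toeplitz relations with adjoints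
  are the instances \<open>(0,p), (0,q)\<close>, then \<open>(1,1), (0,p)\<close>, and finally \<open>(0,p), (k,p)\<close>; this is
  \<open>toeplitz_rep_affN\<close>.  For the converse, put \<open>V\<^bsub>(m,a)\<^esub> = s\<^sup>m v\<^sub>a\<close>, where \<open>v\<^sub>a\<close> is the product of the
  commuting isometries \<open>v\<^sub>p\<close> over the prime factors of \<open>a\<close>; the relation \<open>v\<^sub>p s = s\<^sup>p v\<^sub>p\<close> makes this
  multiplicative.  The products \<open>V\<^sub>x\<^sup>* V\<^sub>y\<close> become \<open>v\<^sub>a\<^sup>* s\<^sup>k v\<^sub>b\<close> (up to adjoints).  The greatest common
  divisor of \<open>a\<close> and \<open>b\<close> makes this product vanish unless it divides \<open>k\<close> (\<open>vn_S_vn_zero\<close>), and it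
  cancels if it does.  For coprime \<open>a\<close> and \<open>b\<close>, lemma \<open>vn_S_step\<close> replaces \<open>k\<close> by \<open>k + b\<close> until \<open>a\<close>
  divides the exponent, and the number of steps is precisely what determines the least common
  multiple \<open>z\<close>.  This is \<open>vn_S_coprime\<close>, and it leads to \<open>sgrp_rep_affN\<close>.

  The two homomorphisms are mutually inverse on generators.  To conclude that they are mutually
  inverse everywhere one needs their continuity.  It holds because the norm of the image of an
  element of the free algebra is one of the seminorms whose supremum defines the universal norm:
  the homomorphisms are contractive.

  Contractivity also makes preimages of closed ideals closed, so for the quotients only generators of
  the ideals have to be compared.  In one direction, the sets \<open>{(1,1)}\<close> and
  \<open>{(0,p), \<dots>, (p - 1,p)}\<close> are foundation sets, and their relations are the two Cuntz relations: the
  unitarity of \<open>s\<close>, and the relation that the projections \<open>e\<^bsub>(k,p)P\<^esub>\<close> for \<open>k < p\<close>, which are orthogonal,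
  add up to \<open>1\<close>.  In the other direction, let \<open>F\<close> be a foundation set,
  let \<open>M\<close> be a common multiple of the second coordinates of its elements and let \<open>N\<close> bound the first
  coordinates.  Modulo the Cuntz relations the projections \<open>e\<^bsub>(N + k,M)P\<^esub>\<close> for \<open>k < M\<close> add up to \<open>1\<close>, and each
  \<open>(N + k,M)\<close> lies in some \<open>qP\<close> with \<open>q \<in> F\<close>, whence it is annihilated by the factor \<open>1 - e\<^bsub>qP\<^esub>\<close>.
  So the product over \<open>F\<close> vanishes.
\<close>

section \<open>Contractive homomorphisms on dense subalgebras\<close>

context cstar_algebra
begin

lemma lim_to_closed: "lim_to X x \<Longrightarrow> x \<in> carrier A" "lim_to X x \<Longrightarrow> X n \<in> carrier A"
  by (auto simp: lim_to_def)

lemma norm_diff_ge: assumes "x \<in> carrier A" "y \<in> carrier A"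
  shows "\<bar>cnorm A x - cnorm A y\<bar> \<le> cnorm A (x \<ominus> y)"
proof -
  have "cnorm A x \<le> cnorm A (x \<ominus> y) + cnorm A y" if "x \<in> carrier A" "y \<in> carrier A" for x y
    using norm_minus_triangle[of x y \<zero>] that by (simp add: a_minus_def)
  from this[of x y] this[of y x] show ?thesis
    using assms norm_minus_commute[of x y] by simp
qed

lemma lim_to_norm: assumes "lim_to X x" shows "(\<lambda>n. cnorm A (X n)) \<longlonglongrightarrow> cnorm A x"
proof (rule LIM_zero_cancel, rule tendsto_rabs_zero_cancel, rule tendsto_sandwich[OF _ _ tendsto_const])
  show "(\<lambda>n. cnorm A (X n \<ominus> x)) \<longlonglongrightarrow> 0" using assms by (simp add: lim_to_def)
qed (use assms in \<open>auto simp: lim_to_closed intro!: norm_diff_ge always_eventually\<close>)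

end

text \<open>
  The closure of the graph of a contractive homomorphism is again a graph: if two pairs in the closure
  share their first component, their difference has first component \<open>0\<close>, so its second component has
  norm \<open>0\<close>.  By density and completeness that graph is total.  Working with a relation \<open>\<Gamma>\<close> instead of
  a function on a subalgebra means that well-definedness is part of contractivity.
\<close>

lemma contractive_extension:
  fixes A :: "('a, 'm) star_algebra_scheme" and B :: "('b, 'n) star_algebra_scheme"
  assumes "cstar_algebra A" "cstar_algebra B" and \<Gamma>: "\<Gamma> \<subseteq> carrier A \<times> carrier B"
    and one: "(\<one>\<^bsub>A\<^esub>, \<one>\<^bsub>B\<^esub>) \<in> \<Gamma>"
    and add: "\<And>a b a' b'. (a, b) \<in> \<Gamma> \<Longrightarrow> (a', b') \<in> \<Gamma> \<Longrightarrow> (a \<oplus>\<^bsub>A\<^esub> a', b \<oplus>\<^bsub>B\<^esub> b') \<in> \<Gamma>"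
    and mul: "\<And>a b a' b'. (a, b) \<in> \<Gamma> \<Longrightarrow> (a', b') \<in> \<Gamma> \<Longrightarrow> (a \<otimes>\<^bsub>A\<^esub> a', b \<otimes>\<^bsub>B\<^esub> b') \<in> \<Gamma>"
    and sca: "\<And>c a b. (a, b) \<in> \<Gamma> \<Longrightarrow> (cscale A c a, cscale B c b) \<in> \<Gamma>"
    and adj: "\<And>a b. (a, b) \<in> \<Gamma> \<Longrightarrow> (adj A a, adj B b) \<in> \<Gamma>"
    and contr: "\<And>a b. (a, b) \<in> \<Gamma> \<Longrightarrow> cnorm B b \<le> cnorm A a"
    and dense: "\<And>a e. a \<in> carrier A \<Longrightarrow> e > 0 \<Longrightarrow> \<exists>(x, y)\<in>\<Gamma>. cnorm A (a \<ominus>\<^bsub>A\<^esub> x) < e"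
  shows "\<exists>\<phi>\<in>star_hom A B. (\<forall>(a, b)\<in>\<Gamma>. \<phi> a = b) \<and> (\<forall>a\<in>carrier A. cnorm B (\<phi> a) \<le> cnorm A a)"
proof -
  interpret A: cstar_algebra A by fact
  interpret B: cstar_algebra B by fact
  define L where "L a b \<longleftrightarrow> (\<exists>X Y. (\<forall>n. (X n, Y n) \<in> \<Gamma>) \<and> A.lim_to X a \<and> B.lim_to Y b)" for a b
  have cl: "a \<in> carrier A" "b \<in> carrier B" if "L a b" for a b
    using that unfolding L_def by (auto simp: A.lim_to_def B.lim_to_def)
  have L\<Gamma>: "L a b" if "(a, b) \<in> \<Gamma>" for a b
    unfolding L_def using that \<Gamma>
    by (intro exI[of _ "\<lambda>_. a"] exI[of _ "\<lambda>_. b"]) (auto intro: A.lim_to_const B.lim_to_const)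
  have LI: "L a b" if "\<And>n. (X n, Y n) \<in> \<Gamma>" "A.lim_to X a" "B.lim_to Y b" for X Y a b
    unfolding L_def using that by blast
  have LE: thesis if "L a b"
    "\<And>X Y. (\<And>n. (X n, Y n) \<in> \<Gamma>) \<Longrightarrow> A.lim_to X a \<Longrightarrow> B.lim_to Y b \<Longrightarrow> thesis" for a b thesis
    using that unfolding L_def by blast
  have Ladd: "L (a \<oplus>\<^bsub>A\<^esub> a') (b \<oplus>\<^bsub>B\<^esub> b')" if "L a b" "L a' b'" for a b a' b'
    by (rule LE[OF that(1)], rule LE[OF that(2)], rule LI)
       (rule add A.lim_to_add B.lim_to_add, assumption+)+
  have Lmul: "L (a \<otimes>\<^bsub>A\<^esub> a') (b \<otimes>\<^bsub>B\<^esub> b')" if "L a b" "L a' b'" for a b a' b'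
    by (rule LE[OF that(1)], rule LE[OF that(2)], rule LI)
       (rule mul A.lim_to_mult B.lim_to_mult, assumption+)+
  have Lsca: "L (cscale A c a) (cscale B c b)" if "L a b" for c a b
    by (rule LE[OF that], rule LI) (rule sca A.lim_to_scale B.lim_to_scale, assumption)+
  have Ladj: "L (adj A a) (adj B b)" if "L a b" for a b
    by (rule LE[OF that], rule LI) (rule adj A.lim_to_adj B.lim_to_adj, assumption)+
  have Lcontr: "cnorm B b \<le> cnorm A a" if L: "L a b" for a b
  proof (rule LE[OF L])
    fix X Y assume XY: "\<And>n. (X n, Y n) \<in> \<Gamma>" and "A.lim_to X a" "B.lim_to Y b"
    then show ?thesis
      by (intro LIMSEQ_le[OF B.lim_to_norm A.lim_to_norm]) (auto intro: contr)
  qed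
  have uniq: "b = b'" if "L a b" "L a b'" for a b b'
  proof -
    have "L (a \<ominus>\<^bsub>A\<^esub> a) (b \<ominus>\<^bsub>B\<^esub> b')"
      using Ladd[OF that(1) Lsca[OF that(2), of "-1"]]
        cl(1)[OF that(1)] cl(2)[OF that(1)] cl(2)[OF that(2)]
      by (simp add: a_minus_def A.uminus_scale B.uminus_scale)
    from Lcontr[OF this] have "cnorm B (b \<ominus>\<^bsub>B\<^esub> b') \<le> 0"
      using cl(1)[OF that(1)] by (simp add: a_minus_def A.r_neg A.norm_zero)
    then show ?thesis
      using cl(2)[OF that(1)] cl(2)[OF that(2)] B.norm_nonneg[of "b \<ominus>\<^bsub>B\<^esub> b'"]
      by (intro B.norm_minus_zero) simp_all
  qed
  have ex: "\<exists>b. L a b" if a: "a \<in> carrier A" for a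
  proof -
    have "\<exists>x y. (x, y) \<in> \<Gamma> \<and> cnorm A (a \<ominus>\<^bsub>A\<^esub> x) < 1 / Suc n" for n
      using dense[OF a, of "1 / Suc n"] by auto
    then obtain X Y where XY: "\<And>n. (X n, Y n) \<in> \<Gamma>" and X: "\<And>n. cnorm A (a \<ominus>\<^bsub>A\<^esub> X n) < 1 / Suc n"
      by metis
    have c: "X n \<in> carrier A" "Y n \<in> carrier B" for n using XY \<Gamma> by auto
    have "\<forall>e>0. \<exists>N. \<forall>m\<ge>N. \<forall>n\<ge>N. cnorm B (Y m \<ominus>\<^bsub>B\<^esub> Y n) < e"
    proof (intro allI impI)
      fix e :: real assume "e > 0"
      then obtain N where N: "1 / Suc N < e / 2" by (metis half_gt_zero nat_approx_posE)
      have "cnorm B (Y m \<ominus>\<^bsub>B\<^esub> Y n) < e" if "m \<ge> N" "n \<ge> N" for m n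
      proof -
        have "(X m \<ominus>\<^bsub>A\<^esub> X n, Y m \<ominus>\<^bsub>B\<^esub> Y n) \<in> \<Gamma>"
          using add[OF XY[of m] sca[OF XY[of n], of "-1"]] c
          by (simp add: a_minus_def A.uminus_scale B.uminus_scale)
        then have "cnorm B (Y m \<ominus>\<^bsub>B\<^esub> Y n) \<le> cnorm A (X m \<ominus>\<^bsub>A\<^esub> X n)" by (rule contr)
        also have "\<dots> \<le> cnorm A (a \<ominus>\<^bsub>A\<^esub> X m) + cnorm A (a \<ominus>\<^bsub>A\<^esub> X n)"
          using A.norm_minus_triangle[of "X m" a "X n"] A.norm_minus_commute[of a "X m"] a c by simp
        moreover have "1 / real (Suc m) \<le> 1 / Suc N" "1 / real (Suc n) \<le> 1 / Suc N"
          using that by (auto simp: frac_le)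
        ultimately show ?thesis using X[of m] X[of n] N by linarith
      qed
      then show "\<exists>N. \<forall>m\<ge>N. \<forall>n\<ge>N. cnorm B (Y m \<ominus>\<^bsub>B\<^esub> Y n) < e" by blast
    qed
    then obtain b where "b \<in> carrier B" "(\<lambda>n. cnorm B (Y n \<ominus>\<^bsub>B\<^esub> b)) \<longlonglongrightarrow> 0"
      using B.complete[of Y] c by blast
    then have "B.lim_to Y b" using c by (auto simp: B.lim_to_def)
    moreover have "A.lim_to X a"
    proof (rule A.lim_toI)
      show "(\<lambda>n. 1 / real (Suc n)) \<longlonglongrightarrow> 0" by (rule LIMSEQ_Suc[OF lim_1_over_n])
      show "cnorm A (X n \<ominus>\<^bsub>A\<^esub> a) \<le> 1 / real (Suc n)" for n
        using X[of n] A.norm_minus_commute[of a "X n"] a c by simp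
    qed (use a c in auto)
    ultimately show ?thesis using LI[of X Y, OF XY] by blast
  qed
  define \<phi> where "\<phi> a = (THE b. L a b)" for a
  have \<phi>: "\<phi> a = b" if "L a b" for a b
    unfolding \<phi>_def using that uniq by blast
  have L\<phi>: "L a (\<phi> a)" if "a \<in> carrier A" for a
    using ex[OF that] \<phi> by blast
  have "\<phi> \<in> star_hom A B"
    unfolding star_hom_def mem_Collect_eq
    by (intro conjI ballI allI ring_hom_memI \<phi> Ladd Lmul Lsca Ladj L\<phi> L\<Gamma> one)
       (auto intro: cl L\<phi>)
  then show ?thesis using \<phi> L\<Gamma> L\<phi> Lcontr by blast
qed

lemma dense_agree:
  fixes A :: "('a, 'm) star_algebra_scheme" and B :: "('b, 'n) star_algebra_scheme"
  assumes "cstar_algebra A" "cstar_algebra B"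
    and h: "\<phi> \<in> star_hom A B" "\<psi> \<in> star_hom A B"
    and contr: "\<And>a. a \<in> carrier A \<Longrightarrow> cnorm B (\<phi> a) \<le> cnorm A a" "\<And>a. a \<in> carrier A \<Longrightarrow> cnorm B (\<psi> a) \<le> cnorm A a"
    and D: "D \<subseteq> carrier A" "\<And>a e. a \<in> carrier A \<Longrightarrow> e > 0 \<Longrightarrow> \<exists>x\<in>D. cnorm A (a \<ominus>\<^bsub>A\<^esub> x) < e"
      "\<And>x. x \<in> D \<Longrightarrow> \<phi> x = \<psi> x"
    and a: "a \<in> carrier A"
  shows "\<phi> a = \<psi> a"
proof -
  interpret A: cstar_algebra A by fact
  interpret B: cstar_algebra B by fact
  have cl: "\<theta> x \<in> carrier B" and diff: "\<theta> (x \<ominus>\<^bsub>A\<^esub> y) = \<theta> x \<ominus>\<^bsub>B\<^esub> \<theta> y"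
    if "\<theta> \<in> star_hom A B" "x \<in> carrier A" "y \<in> carrier A" for \<theta> x y
    using that
    by (auto simp: star_hom_def ring_hom_def a_minus_def A.uminus_scale B.uminus_scale Pi_iff A.scale_closed)
  have "cnorm B (\<phi> a \<ominus>\<^bsub>B\<^esub> \<psi> a) \<le> 0"
  proof (rule field_le_epsilon)
    fix e :: real assume "e > 0"
    then obtain x where x: "x \<in> D" "cnorm A (a \<ominus>\<^bsub>A\<^esub> x) < e / 2" using D(2)[OF a, of "e / 2"] by auto
    have xc: "x \<in> carrier A" using x D by blast
    have "cnorm B (\<phi> a \<ominus>\<^bsub>B\<^esub> \<psi> a) \<le> cnorm B (\<phi> a \<ominus>\<^bsub>B\<^esub> \<phi> x) + cnorm B (\<psi> a \<ominus>\<^bsub>B\<^esub> \<psi> x)"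
      using B.norm_minus_triangle[of "\<phi> a" "\<phi> x" "\<psi> a"] B.norm_minus_commute[of "\<phi> x" "\<psi> a"]
        cl[OF h(1)] cl[OF h(2)] a xc D(3)[OF x(1)] by simp
    also have "\<dots> \<le> cnorm A (a \<ominus>\<^bsub>A\<^esub> x) + cnorm A (a \<ominus>\<^bsub>A\<^esub> x)"
      using contr[of "a \<ominus>\<^bsub>A\<^esub> x"] diff[OF h(1) a xc] diff[OF h(2) a xc] a xc by simp
    finally show "cnorm B (\<phi> a \<ominus>\<^bsub>B\<^esub> \<psi> a) \<le> 0 + e" using x by simp
  qed
  then show ?thesis
    using cl[OF h(1) a a] cl[OF h(2) a a] B.norm_nonneg[of "\<phi> a \<ominus>\<^bsub>B\<^esub> \<psi> a"]
    by (intro B.norm_minus_zero) auto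
qed

section \<open>Contractive form of the universal property\<close>

context admissible_presentation
begin

lemma elt_closed [simp]: "x \<in> free_star_alg G \<Longrightarrow> univ_elt G R x \<in> carrier UA"
  by (simp add: univ_elt_def carrier_cl)

lemma elt_one: "univ_elt G R 1 = \<one>\<^bsub>UA\<^esub>"
  and elt_star: "x \<in> free_star_alg G \<Longrightarrow> univ_elt G R (fstar x) = adj UA (univ_elt G R x)"
  and elt_scale: "x \<in> free_star_alg G \<Longrightarrow> univ_elt G R (fscale c x) = cscale UA c (univ_elt G R x)"
  and elt_add: "x \<in> free_star_alg G \<Longrightarrow> y \<in> free_star_alg G \<Longrightarrow>
    univ_elt G R (x + y) = univ_elt G R x \<oplus>\<^bsub>UA\<^esub> univ_elt G R y"
  and elt_mult: "x \<in> free_star_alg G \<Longrightarrow> y \<in> free_star_alg G \<Longrightarrow>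
    univ_elt G R (x * y) = univ_elt G R x \<otimes>\<^bsub>UA\<^esub> univ_elt G R y"
  by (simp_all add: univ_elt_def one_cl adj_cl scale_cl add_cl mult_cl)

lemmas elt = elt_one elt_star elt_scale elt_add elt_mult

text \<open>
  The universal algebra represents its own presentation; evaluation there is the canonical map.  This
  makes the evaluation lemmas for arbitrary representations available for \<open>univ_elt\<close>.
\<close>

sublocale taut: gen_map UA G "\<lambda>g. univ_elt G R (fgen g)"
  using UA_cstar by (simp add: gen_map_def gen_map_axioms_def)

lemma taut_ev: "x \<in> free_star_alg G \<Longrightarrow> free_eval UA (\<lambda>g. univ_elt G R (fgen g)) x = univ_elt G R x"
  by (induction x rule: free_induct)
    (simp_all add: taut.ev_one taut.ev_gen taut.ev_star taut.ev_scale taut.ev_add taut.ev_mult elt)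

lemma taut_rel: "r \<in> R \<Longrightarrow> r \<in> free_star_alg G \<Longrightarrow> free_eval UA (\<lambda>g. univ_elt G R (fgen g)) r = \<zero>\<^bsub>UA\<^esub>"
  using taut_ev univ_elt_rel[OF adm] by simp

text \<open>
  The seminorm \<open>x \<mapsto> \<parallel>ev x\<parallel>\<close> vanishes on the relations, hence lies below the universal norm.
\<close>

lemma universal_contractive:
  assumes "gen_map B G f" and R: "\<And>r. r \<in> R \<Longrightarrow> free_eval B f r = \<zero>\<^bsub>B\<^esub>"
  shows "\<exists>\<phi>\<in>star_hom UA B. (\<forall>x\<in>free_star_alg G. \<phi> (univ_elt G R x) = free_eval B f x) \<and>
    (\<forall>a\<in>carrier UA. cnorm B (\<phi> a) \<le> cnorm UA a)"
proof -
  interpret gen_map B G f by fact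
  have evR: "(\<lambda>x. cnorm B (ev x)) \<in> rel_seminorms G R"
    using ev_seminorm R by (simp add: rel_seminorms_def norm_zero)
  let ?U = "univ_elt G R"
  define \<Gamma> where "\<Gamma> = (\<lambda>x. (?U x, ev x)) ` free_star_alg G"
  have mem: "(a, b) \<in> \<Gamma>" if "x \<in> free_star_alg G" "a = ?U x" "b = ev x" for a b x
    using that unfolding \<Gamma>_def by blast
  have "\<exists>\<phi>\<in>star_hom UA B. (\<forall>(a, b)\<in>\<Gamma>. \<phi> a = b) \<and> (\<forall>a\<in>carrier UA. cnorm B (\<phi> a) \<le> cnorm UA a)"
  proof (rule contractive_extension[OF UA_cstar])
    show "cstar_algebra B" by unfold_locales
    show "\<Gamma> \<subseteq> carrier UA \<times> carrier B" by (auto simp: \<Gamma>_def)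
    show "(\<one>\<^bsub>UA\<^esub>, \<one>\<^bsub>B\<^esub>) \<in> \<Gamma>"
      by (rule mem[of 1]) (simp_all add: ev_one elt)
    fix a b assume "(a, b) \<in> \<Gamma>"
    then obtain x where x: "x \<in> free_star_alg G" "a = ?U x" "b = ev x" by (auto simp: \<Gamma>_def)
    show "(cscale UA c a, cscale B c b) \<in> \<Gamma>" for c
      by (rule mem[of "fscale c x"]) (use x in \<open>simp_all add: ev_scale elt\<close>)
    show "(adj UA a, adj B b) \<in> \<Gamma>"
      by (rule mem[of "fstar x"]) (use x in \<open>simp_all add: ev_star elt\<close>)
    show "cnorm B b \<le> cnorm UA a"
      using le_N[OF evR x(1)] x by (simp add: univ_elt_def norm_cl_const)
    fix a' b' assume "(a', b') \<in> \<Gamma>"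
    then obtain y where y: "y \<in> free_star_alg G" "a' = ?U y" "b' = ev y" by (auto simp: \<Gamma>_def)
    show "(a \<oplus>\<^bsub>UA\<^esub> a', b \<oplus>\<^bsub>B\<^esub> b') \<in> \<Gamma>"
      by (rule mem[of "x + y"]) (use x y in \<open>simp_all add: ev_add elt\<close>)
    show "(a \<otimes>\<^bsub>UA\<^esub> a', b \<otimes>\<^bsub>B\<^esub> b') \<in> \<Gamma>"
      by (rule mem[of "x * y"]) (use x y in \<open>simp_all add: ev_mult elt\<close>)
  next
    fix a and e :: real assume "a \<in> carrier UA" "e > 0"
    then show "\<exists>(x, y)\<in>\<Gamma>. cnorm UA (a \<ominus>\<^bsub>UA\<^esub> x) < e"
      using univ_elt_dense[OF adm] by (auto simp: \<Gamma>_def)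
  qed
  then obtain \<phi> where \<phi>: "\<phi> \<in> star_hom UA B" "\<forall>(a, b)\<in>\<Gamma>. \<phi> a = b"
    "\<forall>a\<in>carrier UA. cnorm B (\<phi> a) \<le> cnorm UA a" by blast
  have "\<phi> (?U x) = ev x" if "x \<in> free_star_alg G" for x
    using bspec[OF \<phi>(2) mem[OF that refl refl]] by simp
  with \<phi>(1,3) show ?thesis by blast
qed

lemma hom_unique:
  assumes "cstar_algebra B" and h: "\<phi> \<in> star_hom UA B" "\<psi> \<in> star_hom UA B"
    and contr: "\<And>a. a \<in> carrier UA \<Longrightarrow> cnorm B (\<phi> a) \<le> cnorm UA a" "\<And>a. a \<in> carrier UA \<Longrightarrow> cnorm B (\<psi> a) \<le> cnorm UA a"
    and gens: "\<And>g. g \<in> G \<Longrightarrow> \<phi> (univ_elt G R (fgen g)) = \<psi> (univ_elt G R (fgen g))"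
    and a: "a \<in> carrier UA"
  shows "\<phi> a = \<psi> a"
proof (rule dense_agree[OF UA_cstar assms(1) h contr _ _ _ a])
  show "univ_elt G R ` free_star_alg G \<subseteq> carrier UA" by auto
  show "\<exists>x\<in>univ_elt G R ` free_star_alg G. cnorm UA (a \<ominus>\<^bsub>UA\<^esub> x) < e" if "a \<in> carrier UA" "e > 0" for a e
    using univ_elt_dense[OF adm that] by blast
  have "\<phi> (univ_elt G R x) = \<psi> (univ_elt G R x)" if "x \<in> free_star_alg G" for x
    using that
  proof (induction x rule: free_induct)
    case one
    show ?case using h by (simp add: elt star_hom_def ring_hom_def)
  next
    case (gen g)
    then show ?case by (rule gens)
  qed (use h in \<open>simp_all add: elt star_hom_def ring_hom_def\<close>)
  then show "\<phi> x = \<psi> x" if "x \<in> univ_elt G R ` free_star_alg G" for x using that by blast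
qed

end

section \<open>The two systems of relations\<close>

context cstar_algebra
begin
abbreviation adjoint  ("_\<^sup>\<star>" [1000] 999) where "x\<^sup>\<star> \<equiv> adj A x"

declare adj_closed [simp] adj_adj [simp] adj_one [simp] adj_zero [simp]

lemma minus_eq_zero_iff: "x \<in> carrier A \<Longrightarrow> y \<in> carrier A \<Longrightarrow> x \<ominus> y = \<zero> \<longleftrightarrow> x = y"
  using minus_unique_diff by (auto simp: a_minus_def r_neg)

end

context gen_map
begin

lemma ev_power: "x \<in> free_star_alg G \<Longrightarrow> ev (x ^ k) = ev x [^] k"
  by (induction k) (auto simp: ev_one ev_mult power_Suc2 simp del: power_Suc)

lemma ev_fsum: "finite I \<Longrightarrow> (\<And>i. i \<in> I \<Longrightarrow> h i \<in> free_star_alg G) \<Longrightarrow> ev (sum h I) = (\<Oplus>i\<in>I. ev (h i))"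
  by (induction I rule: finite_induct) (auto simp: ev_0 ev_add)

lemmas ev = ev_0 ev_one ev_add ev_diff ev_mult ev_star ev_scale ev_gen ev_power ev_fsum

end

locale toeplitz_rep = cstar_algebra A for A :: "('a, 'm) star_algebra_scheme" (structure) +
  fixes s :: 'a and v :: "nat \<Rightarrow> 'a"
  assumes s_closed [simp]: "s \<in> carrier A"
    and v_closed [simp]: "prime p \<Longrightarrow> v p \<in> carrier A"
    and s_isometry: "s\<^sup>\<star> \<otimes> s = \<one>"
    and v_isometry: "prime p \<Longrightarrow> (v p)\<^sup>\<star> \<otimes> v p = \<one>"
    and T1: "prime p \<Longrightarrow> v p \<otimes> s = s [^] p \<otimes> v p"
    and T2: "prime p \<Longrightarrow> prime q \<Longrightarrow> v p \<otimes> v q = v q \<otimes> v p"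
    and T3: "prime p \<Longrightarrow> prime q \<Longrightarrow> p \<noteq> q \<Longrightarrow> (v p)\<^sup>\<star> \<otimes> v q = v q \<otimes> (v p)\<^sup>\<star>"
    and T4: "prime p \<Longrightarrow> s\<^sup>\<star> \<otimes> v p = s [^] (p - 1) \<otimes> v p \<otimes> s\<^sup>\<star>"
    and T5: "prime p \<Longrightarrow> 1 \<le> k \<Longrightarrow> k < p \<Longrightarrow> (v p)\<^sup>\<star> \<otimes> s [^] k \<otimes> v p = \<zero>"

text \<open>
  The equivalence is needed in both directions: to read off the relations in the Toeplitz algebra
  itself, and to define homomorphisms out of it.
\<close>

lemma toeplitz_rep_iff:
  assumes "gen_map B toeplitz_gens f"
  shows "(\<forall>r\<in>toeplitz_rels. free_eval B f r = \<zero>\<^bsub>B\<^esub>) \<longleftrightarrow> toeplitz_rep B (f GS) (\<lambda>p. f (GV p))"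
proof -
  interpret gen_map B toeplitz_gens f by fact
  have g [simp]: "GS \<in> toeplitz_gens" "\<And>p. prime p \<Longrightarrow> GV p \<in> toeplitz_gens"
    by (auto simp: toeplitz_gens_def)
  have c [simp]: "f GS \<in> carrier B" "\<And>p. prime p \<Longrightarrow> f (GV p) \<in> carrier B" by (auto intro: f)
  have all: "(\<forall>x\<in>{h p |p. P p}. Q x) \<longleftrightarrow> (\<forall>p. P p \<longrightarrow> Q (h p))"
    "(\<forall>x\<in>{k p q |p q. P' p q}. Q x) \<longleftrightarrow> (\<forall>p q. P' p q \<longrightarrow> Q (k p q))"
    for h :: "nat \<Rightarrow> toeplitz_gen poly_star" and P Q k and P' :: "nat \<Rightarrow> nat \<Rightarrow> bool" by blast+
  show ?thesis
    unfolding toeplitz_rels_def ball_Un all toeplitz_rep_def toeplitz_rep_axioms_def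
    by (simp add: ev minus_eq_zero_iff cstar_algebra_axioms cong: conj_cong imp_cong) (auto simp: m_assoc)
qed

locale sgrp_rep = cstar_algebra A for A :: "('a, 'm) star_algebra_scheme" (structure) +
  fixes P :: "('p, 'n) monoid_scheme" and V :: "'p \<Rightarrow> 'a" and E :: "'p set \<Rightarrow> 'a"
  assumes V_closed [simp]: "p \<in> carrier P \<Longrightarrow> V p \<in> carrier A"
    and E_closed [simp]: "X \<in> constructible_ideals P \<Longrightarrow> E X \<in> carrier A"
    and V_isometry: "p \<in> carrier P \<Longrightarrow> (V p)\<^sup>\<star> \<otimes> V p = \<one>"
    and E_adj: "X \<in> constructible_ideals P \<Longrightarrow> (E X)\<^sup>\<star> = E X"
    and E_idem: "X \<in> constructible_ideals P \<Longrightarrow> E X \<otimes> E X = E X"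
    and V_mult: "p \<in> carrier P \<Longrightarrow> q \<in> carrier P \<Longrightarrow> V p \<otimes> V q = V (p \<otimes>\<^bsub>P\<^esub> q)"
    and E_cov: "p \<in> carrier P \<Longrightarrow> X \<in> constructible_ideals P \<Longrightarrow> V p \<otimes> E X \<otimes> (V p)\<^sup>\<star> = E (p <#\<^bsub>P\<^esub> X)"
    and E_whole: "E (carrier P) = \<one>" and E_empty: "E {} = \<zero>"
    and E_inter: "X \<in> constructible_ideals P \<Longrightarrow> Y \<in> constructible_ideals P \<Longrightarrow> E X \<otimes> E Y = E (X \<inter> Y)"

lemma sgrp_rep_iff:
  assumes "gen_map B (sgrp_gens P) f" "monoid P"
  shows "(\<forall>r\<in>sgrp_rels P. free_eval B f r = \<zero>\<^bsub>B\<^esub>) \<longleftrightarrow> sgrp_rep B P (\<lambda>p. f (SV p)) (\<lambda>X. f (SE X))"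
proof -
  interpret gen_map B "sgrp_gens P" f by fact
  interpret P: monoid P by fact
  have g [simp]: "\<And>p. p \<in> carrier P \<Longrightarrow> SV p \<in> sgrp_gens P" "\<And>X. X \<in> constructible_ideals P \<Longrightarrow> SE X \<in> sgrp_gens P"
    by (auto simp: sgrp_gens_def)
  note [simp] = constructible_ideals.intros
  have c [simp]: "\<And>p. p \<in> carrier P \<Longrightarrow> f (SV p) \<in> carrier B" "\<And>X. X \<in> constructible_ideals P \<Longrightarrow> f (SE X) \<in> carrier B" by (auto intro: f)
  have all: "(\<forall>x\<in>{h p |p. P' p}. Q x) \<longleftrightarrow> (\<forall>p. P' p \<longrightarrow> Q (h p))"
    "(\<forall>x\<in>{k p q |p q. P'' p q}. Q x) \<longleftrightarrow> (\<forall>p q. P'' p q \<longrightarrow> Q (k p q))"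
    for h :: "'x \<Rightarrow> 'y" and P' Q and k :: "'u \<Rightarrow> 'v \<Rightarrow> 'y" and P'' by blast+
  show ?thesis
    unfolding sgrp_rels_def ball_Un all sgrp_rep_def sgrp_rep_axioms_def
    by (simp add: ev minus_eq_zero_iff cstar_algebra_axioms cong: conj_cong imp_cong) auto
qed

section \<open>Principal right ideals of the affine semigroup\<close>

lemma affN_simps [simp]:
  "(m, a) \<in> carrier affN \<longleftrightarrow> 1 \<le> a" "(m, a) \<otimes>\<^bsub>affN\<^esub> (n, b) = (m + a * n, a * b)"
  "\<one>\<^bsub>affN\<^esub> = (0, 1)"
  by (simp_all add: affN_def)

abbreviation aff_ideal :: "nat \<times> nat \<Rightarrow> (nat \<times> nat) set"
  where "aff_ideal x \<equiv> x <#\<^bsub>affN\<^esub> carrier affN"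

lemma mem_aff_ideal:
  "(x, y) \<in> aff_ideal (m, a) \<longleftrightarrow> (\<exists>k c. 1 \<le> c \<and> x = m + a * k \<and> y = a * c)"
  by (auto simp: l_coset_def affN_def)

lemma l_coset_aff_ideal:
  assumes x: "x \<in> carrier affN" "y \<in> carrier affN"
  shows "x <#\<^bsub>affN\<^esub> aff_ideal y = aff_ideal (x \<otimes>\<^bsub>affN\<^esub> y)"
proof -
  interpret monoid affN by (rule monoid_affN)
  have "x <#\<^bsub>affN\<^esub> aff_ideal y = (\<Union>z\<in>carrier affN. {x \<otimes>\<^bsub>affN\<^esub> (y \<otimes>\<^bsub>affN\<^esub> z)})"
    unfolding l_coset_def by blast
  also have "\<dots> = (\<Union>z\<in>carrier affN. {(x \<otimes>\<^bsub>affN\<^esub> y) \<otimes>\<^bsub>affN\<^esub> z})"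
    by (intro SUP_cong refl arg_cong[where f = "\<lambda>z. {z}"] m_assoc[symmetric] x)
  finally show ?thesis unfolding l_coset_def .
qed

lemma aff_ideal_inj:
  assumes x: "x \<in> carrier affN" "y \<in> carrier affN" and eq: "aff_ideal x = aff_ideal y"
  shows "x = y"
proof -
  obtain m a n b where xy: "x = (m, a)" "y = (n, b)" by fastforce
  have self: "(m, a) \<in> aff_ideal (m, a)" for m a
    unfolding mem_aff_ideal by (rule exI[of _ 0], rule exI[of _ 1]) simp
  have "(m, a) \<in> aff_ideal (n, b)" "(n, b) \<in> aff_ideal (m, a)"
    using self[of m a] self[of n b] eq unfolding xy by blast+
  then obtain c d j k where *: "m = n + b * j" "n = m + a * k" "a = b * c" "b = a * d"
    unfolding mem_aff_ideal by blast
  have "a = b" using *(3,4) by (metis dvd_antisym dvd_triv_left)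
  moreover have "m = n" using *(1,2) by linarith
  ultimately show ?thesis by (simp add: xy)
qed

lemma aff_ideal_inter_empty:
  assumes "\<not> gcd a b dvd k"
  shows "aff_ideal (m, a) \<inter> aff_ideal (m + k, b) = {}"
proof -
  have *: False if "a * u = k + b * w" for u w
  proof -
    have "k = a * u - b * w" using that by simp
    moreover have "gcd a b dvd a * u - b * w" by (intro dvd_diff_nat) auto
    ultimately show False using assms by simp
  qed
  have "z \<notin> aff_ideal (m, a) \<inter> aff_ideal (m + k, b)" for z
    by (cases z) (auto simp: mem_aff_ideal dest: * *[OF sym])
  then show ?thesis by blast
qed

text \<open>
  The least common multiple.  Membership means \<open>m \<le> x\<close>, \<open>x \<equiv> m\<close> modulo the second coordinate, and
  divisibility of \<open>y\<close>.  The bound \<open>j < a\<close> makes \<open>m + g * a * i\<close> the least common element of the two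
  progressions; without it the right-hand side could be too small.
\<close>

lemma aff_ideal_inter:
  assumes ab: "coprime a b" "1 \<le> b" and ij: "a * i = k + b * j" "j < a" and g: "1 \<le> g"
  shows "aff_ideal (m, g * a) \<inter> aff_ideal (m + g * k, g * b) = aff_ideal (m + g * a * i, g * a * b)"
proof (intro equalityI subsetI)
  fix z assume "z \<in> aff_ideal (m + g * a * i, g * a * b)"
  then obtain u c where c: "c \<ge> 1" and z: "z = (m + g * a * i + g * a * b * u, g * a * b * c)"
    by (cases z) (auto simp: mem_aff_ideal)
  have "z \<in> aff_ideal (m, g * a)"
    unfolding z mem_aff_ideal using c ab(2)
    by (intro exI[of _ "i + b * u"] exI[of _ "b * c"]) (simp add: algebra_simps)
  moreover have "z \<in> aff_ideal (m + g * k, g * b)"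
    unfolding z mem_aff_ideal mult.assoc ij(1) using c ij(2)
    by (intro exI[of _ "j + a * u"] exI[of _ "a * c"]) (simp add: algebra_simps)
  ultimately show "z \<in> aff_ideal (m, g * a) \<inter> aff_ideal (m + g * k, g * b)" by blast
next
  fix z assume zin: "z \<in> aff_ideal (m, g * a) \<inter> aff_ideal (m + g * k, g * b)"
  obtain x y where z: "z = (x, y)" by fastforce
  obtain u c w d where x: "x = m + g * a * u" "x = m + g * k + g * b * w"
    and y: "y = g * a * c" "y = g * b * d" "1 \<le> c" "1 \<le> d"
    using zin unfolding z Int_iff mem_aff_ideal by blast
  have "g * (a * u) = g * (k + b * w)" using x by (simp add: algebra_simps)
  then have uw: "a * u = k + b * w" using g by simp
  have "[k + b * j = k + b * w] (mod a)"
    unfolding ij(1)[symmetric] uw[symmetric] by (simp add: cong_def)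
  then have "[j = w] (mod a)"
    using ab(1) by (simp add: cong_add_lcancel_nat cong_mult_lcancel_nat coprime_commute)
  then have "w mod a = j" using ij(2) by (simp add: cong_def)
  then obtain t where w: "w = j + a * t" by (metis mod_mult_div_eq)
  have "g * (a * c) = g * (b * d)" using y(1,2) by (metis mult.assoc)
  then have "a * c = b * d" using g by simp
  then have "b dvd c" using ab(1) by (metis coprime_commute coprime_dvd_mult_right_iff dvd_triv_left)
  then obtain e where e: "c = b * e" by blast
  have "x = m + g * (k + b * j) + g * a * b * t" using x(2) w by (simp add: algebra_simps)
  then have "x = m + g * a * i + g * a * b * t" by (simp add: ij(1)[symmetric] mult.assoc)
  moreover have "e \<ge> 1" using e y by (cases e) auto
  ultimately show "z \<in> aff_ideal (m + g * a * i, g * a * b)"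
    unfolding z mem_aff_ideal using y(1) e by (intro exI[of _ t] exI[of _ e]) simp
qed

lemma coprime_solution:
  assumes "coprime a b" "1 \<le> (a::nat)"
  shows "\<exists>i j. a * i = k + b * j \<and> j < a"
proof -
  obtain x where x: "[b * x = 1] (mod a)" using assms(1) cong_solve_coprime_nat[of b a] by (auto simp: coprime_commute)
  \<comment> \<open>\<open>a - 1\<close> stands for \<open>-1\<close> modulo \<open>a\<close>\<close>
  define j where "j = (x * k * (a - 1)) mod a"
  have "[k + b * j = k + (b * x) * k * (a - 1)] (mod a)"
    unfolding j_def by (intro cong_add cong_refl) (simp add: cong_def mod_mult_right_eq mult.assoc)
  also have "[k + (b * x) * k * (a - 1) = k + 1 * k * (a - 1)] (mod a)"
    using x by (intro cong_add cong_mult cong_refl)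
  also have "k + 1 * k * (a - 1) = a * k" using assms(2) by (cases a) auto
  finally have "a dvd k + b * j" by (simp add: cong_def mod_eq_0_iff_dvd)
  then obtain i where "k + b * j = a * i" by blast
  moreover have "j < a" using assms(2) by (simp add: j_def)
  ultimately show ?thesis by metis
qed

text \<open>
  The case distinction keeps the data that produced the generator of the intersection, since the same
  data are needed to evaluate the corresponding product of isometries.
\<close>

lemma aff_ideal_inter_cases:
  assumes "1 \<le> a" "1 \<le> b"
  obtains (empty) "\<not> gcd a b dvd k" "\<And>m. aff_ideal (m, a) \<inter> aff_ideal (m + k, b) = {}"
  | (meet) g a' b' k' i j where "1 \<le> g" "1 \<le> a'" "1 \<le> b'" "a = g * a'" "b = g * b'" "k = g * k'" "coprime a' b'"
    "a' * i = k' + b' * j" "j < a'"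
    "\<And>m. aff_ideal (m, a) \<inter> aff_ideal (m + k, b) = aff_ideal (m + a * i, a * b')"
proof (cases "gcd a b dvd k")
  case True
  define g where "g = gcd a b"
  have g: "1 \<le> g" using assms by (simp add: g_def Suc_le_eq)
  obtain a' b' where ab: "a = g * a'" "b = g * b'" "coprime a' b'"
  proof -
    have "\<exists>a' b'. a = a' * g \<and> b = b' * g \<and> coprime a' b'"
      unfolding g_def using assms by (intro gcd_coprime_exists) simp
    then show ?thesis using that by (metis mult.commute)
  qed
  have pos: "1 \<le> a'" "1 \<le> b'" using assms ab(1,2) by (metis gr0I less_one mult_0_right not_less)+
  obtain k' where k: "k = g * k'" using True by (auto simp: g_def)
  obtain i j where ij: "a' * i = k' + b' * j" "j < a'" using coprime_solution[OF ab(3) pos(1)] by blast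
  show ?thesis
  proof (rule meet[OF g pos ab(1,2) k ab(3) ij])
    show "aff_ideal (m, a) \<inter> aff_ideal (m + k, b) = aff_ideal (m + a * i, a * b')" for m
      unfolding ab(1,2) k by (rule aff_ideal_inter[OF ab(3) pos(2) ij g])
  qed
next
  case False
  then show ?thesis using empty aff_ideal_inter_empty by blast
qed

lemma aff_ideal_inter_princ:
  assumes "x \<in> carrier affN" "y \<in> carrier affN"
  shows "aff_ideal x \<inter> aff_ideal y = {} \<or> (\<exists>z\<in>carrier affN. aff_ideal x \<inter> aff_ideal y = aff_ideal z)"
proof -
  have *: "aff_ideal (m, a) \<inter> aff_ideal (m + k, b) = {} \<or>
      (\<exists>z\<in>carrier affN. aff_ideal (m, a) \<inter> aff_ideal (m + k, b) = aff_ideal z)"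
    if "1 \<le> a" "1 \<le> b" for m a k b
    using that
  proof (cases rule: aff_ideal_inter_cases[where k = k, case_names empty meet])
    case empty
    then show ?thesis by simp
  next
    case (meet g a' b' k' i j)
    have "(m + a * i, a * b') \<in> carrier affN" using meet(3) that(1) by simp
    then show ?thesis unfolding meet(10) by blast
  qed
  obtain m a n b where xy: "x = (m, a)" "y = (n, b)" by fastforce
  show ?thesis
  proof (cases "m \<le> n")
    case True
    then show ?thesis using *[of a b m "n - m"] assms xy by simp
  next
    case False
    then show ?thesis using *[of b a n "m - n"] assms xy by (simp add: Int_commute)
  qed
qed

text \<open>
  Closure under left quotients reduces to closure under intersections: \<open>left_quot affN p X\<close> only depends on
  \<open>pP \<inter> X\<close>, and if this is \<open>zP\<close> with \<open>z = py\<close>, then the quotient is \<open>yP\<close> by left cancellation.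
\<close>

lemma constructible_affN:
  "X \<in> constructible_ideals affN \<longleftrightarrow> X = {} \<or> (\<exists>x\<in>carrier affN. X = aff_ideal x)"
proof
  interpret monoid affN by (rule monoid_affN)
  have one: "aff_ideal \<one>\<^bsub>affN\<^esub> = carrier affN"
  proof -
    have "aff_ideal \<one>\<^bsub>affN\<^esub> = (\<Union>h\<in>carrier affN. {h})"
      unfolding l_coset_def by (intro SUP_cong refl) (simp only: l_one)
    then show ?thesis by simp
  qed
  assume "X \<in> constructible_ideals affN"
  then show "X = {} \<or> (\<exists>x\<in>carrier affN. X = aff_ideal x)"
  proof induction
    case whole
    then show ?case using one one_closed by metis
  next
    case (left_mult p X)
    have "p <#\<^bsub>affN\<^esub> {} = {}" by (simp add: l_coset_def)
    with left_mult show ?case using l_coset_aff_ideal[of p] m_closed[of p] by metis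
  next
    case (left_quot p X)
    note p = left_quot.hyps(1)
    have lq: "left_quot affN p X = left_quot affN p (aff_ideal p \<inter> X)"
      by (auto simp: left_quot_def l_coset_def)
    have "aff_ideal p \<inter> X = {} \<or> (\<exists>z\<in>carrier affN. aff_ideal p \<inter> X = aff_ideal z)"
      using left_quot.IH aff_ideal_inter_princ[OF p] by blast
    then show ?case
    proof
      assume "aff_ideal p \<inter> X = {}"
      then show ?thesis unfolding lq by (simp add: left_quot_def)
    next
      assume "\<exists>z\<in>carrier affN. aff_ideal p \<inter> X = aff_ideal z"
      then obtain z where z: "z \<in> carrier affN" "aff_ideal p \<inter> X = aff_ideal z" by blast
      have "z \<in> aff_ideal z" unfolding l_coset_def using r_one[OF z(1)] one_closed by force
      then have "z \<in> aff_ideal p" using z by blast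
      then obtain y where y: "y \<in> carrier affN" "z = p \<otimes>\<^bsub>affN\<^esub> y" by (auto simp: l_coset_def)
      have inj: "x = y" if "p \<otimes>\<^bsub>affN\<^esub> x = p \<otimes>\<^bsub>affN\<^esub> y" for x y
        using that p by (cases p; cases x; cases y) auto
      have "left_quot affN p (aff_ideal z) = aff_ideal y"
        unfolding y(2) l_coset_aff_ideal[OF p y(1), symmetric]
        using p y by (auto simp: left_quot_def l_coset_def dest: inj)
      then show ?thesis using lq z y by auto
    qed
  next
    case (inter X Y)
    then show ?case using aff_ideal_inter_princ by (metis Int_empty_left Int_empty_right)
  qed simp
next
  show "X = {} \<or> (\<exists>x\<in>carrier affN. X = aff_ideal x) \<Longrightarrow> X \<in> constructible_ideals affN"
    by (auto intro: constructible_ideals.intros)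
qed

section \<open>Products of the Toeplitz generators\<close>

context cstar_algebra
begin

text \<open>
  A relation \<open>a \<otimes> b = c\<close> in a form that rewrites inside right-associated products.
\<close>

lemma mult_assoc_subst:
  assumes "a \<otimes> b = c" "a \<in> carrier A" "b \<in> carrier A" "x \<in> carrier A"
  shows "a \<otimes> (b \<otimes> x) = c \<otimes> x"
  using assms m_assoc by metis

end

lemma pos_nat_prime_induct [consumes 1, case_names one prime_mult]:
  assumes "1 \<le> (a::nat)" "P 1" "\<And>p b. prime p \<Longrightarrow> 1 \<le> b \<Longrightarrow> P b \<Longrightarrow> P (p * b)"
  shows "P a"
proof -
  have "a \<noteq> 0 \<longrightarrow> P a"
  proof (induction a rule: prime_divisors_induct)
    case (factor p b)
    then show ?case using assms(3)[of p b] by (auto simp: Suc_le_eq)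
  qed (use assms in auto)
  then show ?thesis using assms(1) by simp
qed

context toeplitz_rep
begin

abbreviation "S k \<equiv> s [^] (k::nat)"

text \<open>
  The isometries \<open>v\<^sub>p\<close> commute, so the order of the prime factors is immaterial.  Sorting them fixes a
  choice; a fold over the multiset would require commutativity outside the carrier as well.
\<close>

definition vn :: "nat \<Rightarrow> 'a"
  where "vn a = foldr (\<lambda>p x. v p \<otimes> x) (sorted_list_of_multiset (prime_factorization a)) \<one>"

lemma vn_1 [simp]: "vn 1 = \<one>" "vn (Suc 0) = \<one>"
  by (simp_all add: vn_def)

lemma vn_closed [simp]: "vn a \<in> carrier A"
proof -
  have "(\<And>p. p \<in> set ps \<Longrightarrow> prime p) \<Longrightarrow> foldr (\<lambda>p x. v p \<otimes> x) ps \<one> \<in> carrier A" for ps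
    by (induction ps) auto
  then show ?thesis unfolding vn_def by (metis in_prime_factors_imp_prime set_sorted_list_of_multiset)
qed

lemma vn_prime_mult: assumes "prime p" "1 \<le> b" shows "vn (p * b) = v p \<otimes> vn b"
proof -
  have insort: "foldr (\<lambda>p x. v p \<otimes> x) (insort p ps) \<one> = v p \<otimes> foldr (\<lambda>p x. v p \<otimes> x) ps \<one>
      \<and> foldr (\<lambda>p x. v p \<otimes> x) ps \<one> \<in> carrier A"
    if "\<And>q. q \<in> set ps \<Longrightarrow> prime q" for ps
    using that
  proof (induction ps)
    case (Cons q ps)
    then have q: "prime q" and IH: "foldr (\<lambda>p x. v p \<otimes> x) (insort p ps) \<one> = v p \<otimes> foldr (\<lambda>p x. v p \<otimes> x) ps \<one>"
      "foldr (\<lambda>p x. v p \<otimes> x) ps \<one> \<in> carrier A" by auto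
    have "v q \<otimes> (v p \<otimes> x) = v p \<otimes> (v q \<otimes> x)" if "x \<in> carrier A" for x
      using T2[OF q assms(1)] q assms(1) that by (metis m_assoc v_closed)
    then show ?case using IH q by simp
  qed simp
  have "prime_factorization (p * b) = add_mset p (prime_factorization b)"
    using assms by (simp add: prime_factorization_mult prime_factorization_prime)
  then show ?thesis unfolding vn_def using insort[of "sorted_list_of_multiset (prime_factorization b)"] by auto
qed

lemma vn_prime: "prime p \<Longrightarrow> vn p = v p"
  using vn_prime_mult[of p 1] by simp

lemma vn_mult: "1 \<le> a \<Longrightarrow> 1 \<le> b \<Longrightarrow> vn (a * b) = vn a \<otimes> vn b"
proof (induction a rule: pos_nat_prime_induct)
  case (prime_mult p a)
  then show ?case by (simp add: mult.assoc vn_prime_mult m_assoc)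
qed simp

lemma vn_isometry: "1 \<le> a \<Longrightarrow> (vn a)\<^sup>\<star> \<otimes> vn a = \<one>"
proof (induction a rule: pos_nat_prime_induct)
  case (prime_mult p a)
  have "(vn (p * a))\<^sup>\<star> \<otimes> vn (p * a) = (vn a)\<^sup>\<star> \<otimes> ((v p)\<^sup>\<star> \<otimes> (v p \<otimes> vn a))"
    using prime_mult by (simp add: vn_prime_mult adj_mult m_assoc)
  also have "\<dots> = \<one>" using prime_mult by (simp add: mult_assoc_subst[OF v_isometry])
  finally show ?case .
qed simp

lemma S_isometry: "(S k)\<^sup>\<star> \<otimes> S k = \<one>"
proof (induction k)
  case (Suc k)
  have "(S (Suc k))\<^sup>\<star> \<otimes> S (Suc k) = s\<^sup>\<star> \<otimes> ((S k)\<^sup>\<star> \<otimes> (S k \<otimes> s))"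
    by (simp add: adj_mult m_assoc)
  also have "\<dots> = \<one>" by (simp add: mult_assoc_subst[OF Suc] s_isometry)
  finally show ?case .
qed simp

lemma S_add: "S k \<otimes> S l = S (k + l)" by (simp add: nat_pow_mult)

lemma S_diff: "k \<le> l \<Longrightarrow> (S k)\<^sup>\<star> \<otimes> S l = S (l - k)"
  using S_add[of k "l - k"] mult_assoc_subst[OF S_isometry, of k "S (l - k)"] by simp

lemma S_diff': "l \<le> k \<Longrightarrow> (S k)\<^sup>\<star> \<otimes> S l = (S (k - l))\<^sup>\<star>"
  using arg_cong[OF S_diff[of l k], of "adj A"] by (simp add: adj_mult)

lemma vn_S: assumes "1 \<le> a" shows "vn a \<otimes> S k = S (a * k) \<otimes> vn a"
proof -
  have 1: "vn a \<otimes> s = S a \<otimes> vn a" using assms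
  proof (induction a rule: pos_nat_prime_induct)
    case (prime_mult p a)
    have p: "v p \<otimes> S k = S (p * k) \<otimes> v p" for k
    proof (induction k)
      case (Suc k)
      have "v p \<otimes> S (Suc k) = (v p \<otimes> S k) \<otimes> s" using prime_mult by (simp add: m_assoc)
      also have "\<dots> = S (p * k) \<otimes> (v p \<otimes> s)" using prime_mult Suc by (simp add: m_assoc)
      also have "\<dots> = (S (p * k) \<otimes> S p) \<otimes> v p" using prime_mult by (simp add: T1 m_assoc)
      finally show ?case by (simp add: S_add add.commute)
    qed (use prime_mult in simp)
    have "vn (p * a) \<otimes> s = v p \<otimes> (vn a \<otimes> s)" using prime_mult by (simp add: vn_prime_mult m_assoc)
    also have "\<dots> = (v p \<otimes> S a) \<otimes> vn a" using prime_mult by (simp add: m_assoc)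
    also have "\<dots> = S (p * a) \<otimes> vn (p * a)" using prime_mult by (simp add: p vn_prime_mult m_assoc)
    finally show ?case .
  qed simp
  show ?thesis
  proof (induction k)
    case (Suc k)
    have "vn a \<otimes> S (Suc k) = (vn a \<otimes> S k) \<otimes> s" by (simp add: m_assoc)
    also have "\<dots> = S (a * k) \<otimes> (vn a \<otimes> s)" using Suc by (simp add: m_assoc)
    also have "\<dots> = (S (a * k) \<otimes> S a) \<otimes> vn a" by (simp add: 1 m_assoc)
    finally show ?case by (simp add: S_add add.commute)
  qed simp
qed

lemma s_adj_vn: "1 \<le> a \<Longrightarrow> s\<^sup>\<star> \<otimes> vn a = S (a - 1) \<otimes> vn a \<otimes> s\<^sup>\<star>"
proof (induction a rule: pos_nat_prime_induct)
  case (prime_mult p a)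
  have "s\<^sup>\<star> \<otimes> vn (p * a) = (s\<^sup>\<star> \<otimes> v p) \<otimes> vn a" using prime_mult by (simp add: vn_prime_mult m_assoc)
  also have "\<dots> = S (p - 1) \<otimes> v p \<otimes> (s\<^sup>\<star> \<otimes> vn a)" using prime_mult by (simp add: T4 m_assoc)
  also have "\<dots> = S (p - 1) \<otimes> (v p \<otimes> S (a - 1)) \<otimes> (vn a \<otimes> s\<^sup>\<star>)" using prime_mult by (simp add: m_assoc)
  also have "\<dots> = (S (p - 1) \<otimes> S (p * (a - 1))) \<otimes> (v p \<otimes> vn a \<otimes> s\<^sup>\<star>)"
    using prime_mult vn_S[of p "a - 1"] prime_gt_0_nat[of p] by (simp add: vn_prime m_assoc)
  also have "p - 1 + p * (a - 1) = p * a - 1"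
    using prime_mult(2) prime_gt_0_nat[OF prime_mult(1)] by (cases a) auto
  then have "(S (p - 1) \<otimes> S (p * (a - 1))) \<otimes> (v p \<otimes> vn a \<otimes> s\<^sup>\<star>) = S (p * a - 1) \<otimes> vn (p * a) \<otimes> s\<^sup>\<star>"
    using prime_mult by (simp only: S_add) (simp add: vn_prime_mult m_assoc)
  finally show ?case .
qed simp

text \<open>
  The adjoint of \<open>s\<^sup>* v\<^sub>a = s\<^bsup>a-1\<^esup> v\<^sub>a s\<^sup>*\<close> moves one \<open>s\<close> to the left of \<open>v\<^sub>a\<^sup>*\<close> at the price of \<open>a - 1\<close>
  factors \<open>s\<^sup>*\<close> on the right, and these absorb the remaining \<open>r - 1\<close> factors \<open>s\<close>.
\<close>

lemma vn_adj_S_small: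
  assumes "1 \<le> r" "r \<le> a"
  shows "(vn a)\<^sup>\<star> \<otimes> S r = s \<otimes> (vn a)\<^sup>\<star> \<otimes> (S (a - r))\<^sup>\<star>"
proof -
  have "(vn a)\<^sup>\<star> \<otimes> s = s \<otimes> (vn a)\<^sup>\<star> \<otimes> (S (a - 1))\<^sup>\<star>"
    using arg_cong[OF s_adj_vn[of a], of "adj A"] assms by (simp add: adj_mult m_assoc)
  moreover have "S r = s \<otimes> S (r - 1)" using S_add[of 1 "r - 1"] assms by simp
  ultimately have "(vn a)\<^sup>\<star> \<otimes> S r = s \<otimes> (vn a)\<^sup>\<star> \<otimes> ((S (a - 1))\<^sup>\<star> \<otimes> S (r - 1))"
    by (simp add: m_assoc[symmetric])
  then show ?thesis using assms by (simp add: S_diff')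
qed

lemma vn_adj_S:
  assumes "1 \<le> a"
  shows "(vn a)\<^sup>\<star> \<otimes> S (a * k) = S k \<otimes> (vn a)\<^sup>\<star>"
proof (induction k)
  case (Suc k)
  have "(vn a)\<^sup>\<star> \<otimes> S (a * Suc k) = ((vn a)\<^sup>\<star> \<otimes> S (a * k)) \<otimes> S a"
    using S_add[of "a * k" a] by (simp add: m_assoc add.commute)
  also have "\<dots> = S k \<otimes> ((vn a)\<^sup>\<star> \<otimes> S a)" using Suc by (simp add: m_assoc)
  also have "\<dots> = S (Suc k) \<otimes> (vn a)\<^sup>\<star>"
    using vn_adj_S_small[of a a] assms by (simp add: m_assoc)
  finally show ?case .
qed simp

lemma vn_coprime: "1 \<le> a \<Longrightarrow> 1 \<le> b \<Longrightarrow> coprime a b \<Longrightarrow> (vn a)\<^sup>\<star> \<otimes> vn b = vn b \<otimes> (vn a)\<^sup>\<star>"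
proof (induction a rule: pos_nat_prime_induct)
  case (prime_mult p a)
  have p: "(v p)\<^sup>\<star> \<otimes> vn b = vn b \<otimes> (v p)\<^sup>\<star>"
    using prime_mult.prems(1) prime_mult.prems(2)
  proof (induction b rule: pos_nat_prime_induct)
    case (prime_mult q b)
    have [simp]: "prime p" by fact
    have "p \<noteq> q" "coprime (p * a) b" using prime_mult \<open>prime p\<close> by auto
    have "(v p)\<^sup>\<star> \<otimes> vn (q * b) = ((v p)\<^sup>\<star> \<otimes> v q) \<otimes> vn b"
      using prime_mult by (simp add: vn_prime_mult m_assoc)
    also have "\<dots> = v q \<otimes> ((v p)\<^sup>\<star> \<otimes> vn b)" using prime_mult \<open>p \<noteq> q\<close> by (simp add: T3 m_assoc)
    also have "\<dots> = vn (q * b) \<otimes> (v p)\<^sup>\<star>"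
      using prime_mult \<open>coprime (p * a) b\<close> by (simp add: vn_prime_mult m_assoc)
    finally show ?case .
  qed (use prime_mult in simp)
  have a: "(vn a)\<^sup>\<star> \<otimes> vn b = vn b \<otimes> (vn a)\<^sup>\<star>" using prime_mult by simp
  have "(vn (p * a))\<^sup>\<star> \<otimes> vn b = (vn a)\<^sup>\<star> \<otimes> ((v p)\<^sup>\<star> \<otimes> vn b)"
    using prime_mult by (simp add: vn_prime_mult adj_mult m_assoc)
  also have "\<dots> = ((vn a)\<^sup>\<star> \<otimes> vn b) \<otimes> (v p)\<^sup>\<star>" using prime_mult(1) by (simp add: p m_assoc)
  also have "\<dots> = vn b \<otimes> (vn (p * a))\<^sup>\<star>"
    unfolding a using prime_mult(1,2) by (simp add: vn_prime_mult adj_mult m_assoc)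
  finally show ?case .
qed simp

text \<open>
  The relation \<open>T5\<close> covers prime \<open>a\<close> and \<open>k < a\<close>.  In general, split a prime \<open>p\<close> off \<open>a\<close>.  If \<open>p\<close> does
  not divide \<open>k\<close>, then \<open>T5\<close> applies to the remainder of \<open>k\<close>; otherwise \<open>v\<^sub>p\<^sup>* s\<^sup>k v\<^sub>p = s\<^bsup>k/p\<^esup>\<close>, and the
  remaining factor of \<open>a\<close> does not divide \<open>k / p\<close>.
\<close>

lemma vn_S_vn_zero: "1 \<le> a \<Longrightarrow> \<not> a dvd k \<Longrightarrow> (vn a)\<^sup>\<star> \<otimes> S k \<otimes> vn a = \<zero>"
proof (induction a arbitrary: k rule: pos_nat_prime_induct)
  case (prime_mult p a)
  have [simp]: "prime p" by fact
  have p1: "1 \<le> p" using prime_gt_0_nat[of p] by simp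
  have eq: "(vn (p * a))\<^sup>\<star> \<otimes> S k \<otimes> vn (p * a) = (vn a)\<^sup>\<star> \<otimes> ((v p)\<^sup>\<star> \<otimes> S k \<otimes> v p) \<otimes> vn a"
    using prime_mult by (simp add: vn_prime_mult adj_mult m_assoc)
  have k: "S k = S (p * (k div p)) \<otimes> S (k mod p)" by (simp add: S_add)
  have "(v p)\<^sup>\<star> \<otimes> S k \<otimes> v p = ((v p)\<^sup>\<star> \<otimes> S (p * (k div p))) \<otimes> S (k mod p) \<otimes> v p"
    by (subst k) (simp add: m_assoc)
  also have "\<dots> = S (k div p) \<otimes> ((v p)\<^sup>\<star> \<otimes> S (k mod p) \<otimes> v p)"
    using vn_adj_S[OF p1, of "k div p"] by (simp add: vn_prime m_assoc)
  finally have eq2: "(v p)\<^sup>\<star> \<otimes> S k \<otimes> v p = S (k div p) \<otimes> ((v p)\<^sup>\<star> \<otimes> S (k mod p) \<otimes> v p)" .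
  show ?case
  proof (cases "p dvd k")
    case True
    then have "\<not> a dvd k div p" using prime_mult(4) p1 by (metis dvd_mult_div_cancel mult_dvd_mono dvd_refl)
    moreover have "(v p)\<^sup>\<star> \<otimes> S k \<otimes> v p = S (k div p)" using eq2 True by (simp add: v_isometry)
    ultimately show ?thesis using prime_mult.IH eq by simp
  next
    case False
    then have "(v p)\<^sup>\<star> \<otimes> S (k mod p) \<otimes> v p = \<zero>"
      using p1 by (intro T5) (auto simp: dvd_eq_mod_eq_0)
    then show ?thesis using eq eq2 by simp
  qed
qed simp

text \<open>
  If \<open>k\<close> leaves a nonzero remainder \<open>r\<close> modulo \<open>a\<close>, the exponent \<open>a - r\<close> in \<open>vn_adj_S_small\<close> is positive,
  so a factor \<open>s\<^sup>*\<close> survives on the right.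
\<close>

lemma vn_adj_S_factor:
  assumes "1 \<le> a" "\<not> a dvd k"
  shows "\<exists>t\<in>carrier A. (vn a)\<^sup>\<star> \<otimes> S k = t \<otimes> s\<^sup>\<star>"
proof -
  define c r where "c = k div a" and "r = k mod a"
  have k: "k = a * c + r" by (simp add: c_def r_def)
  have r: "1 \<le> r" "r < a"
    using assms by (auto simp: r_def dvd_eq_mod_eq_0 Suc_le_eq)
  have "S (a - r) = s \<otimes> S (a - r - 1)" using S_add[of 1 "a - r - 1"] r by (simp add: Suc_diff_Suc del: nat_pow_Suc)
  then have d: "(S (a - r))\<^sup>\<star> = (S (a - r - 1))\<^sup>\<star> \<otimes> s\<^sup>\<star>" by (simp add: adj_mult)
  have "(vn a)\<^sup>\<star> \<otimes> S k = ((vn a)\<^sup>\<star> \<otimes> S (a * c)) \<otimes> S r"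
    unfolding k by (simp add: S_add[symmetric] m_assoc)
  also have "\<dots> = S c \<otimes> ((vn a)\<^sup>\<star> \<otimes> S r)" using assms by (simp add: vn_adj_S m_assoc)
  also have "\<dots> = (S c \<otimes> s \<otimes> (vn a)\<^sup>\<star> \<otimes> (S (a - r - 1))\<^sup>\<star>) \<otimes> s\<^sup>\<star>"
    using r by (simp add: vn_adj_S_small d m_assoc)
  finally show ?thesis by (intro bexI) auto
qed

text \<open>
  The right-hand side is \<open>v\<^sub>a\<^sup>* s\<^sup>k v\<^sub>b s s\<^sup>*\<close>, so the claim is that \<open>v\<^sub>a\<^sup>* s\<^sup>k v\<^sub>b\<close> kills the projection
  \<open>1 - s s\<^sup>*\<close>.  By \<open>vn_adj_S_factor\<close> it suffices that \<open>s\<^sup>* v\<^sub>b\<close> does, and \<open>s\<^sup>* v\<^sub>b\<close> ends in \<open>s\<^sup>*\<close>.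
\<close>

lemma vn_S_step:
  assumes a: "1 \<le> a" "\<not> a dvd k" and b: "1 \<le> b"
  shows "(vn a)\<^sup>\<star> \<otimes> S k \<otimes> vn b = (vn a)\<^sup>\<star> \<otimes> S (k + b) \<otimes> vn b \<otimes> s\<^sup>\<star>"
proof -
  obtain t where t: "t \<in> carrier A" "(vn a)\<^sup>\<star> \<otimes> S k = t \<otimes> s\<^sup>\<star>" using vn_adj_S_factor[OF a] by blast
  have "(vn a)\<^sup>\<star> \<otimes> S (k + b) \<otimes> vn b \<otimes> s\<^sup>\<star> = ((vn a)\<^sup>\<star> \<otimes> S k) \<otimes> (S b \<otimes> vn b) \<otimes> s\<^sup>\<star>"
    by (simp add: S_add[symmetric] m_assoc)
  also have "S b \<otimes> vn b = vn b \<otimes> s" using vn_S[OF b, of 1] by simp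
  also have "((vn a)\<^sup>\<star> \<otimes> S k) \<otimes> (vn b \<otimes> s) \<otimes> s\<^sup>\<star> = t \<otimes> (s\<^sup>\<star> \<otimes> vn b) \<otimes> (s \<otimes> s\<^sup>\<star>)"
    using t by (simp add: m_assoc)
  also have "\<dots> = t \<otimes> S (b - 1) \<otimes> vn b \<otimes> (s\<^sup>\<star> \<otimes> (s \<otimes> s\<^sup>\<star>))"
    using t b by (simp add: s_adj_vn m_assoc)
  also have "s\<^sup>\<star> \<otimes> (s \<otimes> s\<^sup>\<star>) = s\<^sup>\<star>" by (simp add: mult_assoc_subst[OF s_isometry])
  also have "t \<otimes> S (b - 1) \<otimes> vn b \<otimes> s\<^sup>\<star> = t \<otimes> (s\<^sup>\<star> \<otimes> vn b)"
    using t b by (simp add: s_adj_vn m_assoc)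
  also have "\<dots> = (vn a)\<^sup>\<star> \<otimes> S k \<otimes> vn b" using t by (simp add: m_assoc)
  finally show ?thesis ..
qed

text \<open>
  None of the exponents \<open>k + b * l\<close> with \<open>l < j\<close> is divisible by \<open>a\<close>, because \<open>j < a\<close> and \<open>b\<close> is
  invertible modulo \<open>a\<close>.  So \<open>vn_S_step\<close> applies \<open>j\<close> times, and then \<open>v\<^sub>a\<^sup>* s\<^bsup>ai\<^esup> = s\<^sup>i v\<^sub>a\<^sup>*\<close> and
  the relation \<open>vn_coprime\<close> finish the computation.
\<close>

lemma vn_S_coprime:
  assumes ab: "1 \<le> a" "1 \<le> b" "coprime a b" and ij: "a * i = k + b * j" "j < a"
  shows "(vn a)\<^sup>\<star> \<otimes> S k \<otimes> vn b = S i \<otimes> vn b \<otimes> (vn a)\<^sup>\<star> \<otimes> (S j)\<^sup>\<star>"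
proof -
  have "(vn a)\<^sup>\<star> \<otimes> S k \<otimes> vn b = (vn a)\<^sup>\<star> \<otimes> S (k + b * l) \<otimes> vn b \<otimes> (S l)\<^sup>\<star>" if "l \<le> j" for l
    using that
  proof (induction l)
    case (Suc l)
    have "\<not> a dvd k + b * l"
    proof
      assume "a dvd k + b * l"
      moreover have "a dvd k + b * j" by (simp flip: ij(1))
      ultimately have "a dvd (k + b * j) - (k + b * l)" by (intro dvd_diff_nat)
      then have "a dvd b * (j - l)" by (simp add: diff_mult_distrib2)
      then have "a dvd j - l" using ab(3) by (simp add: coprime_dvd_mult_right_iff)
      then show False using Suc.prems ij(2) by (auto dest: dvd_imp_le)
    qed
    from vn_S_step[OF ab(1) this ab(2)] Suc show ?case
      by (simp add: adj_mult m_assoc add.commute add.left_commute)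
  qed simp
  from this[of j] have "(vn a)\<^sup>\<star> \<otimes> S k \<otimes> vn b = ((vn a)\<^sup>\<star> \<otimes> S (a * i)) \<otimes> vn b \<otimes> (S j)\<^sup>\<star>"
    by (simp add: ij(1))
  also have "\<dots> = S i \<otimes> ((vn a)\<^sup>\<star> \<otimes> vn b) \<otimes> (S j)\<^sup>\<star>" using ab by (simp add: vn_adj_S m_assoc)
  also have "\<dots> = S i \<otimes> vn b \<otimes> (vn a)\<^sup>\<star> \<otimes> (S j)\<^sup>\<star>" using ab by (simp add: vn_coprime m_assoc)
  finally show ?thesis .
qed

end

section \<open>The covariance relations in a Toeplitz representation\<close>

context toeplitz_rep
begin

definition aff_iso :: "nat \<times> nat \<Rightarrow> 'a"
  where "aff_iso x = S (fst x) \<otimes> vn (snd x)"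

text \<open>
  The generator of a nonempty principal ideal is unique (\<open>aff_ideal_inj\<close>), so the choice below is no
  choice.
\<close>

definition aff_proj :: "(nat \<times> nat) set \<Rightarrow> 'a"
  where "aff_proj X = (if X = {} then \<zero>
    else let x = (SOME x. x \<in> carrier affN \<and> X = aff_ideal x) in aff_iso x \<otimes> (aff_iso x)\<^sup>\<star>)"

lemma aff_iso_closed [simp]: "aff_iso x \<in> carrier A"
  by (simp add: aff_iso_def)

lemma aff_iso_mult:
  assumes "x \<in> carrier affN" "y \<in> carrier affN"
  shows "aff_iso x \<otimes> aff_iso y = aff_iso (x \<otimes>\<^bsub>affN\<^esub> y)"
proof -
  obtain m a n b where xy: "x = (m, a)" "y = (n, b)" by fastforce
  have "aff_iso x \<otimes> aff_iso y = S m \<otimes> (vn a \<otimes> S n) \<otimes> vn b"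
    by (simp add: xy aff_iso_def m_assoc)
  also have "\<dots> = (S m \<otimes> S (a * n)) \<otimes> (vn a \<otimes> vn b)"
    using assms by (simp add: xy vn_S m_assoc)
  also have "\<dots> = aff_iso (x \<otimes>\<^bsub>affN\<^esub> y)"
    using assms by (simp add: xy aff_iso_def S_add vn_mult)
  finally show ?thesis .
qed

lemma aff_iso_isometry:
  assumes "x \<in> carrier affN"
  shows "(aff_iso x)\<^sup>\<star> \<otimes> aff_iso x = \<one>"
proof -
  obtain m a where x: "x = (m, a)" by fastforce
  have "(aff_iso x)\<^sup>\<star> \<otimes> aff_iso x = (vn a)\<^sup>\<star> \<otimes> ((S m)\<^sup>\<star> \<otimes> (S m \<otimes> vn a))"
    by (simp add: x aff_iso_def adj_mult m_assoc)
  also have "\<dots> = (vn a)\<^sup>\<star> \<otimes> vn a" by (simp add: mult_assoc_subst[OF S_isometry])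
  finally show ?thesis using assms by (simp add: x vn_isometry)
qed

lemma aff_proj_ideal:
  assumes "x \<in> carrier affN"
  shows "aff_proj (aff_ideal x) = aff_iso x \<otimes> (aff_iso x)\<^sup>\<star>"
proof -
  have "aff_ideal x \<noteq> {}" using assms unfolding l_coset_def by blast
  moreover have "(SOME y. y \<in> carrier affN \<and> aff_ideal x = aff_ideal y) = x"
    using assms aff_ideal_inj by (intro some_equality) auto
  ultimately show ?thesis by (simp add: aff_proj_def)
qed

lemma aff_iso_adj_mult:
  "(aff_iso (m, a))\<^sup>\<star> \<otimes> aff_iso (m + k, b) = (vn a)\<^sup>\<star> \<otimes> S k \<otimes> vn b"
proof -
  have "(aff_iso (m, a))\<^sup>\<star> \<otimes> aff_iso (m + k, b) = (vn a)\<^sup>\<star> \<otimes> ((S m)\<^sup>\<star> \<otimes> S (m + k)) \<otimes> vn b"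
    by (simp add: aff_iso_def adj_mult m_assoc)
  then show ?thesis by (simp add: S_diff)
qed

lemma vn_S_vn_cancel:
  assumes "1 \<le> g" "1 \<le> a" "1 \<le> b"
  shows "(vn (g * a))\<^sup>\<star> \<otimes> S k \<otimes> vn (g * b) =
    (vn a)\<^sup>\<star> \<otimes> ((vn g)\<^sup>\<star> \<otimes> S k \<otimes> vn g) \<otimes> vn b"
  using assms by (simp add: vn_mult adj_mult m_assoc)

text \<open>
  For \<open>x = (m, a)\<close> and \<open>y = (m + k, b)\<close> the middle part of \<open>V\<^sub>x V\<^sub>x\<^sup>* V\<^sub>y V\<^sub>y\<^sup>*\<close> is \<open>v\<^sub>a\<^sup>* s\<^sup>k v\<^sub>b\<close>.  It
  vanishes when \<open>gcd a b\<close> does not divide \<open>k\<close>, which is when the ideals are disjoint; otherwise it is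
  \<open>V\<^sub>p V\<^sub>q\<^sup>*\<close> with \<open>xp = yq\<close> the least common multiple.  Taking adjoints covers the opposite order of the
  first coordinates.
\<close>

lemma aff_proj_mult:
  assumes "x \<in> carrier affN" "y \<in> carrier affN"
  shows "aff_proj (aff_ideal x) \<otimes> aff_proj (aff_ideal y) = aff_proj (aff_ideal x \<inter> aff_ideal y)"
proof -
  have ordered: "aff_proj (aff_ideal (m, a)) \<otimes> aff_proj (aff_ideal (m + k, b)) =
      aff_proj (aff_ideal (m, a) \<inter> aff_ideal (m + k, b))" if ab: "1 \<le> a" "1 \<le> b" for m a k b
  proof -
    let ?x = "aff_iso (m, a)" and ?y = "aff_iso (m + k, b)"
    have x: "(m, a) \<in> carrier affN" "(m + k, b) \<in> carrier affN" using ab by auto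
    have eq: "aff_proj (aff_ideal (m, a)) \<otimes> aff_proj (aff_ideal (m + k, b)) =
        ?x \<otimes> ((vn a)\<^sup>\<star> \<otimes> S k \<otimes> vn b) \<otimes> ?y\<^sup>\<star>"
      unfolding aff_proj_ideal[OF x(1)] aff_proj_ideal[OF x(2)] aff_iso_adj_mult[of m a k b, symmetric]
      by (simp add: m_assoc)
    from ab show ?thesis
    proof (cases rule: aff_ideal_inter_cases[where k = k, case_names empty meet])
      case empty
      define g where "g = gcd a b"
      have g: "1 \<le> g" using ab by (simp add: g_def Suc_le_eq)
      obtain a' b' where a': "a = g * a'" "b = g * b'" unfolding g_def by (metis dvdE gcd_dvd1 gcd_dvd2)
      then have "1 \<le> a'" "1 \<le> b'" using ab by (metis gr0I less_one mult_0_right not_less)+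
      then have "(vn a)\<^sup>\<star> \<otimes> S k \<otimes> vn b = \<zero>"
        unfolding a' using g empty(1) by (simp add: vn_S_vn_cancel vn_S_vn_zero g_def[symmetric])
      then show ?thesis unfolding eq empty(2) by (simp add: aff_proj_def)
    next
      case (meet g a' b' k' i j)
      have c: "(i, b') \<in> carrier affN" "(j, a') \<in> carrier affN" "(m + a * i, a * b') \<in> carrier affN"
        using ab meet(2,3) by auto
      have "(vn g)\<^sup>\<star> \<otimes> S (g * k') \<otimes> vn g = S k'"
        using meet(1) vn_S[of g k'] vn_isometry[of g] by (simp add: m_assoc flip: vn_S) (simp add: mult_assoc_subst)
      then have "(vn a)\<^sup>\<star> \<otimes> S k \<otimes> vn b = (vn a')\<^sup>\<star> \<otimes> S k' \<otimes> vn b'"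
        unfolding meet(4-6) by (simp only: vn_S_vn_cancel[OF meet(1,2,3)])
      also have "\<dots> = S i \<otimes> vn b' \<otimes> (vn a')\<^sup>\<star> \<otimes> (S j)\<^sup>\<star>"
        by (rule vn_S_coprime[OF meet(2,3,7,8,9)])
      also have "\<dots> = aff_iso (i, b') \<otimes> (aff_iso (j, a'))\<^sup>\<star>"
        by (simp add: aff_iso_def adj_mult m_assoc)
      finally have "?x \<otimes> ((vn a)\<^sup>\<star> \<otimes> S k \<otimes> vn b) \<otimes> ?y\<^sup>\<star> =
          (?x \<otimes> aff_iso (i, b')) \<otimes> (?y \<otimes> aff_iso (j, a'))\<^sup>\<star>"
        by (simp add: adj_mult m_assoc)
      also have "?x \<otimes> aff_iso (i, b') = aff_iso (m + a * i, a * b')"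
        using aff_iso_mult[OF x(1) c(1)] by simp
      also have "?y \<otimes> aff_iso (j, a') = aff_iso (m + k + b * j, b * a')"
        using aff_iso_mult[OF x(2) c(2)] by simp
      also have "(m + k + b * j, b * a') = (m + a * i, a * b')"
      proof -
        have "g * k' + g * b' * j = g * a' * i" using meet(8) by (metis distrib_left mult.assoc)
        then show ?thesis unfolding meet(4-6) by (simp add: mult.commute mult.left_commute)
      qed
      finally show ?thesis unfolding eq meet(10) aff_proj_ideal[OF c(3)] .
    qed
  qed
  have adj: "(aff_proj (aff_ideal z))\<^sup>\<star> = aff_proj (aff_ideal z)" "aff_proj (aff_ideal z) \<in> carrier A"
    if "z \<in> carrier affN" for z
    using that by (simp_all add: aff_proj_ideal adj_mult)
  obtain m a n b where xy: "x = (m, a)" "y = (n, b)" by fastforce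
  show ?thesis
  proof (cases "m \<le> n")
    case True
    then show ?thesis using ordered[of a b m "n - m"] assms by (simp add: xy)
  next
    case False
    have "aff_proj (aff_ideal x) \<otimes> aff_proj (aff_ideal y) = (aff_proj (aff_ideal y) \<otimes> aff_proj (aff_ideal x))\<^sup>\<star>"
      using assms by (simp add: adj adj_mult)
    also have "\<dots> = (aff_proj (aff_ideal x \<inter> aff_ideal y))\<^sup>\<star>"
      using ordered[of b a n "m - n"] False assms by (simp add: xy Int_commute)
    also have "\<dots> = aff_proj (aff_ideal x \<inter> aff_ideal y)"
      using aff_ideal_inter_princ[OF assms] adj(1) by (auto simp: aff_proj_def[of "{}"])
    finally show ?thesis .
  qed
qed

theorem sgrp_rep_affN: "sgrp_rep A affN aff_iso aff_proj"
proof (intro sgrp_rep.intro sgrp_rep_axioms.intro)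
  interpret P: monoid affN by (rule monoid_affN)
  note cases = constructible_affN[THEN iffD1]
  have E0: "aff_proj {} = \<zero>" by (simp add: aff_proj_def)
  show "aff_proj {} = \<zero>" by (rule E0)
  show "cstar_algebra A" by unfold_locales
  show "aff_iso p \<in> carrier A" for p by simp
  show "(aff_iso p)\<^sup>\<star> \<otimes> aff_iso p = \<one>" if "p \<in> carrier affN" for p using that by (rule aff_iso_isometry)
  show "aff_iso p \<otimes> aff_iso q = aff_iso (p \<otimes>\<^bsub>affN\<^esub> q)" if "p \<in> carrier affN" "q \<in> carrier affN" for p q
    using that by (rule aff_iso_mult)
  have cl: "aff_proj X \<in> carrier A" "(aff_proj X)\<^sup>\<star> = aff_proj X" if "X \<in> constructible_ideals affN" for X
    using cases[OF that] by (auto simp: E0 aff_proj_ideal adj_mult)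
  show "aff_proj X \<in> carrier A" "(aff_proj X)\<^sup>\<star> = aff_proj X" if "X \<in> constructible_ideals affN" for X
    using cl[OF that] .
  show inter: "aff_proj X \<otimes> aff_proj Y = aff_proj (X \<inter> Y)"
    if "X \<in> constructible_ideals affN" "Y \<in> constructible_ideals affN" for X Y
    using cases[OF that(1)] cases[OF that(2)] cl(1)[OF that(1)] cl(1)[OF that(2)]
    by (elim disjE bexE) (simp_all add: E0 aff_proj_mult)
  show "aff_proj X \<otimes> aff_proj X = aff_proj X" if "X \<in> constructible_ideals affN" for X
    using inter[OF that that] by simp
  have one: "aff_ideal (0, 1) = carrier affN"
    by (auto simp: l_coset_def affN_def)
  have "aff_proj (aff_ideal (0, 1)) = \<one>"
    by (subst aff_proj_ideal) (simp_all add: aff_iso_def)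
  then show "aff_proj (carrier affN) = \<one>" unfolding one .
  show "aff_iso p \<otimes> aff_proj X \<otimes> (aff_iso p)\<^sup>\<star> = aff_proj (p <#\<^bsub>affN\<^esub> X)"
    if p: "p \<in> carrier affN" and X: "X \<in> constructible_ideals affN" for p X
    using cases[OF X]
  proof (elim disjE bexE)
    assume "X = {}"
    then show ?thesis by (simp add: E0 l_coset_def)
  next
    fix x assume x: "x \<in> carrier affN" "X = aff_ideal x"
    have "aff_iso p \<otimes> aff_proj X \<otimes> (aff_iso p)\<^sup>\<star> = (aff_iso p \<otimes> aff_iso x) \<otimes> (aff_iso p \<otimes> aff_iso x)\<^sup>\<star>"
      using x by (simp add: aff_proj_ideal adj_mult m_assoc)
    also have "\<dots> = aff_proj (p <#\<^bsub>affN\<^esub> X)"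
      using p x P.m_closed[OF p x(1)] by (simp add: aff_iso_mult l_coset_aff_ideal aff_proj_ideal)
    finally show ?thesis .
  qed
qed

end

section \<open>The Toeplitz relations in a covariant representation\<close>

context
  fixes A :: "('a, 'm) star_algebra_scheme" (structure) and V E
  assumes rep: "sgrp_rep A affN V E"
begin

interpretation sgrp_rep A affN V E by (rule rep)

lemma E_aff_ideal: assumes x: "x \<in> carrier affN" shows "E (aff_ideal x) = V x \<otimes> (V x)\<^sup>\<star>"
  using E_cov[OF x constructible_ideals.whole] x by (simp add: E_whole del: affN_simps)

lemma V_one: "V (0, 1) = \<one>"
proof -
  have "V (0, 1) \<otimes> V (0, 1) = V (0, 1)" using V_mult[of "(0, 1)" "(0, 1)"] by simp
  then have "(V (0, 1))\<^sup>\<star> \<otimes> (V (0, 1) \<otimes> V (0, 1)) = \<one>" using V_isometry[of "(0, 1)"] by simp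
  then show ?thesis using mult_assoc_subst[OF V_isometry, of "(0, 1)"] by simp
qed

lemma V_pow: "V (1, 1) [^] (k::nat) = V (k, 1)"
proof (induction k)
  case 0
  then show ?case using V_one by simp
next
  case (Suc k)
  then show ?case using V_mult[of "(k, 1)" "(1, 1)"] by simp
qed

text \<open>
  Multiply \<open>e\<^bsub>xP\<^esub> e\<^bsub>yP\<^esub> = e\<^bsub>zP\<^esub>\<close> by \<open>V\<^sub>x\<^sup>*\<close> on the left and by \<open>V\<^sub>y\<close> on the right.
\<close>

lemma V_adj_V_meet:
  assumes c: "x \<in> carrier affN" "y \<in> carrier affN" "p \<in> carrier affN" "q \<in> carrier affN"
    and z: "x \<otimes>\<^bsub>affN\<^esub> p = z" "y \<otimes>\<^bsub>affN\<^esub> q = z" "aff_ideal x \<inter> aff_ideal y = aff_ideal z"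
  shows "(V x)\<^sup>\<star> \<otimes> V y = V p \<otimes> (V q)\<^sup>\<star>"
proof -
  interpret P: monoid affN by (rule monoid_affN)
  have zc: "z \<in> carrier affN" using P.m_closed[OF c(1,3)] z by simp
  have X: "aff_ideal x \<in> constructible_ideals affN" "aff_ideal y \<in> constructible_ideals affN"
    using c by (auto simp: constructible_affN)
  note [simp] = c[THEN V_closed] zc[THEN V_closed]
  have "(V x \<otimes> (V x)\<^sup>\<star>) \<otimes> (V y \<otimes> (V y)\<^sup>\<star>) = V z \<otimes> (V z)\<^sup>\<star>"
    using E_inter[OF X] unfolding z(3) by (simp only: E_aff_ideal c zc)
  also have "\<dots> = (V x \<otimes> V p) \<otimes> (V y \<otimes> V q)\<^sup>\<star>"
    using V_mult[OF c(1,3)] V_mult[OF c(2,4)] by (simp only: z)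
  finally have eq: "(V x \<otimes> (V x)\<^sup>\<star>) \<otimes> (V y \<otimes> (V y)\<^sup>\<star>) = (V x \<otimes> V p) \<otimes> (V y \<otimes> V q)\<^sup>\<star>" .
  have "(V x)\<^sup>\<star> \<otimes> V y = ((V x)\<^sup>\<star> \<otimes> V x) \<otimes> (V x)\<^sup>\<star> \<otimes> V y \<otimes> ((V y)\<^sup>\<star> \<otimes> V y)"
    by (simp add: V_isometry c)
  also have "\<dots> = (V x)\<^sup>\<star> \<otimes> ((V x \<otimes> (V x)\<^sup>\<star>) \<otimes> (V y \<otimes> (V y)\<^sup>\<star>)) \<otimes> V y"
    by (simp add: m_assoc)
  also have "\<dots> = ((V x)\<^sup>\<star> \<otimes> V x) \<otimes> V p \<otimes> (V q)\<^sup>\<star> \<otimes> ((V y)\<^sup>\<star> \<otimes> V y)"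
    unfolding eq by (simp add: adj_mult m_assoc)
  also have "\<dots> = V p \<otimes> (V q)\<^sup>\<star>" by (simp add: V_isometry c)
  finally show ?thesis .
qed

lemma V_adj_V_disjoint:
  assumes c: "x \<in> carrier affN" "y \<in> carrier affN" and disj: "aff_ideal x \<inter> aff_ideal y = {}"
  shows "(V x)\<^sup>\<star> \<otimes> V y = \<zero>"
proof -
  have X: "aff_ideal x \<in> constructible_ideals affN" "aff_ideal y \<in> constructible_ideals affN"
    using c by (auto simp: constructible_affN)
  note [simp] = c[THEN V_closed]
  have eq: "(V x \<otimes> (V x)\<^sup>\<star>) \<otimes> (V y \<otimes> (V y)\<^sup>\<star>) = \<zero>"
    using E_inter[OF X] unfolding disj by (simp only: E_aff_ideal c E_empty)
  have "(V x)\<^sup>\<star> \<otimes> V y = ((V x)\<^sup>\<star> \<otimes> V x) \<otimes> (V x)\<^sup>\<star> \<otimes> V y \<otimes> ((V y)\<^sup>\<star> \<otimes> V y)"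
    by (simp add: V_isometry c)
  also have "\<dots> = (V x)\<^sup>\<star> \<otimes> ((V x \<otimes> (V x)\<^sup>\<star>) \<otimes> (V y \<otimes> (V y)\<^sup>\<star>)) \<otimes> V y"
    by (simp add: m_assoc)
  also have "\<dots> = \<zero>" unfolding eq by simp
  finally show ?thesis .
qed

theorem toeplitz_rep_affN: "toeplitz_rep A (V (1, 1)) (\<lambda>p. V (0, p))"
proof (intro toeplitz_rep.intro toeplitz_rep_axioms.intro)
  have p0: "1 \<le> p" if "prime p" for p :: nat using prime_gt_0_nat[OF that] by simp
  show "cstar_algebra A" by unfold_locales
  show "V (1, 1) \<in> carrier A" by simp
  show "V (0, p) \<in> carrier A" if "prime p" for p using p0[OF that] by simp
  show "(V (1, 1))\<^sup>\<star> \<otimes> V (1, 1) = \<one>" by (simp add: V_isometry)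
  show "(V (0, p))\<^sup>\<star> \<otimes> V (0, p) = \<one>" if "prime p" for p using p0[OF that] by (simp add: V_isometry)
  show "V (0, p) \<otimes> V (1, 1) = V (1, 1) [^] p \<otimes> V (0, p)" if "prime p" for p
    using p0[OF that] by (simp add: V_pow[simplified] V_mult)
  show "V (0, p) \<otimes> V (0, q) = V (0, q) \<otimes> V (0, p)" if "prime p" "prime q" for p q
    using p0[OF that(1)] p0[OF that(2)] by (simp add: V_mult mult.commute)
  show "(V (0, p))\<^sup>\<star> \<otimes> V (0, q) = V (0, q) \<otimes> (V (0, p))\<^sup>\<star>" if "prime p" "prime q" "p \<noteq> q" for p q
    using p0[OF that(1)] p0[OF that(2)] primes_coprime[OF that] aff_ideal_inter[of p q 0 0 0 1 0]
    by (intro V_adj_V_meet[where z = "(0, p * q)"]) auto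
  show "(V (1, 1))\<^sup>\<star> \<otimes> V (0, p) = V (1, 1) [^] (p - 1) \<otimes> V (0, p) \<otimes> (V (1, 1))\<^sup>\<star>" if "prime p" for p
  proof -
    have "(V (1, 1))\<^sup>\<star> \<otimes> V (0, p) = V (p - 1, p) \<otimes> (V (1, 1))\<^sup>\<star>"
      using p0[OF that] aff_ideal_inter[of p 1 1 1 "p - 1" 1 0]
      by (intro V_adj_V_meet[where z = "(p, p)"]) (auto simp: Int_commute)
    also have "V (p - 1, p) = V (1, 1) [^] (p - 1) \<otimes> V (0, p)"
      using p0[OF that] by (simp add: V_pow[simplified] V_mult)
    finally show ?thesis .
  qed
  show "(V (0, p))\<^sup>\<star> \<otimes> V (1, 1) [^] k \<otimes> V (0, p) = \<zero>" if p: "prime p" and k: "1 \<le> k" "k < p" for p k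
  proof -
    have "\<not> p dvd k" using k by (auto dest: dvd_imp_le)
    then have "aff_ideal (0, p) \<inter> aff_ideal (k, p) = {}" using aff_ideal_inter_empty[of p p k 0] by simp
    then have "(V (0, p))\<^sup>\<star> \<otimes> V (k, p) = \<zero>" using p0[OF p] by (intro V_adj_V_disjoint) auto
    moreover have "V (k, p) = V (1, 1) [^] k \<otimes> V (0, p)"
      using p0[OF p] by (simp add: V_pow[simplified] V_mult)
    ultimately show ?thesis using p0[OF p] by (simp add: m_assoc del: nat_pow_Suc)
  qed
qed

end

section \<open>Closed ideals and quotients\<close>

lemma star_hom_simps:
  assumes "h \<in> star_hom A B"
  shows "x \<in> carrier A \<Longrightarrow> h x \<in> carrier B"
    and "x \<in> carrier A \<Longrightarrow> y \<in> carrier A \<Longrightarrow> h (x \<otimes>\<^bsub>A\<^esub> y) = h x \<otimes>\<^bsub>B\<^esub> h y"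
    and "x \<in> carrier A \<Longrightarrow> y \<in> carrier A \<Longrightarrow> h (x \<oplus>\<^bsub>A\<^esub> y) = h x \<oplus>\<^bsub>B\<^esub> h y"
    and "h \<one>\<^bsub>A\<^esub> = \<one>\<^bsub>B\<^esub>"
    and "x \<in> carrier A \<Longrightarrow> h (cscale A c x) = cscale B c (h x)"
    and "x \<in> carrier A \<Longrightarrow> h (adj A x) = adj B (h x)"
  using assms by (auto simp: star_hom_def ring_hom_def)

lemma star_homI:
  assumes "\<And>x. x \<in> carrier A \<Longrightarrow> h x \<in> carrier B"
    and "\<And>x y. x \<in> carrier A \<Longrightarrow> y \<in> carrier A \<Longrightarrow> h (x \<otimes>\<^bsub>A\<^esub> y) = h x \<otimes>\<^bsub>B\<^esub> h y"
    and "\<And>x y. x \<in> carrier A \<Longrightarrow> y \<in> carrier A \<Longrightarrow> h (x \<oplus>\<^bsub>A\<^esub> y) = h x \<oplus>\<^bsub>B\<^esub> h y"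
    and "h \<one>\<^bsub>A\<^esub> = \<one>\<^bsub>B\<^esub>"
    and "\<And>c x. x \<in> carrier A \<Longrightarrow> h (cscale A c x) = cscale B c (h x)"
    and "\<And>x. x \<in> carrier A \<Longrightarrow> h (adj A x) = adj B (h x)"
  shows "h \<in> star_hom A B"
  using assms by (auto simp: star_hom_def intro!: ring_hom_memI)

lemma star_hom_comp: "h \<in> star_hom A B \<Longrightarrow> k \<in> star_hom B C \<Longrightarrow> k \<circ> h \<in> star_hom A C"
  by (rule star_homI) (simp_all add: star_hom_simps[of h A B] star_hom_simps[of k B C])

lemma star_hom_id: "(\<lambda>x. x) \<in> star_hom A A"
  by (rule star_homI) simp_all

lemma star_hom_zero_minus:
  assumes "cstar_algebra A" "cstar_algebra B" "h \<in> star_hom A B"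
  shows "h \<zero>\<^bsub>A\<^esub> = \<zero>\<^bsub>B\<^esub>"
    and "x \<in> carrier A \<Longrightarrow> y \<in> carrier A \<Longrightarrow> h (x \<ominus>\<^bsub>A\<^esub> y) = h x \<ominus>\<^bsub>B\<^esub> h y"
proof -
  interpret A: cstar_algebra A by fact
  interpret B: cstar_algebra B by fact
  note h = star_hom_simps[OF assms(3)]
  show "h \<zero>\<^bsub>A\<^esub> = \<zero>\<^bsub>B\<^esub>"
    using h(5)[of "\<zero>\<^bsub>A\<^esub>" 0] h(1)[of "\<zero>\<^bsub>A\<^esub>"] by (simp add: A.scale_zero_right B.scale_zero_left)
  show "h (x \<ominus>\<^bsub>A\<^esub> y) = h x \<ominus>\<^bsub>B\<^esub> h y" if "x \<in> carrier A" "y \<in> carrier A"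
    using that by (simp add: a_minus_def A.uminus_scale B.uminus_scale h A.scale_closed)
qed

lemma star_hom_pow:
  assumes "cstar_algebra A" "cstar_algebra B" "h \<in> star_hom A B" "x \<in> carrier A"
  shows "h (x [^]\<^bsub>A\<^esub> (k::nat)) = h x [^]\<^bsub>B\<^esub> k"
proof -
  interpret A: cstar_algebra A by fact
  interpret B: cstar_algebra B by fact
  show ?thesis using assms(4) by (induction k) (simp_all add: star_hom_simps[OF assms(3)])
qed

lemma gen_closed_ideal_least: "closed_ideal I A \<Longrightarrow> S \<subseteq> I \<Longrightarrow> gen_closed_ideal A S \<subseteq> I"
  by (auto simp: gen_closed_ideal_def)

lemma gen_closed_ideal_carrier:
  assumes "ring A" "S \<subseteq> carrier A" shows "gen_closed_ideal A S \<subseteq> carrier A"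
proof (rule gen_closed_ideal_least[OF _ assms(2)])
  interpret ring A by fact
  show "closed_ideal (carrier A) A" by (simp add: closed_ideal_def oneideal)
qed

lemma closed_ideal_preimage:
  assumes A: "cstar_algebra A" and B: "cstar_algebra B" and h: "h \<in> star_hom A B"
    and contr: "\<And>a. a \<in> carrier A \<Longrightarrow> cnorm B (h a) \<le> cnorm A a" and J: "closed_ideal J B"
  shows "closed_ideal {a \<in> carrier A. h a \<in> J} A"
proof -
  interpret A: cstar_algebra A by fact
  interpret B: cstar_algebra B by fact
  interpret ring_hom_ring A B h
    using h by unfold_locales (simp add: star_hom_def)
  have JI: "ideal J B" and Jcl: "\<And>x. x \<in> carrier B \<Longrightarrow> \<forall>e>0. \<exists>y\<in>J. cnorm B (x \<ominus>\<^bsub>B\<^esub> y) < e \<Longrightarrow> x \<in> J"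
    using J by (auto simp: closed_ideal_def)
  show ?thesis
    unfolding closed_ideal_def
  proof (intro conjI ballI impI)
    show "ideal {a \<in> carrier A. h a \<in> J} A" by (rule ideal_vimage[OF JI])
    fix x assume x: "x \<in> carrier A" "\<forall>e>0. \<exists>y\<in>{a \<in> carrier A. h a \<in> J}. cnorm A (x \<ominus>\<^bsub>A\<^esub> y) < e"
    have "h x \<in> J"
    proof (rule Jcl)
      show "h x \<in> carrier B" using x by simp
      show "\<forall>e>0. \<exists>y\<in>J. cnorm B (h x \<ominus>\<^bsub>B\<^esub> y) < e"
      proof (intro allI impI)
        fix e :: real assume "e > 0"
        then obtain y where y: "y \<in> carrier A" "h y \<in> J" "cnorm A (x \<ominus>\<^bsub>A\<^esub> y) < e" using x by blast
        then have "cnorm B (h x \<ominus>\<^bsub>B\<^esub> h y) < e"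
          using contr[of "x \<ominus>\<^bsub>A\<^esub> y"] x star_hom_zero_minus(2)[OF A B h, of x y] by simp
        then show "\<exists>y\<in>J. cnorm B (h x \<ominus>\<^bsub>B\<^esub> y) < e" using y by blast
      qed
    qed
    then show "x \<in> {a \<in> carrier A. h a \<in> J}" using x by simp
  qed
qed

text \<open>
  It is enough to test the generators \<open>S\<close> against every closed ideal \<open>J\<close> containing \<open>T\<close>, since the
  preimage of \<open>J\<close> is then a closed ideal containing \<open>S\<close>.
\<close>

lemma hom_gen_closed_ideal:
  assumes "cstar_algebra A" "cstar_algebra B" "h \<in> star_hom A B"
    and "\<And>a. a \<in> carrier A \<Longrightarrow> cnorm B (h a) \<le> cnorm A a" and S: "S \<subseteq> carrier A"
    and ST: "\<And>J. closed_ideal J B \<Longrightarrow> T \<subseteq> J \<Longrightarrow> h ` S \<subseteq> J"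
  shows "h ` gen_closed_ideal A S \<subseteq> gen_closed_ideal B T"
  unfolding gen_closed_ideal_def[of B T]
proof (rule Inf_greatest)
  fix J assume "J \<in> {J. closed_ideal J B \<and> T \<subseteq> J}"
  then have J: "closed_ideal J B" "T \<subseteq> J" by auto
  have "gen_closed_ideal A S \<subseteq> {a \<in> carrier A. h a \<in> J}"
    using S ST[OF J] by (intro gen_closed_ideal_least closed_ideal_preimage[OF assms(1-4) J(1)]) auto
  then show "h ` gen_closed_ideal A S \<subseteq> J" by blast
qed

lemma cstar_quot_simps:
  fixes A :: "('a, 'm) star_algebra_scheme"
  shows "carrier (A CQuot I) = (\<lambda>x. I +>\<^bsub>A\<^esub> x) ` carrier A"
    "X \<otimes>\<^bsub>A CQuot I\<^esub> Y = (\<Union>a\<in>X. \<Union>b\<in>Y. I +>\<^bsub>A\<^esub> (a \<otimes>\<^bsub>A\<^esub> b))"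
    "X \<oplus>\<^bsub>A CQuot I\<^esub> Y = (\<Union>a\<in>X. \<Union>b\<in>Y. {a \<oplus>\<^bsub>A\<^esub> b})"
    "\<one>\<^bsub>A CQuot I\<^esub> = I +>\<^bsub>A\<^esub> \<one>\<^bsub>A\<^esub>"
    "cscale (A CQuot I) c X = (\<Union>x\<in>X. I +>\<^bsub>A\<^esub> cscale A c x)"
    "adj (A CQuot I) X = (\<Union>x\<in>X. I +>\<^bsub>A\<^esub> adj A x)"
  by (auto simp: cstar_quot_def ring.defs star_algebra.defs FactRing_def A_RCOSETS_def' rcoset_mult_def set_add_def')

text \<open>
  All operations of the quotient are unions over representatives, so they commute with taking images.
\<close>

lemma star_iso_quotient:
  fixes A :: "('a, 'm) star_algebra_scheme" and B :: "('b, 'n) star_algebra_scheme"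
  assumes A: "cstar_algebra A" and B: "cstar_algebra B" and iso: "\<phi> \<in> star_iso A B"
    and I: "I \<subseteq> carrier A" "\<phi> ` I = J"
  shows "(\<lambda>X. \<phi> ` X) \<in> star_iso (A CQuot I) (B CQuot J)"
    and "x \<in> carrier A \<Longrightarrow> \<phi> ` (I +>\<^bsub>A\<^esub> x) = J +>\<^bsub>B\<^esub> \<phi> x"
proof -
  interpret A: cstar_algebra A by fact
  interpret B: cstar_algebra B by fact
  have h: "\<phi> \<in> star_hom A B" and bij: "bij_betw \<phi> (carrier A) (carrier B)"
    using iso by (auto simp: star_iso_def)
  note hom = star_hom_simps[OF h]
  have coset: "\<phi> ` (I +>\<^bsub>A\<^esub> x) = J +>\<^bsub>B\<^esub> \<phi> x" if "x \<in> carrier A" for x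
  proof -
    have "\<phi> ` (I +>\<^bsub>A\<^esub> x) = (\<Union>i\<in>I. {\<phi> (i \<oplus>\<^bsub>A\<^esub> x)})" by (auto simp: a_r_coset_def')
    also have "\<dots> = (\<Union>i\<in>I. {\<phi> i \<oplus>\<^bsub>B\<^esub> \<phi> x})"
      using I(1) that by (intro SUP_cong refl) (auto simp: hom)
    also have "\<dots> = J +>\<^bsub>B\<^esub> \<phi> x" by (auto simp: a_r_coset_def' I(2)[symmetric])
    finally show ?thesis .
  qed
  then show "x \<in> carrier A \<Longrightarrow> \<phi> ` (I +>\<^bsub>A\<^esub> x) = J +>\<^bsub>B\<^esub> \<phi> x" .
  have sub: "X \<subseteq> carrier A" if "X \<in> carrier (A CQuot I)" for X
    using that I(1) by (auto simp: cstar_quot_simps a_r_coset_def')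
  have UN: "\<phi> ` (\<Union>x\<in>X. I +>\<^bsub>A\<^esub> f x) = (\<Union>y\<in>\<phi> ` X. J +>\<^bsub>B\<^esub> g y)"
    if "\<And>x. x \<in> X \<Longrightarrow> f x \<in> carrier A" "\<And>x. x \<in> X \<Longrightarrow> \<phi> (f x) = g (\<phi> x)" for X f g
    using that by (simp add: image_UN coset)
  have "(\<lambda>X. \<phi> ` X) \<in> star_hom (A CQuot I) (B CQuot J)"
  proof (rule star_homI)
    fix X assume X: "X \<in> carrier (A CQuot I)"
    show "\<phi> ` X \<in> carrier (B CQuot J)" using X by (auto simp: cstar_quot_simps coset hom)
    show "\<phi> ` cscale (A CQuot I) c X = cscale (B CQuot J) c (\<phi> ` X)" for c
      unfolding cstar_quot_simps using sub[OF X] by (intro UN) (auto simp: hom A.scale_closed)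
    show "\<phi> ` adj (A CQuot I) X = adj (B CQuot J) (\<phi> ` X)"
      unfolding cstar_quot_simps using sub[OF X] by (intro UN) (auto simp: hom)
    fix Y assume Y: "Y \<in> carrier (A CQuot I)"
    have "\<phi> ` (\<Union>a\<in>X. \<Union>b\<in>Y. I +>\<^bsub>A\<^esub> (a \<otimes>\<^bsub>A\<^esub> b)) = (\<Union>a\<in>X. \<Union>b\<in>Y. \<phi> ` (I +>\<^bsub>A\<^esub> (a \<otimes>\<^bsub>A\<^esub> b)))"
      by (simp add: image_UN)
    also have "\<dots> = (\<Union>a\<in>X. \<Union>b\<in>Y. J +>\<^bsub>B\<^esub> (\<phi> a \<otimes>\<^bsub>B\<^esub> \<phi> b))"
      using sub[OF X] sub[OF Y] by (intro SUP_cong refl) (auto simp: coset hom subset_iff)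
    finally show "\<phi> ` (X \<otimes>\<^bsub>A CQuot I\<^esub> Y) = \<phi> ` X \<otimes>\<^bsub>B CQuot J\<^esub> \<phi> ` Y"
      by (simp add: cstar_quot_simps)
    have "\<phi> ` (\<Union>a\<in>X. \<Union>b\<in>Y. {a \<oplus>\<^bsub>A\<^esub> b}) = (\<Union>a\<in>X. \<Union>b\<in>Y. {\<phi> (a \<oplus>\<^bsub>A\<^esub> b)})"
      by (simp add: image_UN)
    also have "\<dots> = (\<Union>a\<in>X. \<Union>b\<in>Y. {\<phi> a \<oplus>\<^bsub>B\<^esub> \<phi> b})"
      using sub[OF X] sub[OF Y] by (intro SUP_cong refl) (auto simp: hom subset_iff)
    finally show "\<phi> ` (X \<oplus>\<^bsub>A CQuot I\<^esub> Y) = \<phi> ` X \<oplus>\<^bsub>B CQuot J\<^esub> \<phi> ` Y"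
      by (simp add: cstar_quot_simps)
  next
    show "\<phi> ` \<one>\<^bsub>A CQuot I\<^esub> = \<one>\<^bsub>B CQuot J\<^esub>" by (simp add: cstar_quot_simps coset hom)
  qed
  moreover have "inj_on (\<lambda>X. \<phi> ` X) (carrier (A CQuot I))"
    using inj_on_image_eq_iff[OF bij_betw_imp_inj_on[OF bij]] sub by (intro inj_onI) blast
  moreover have "(\<lambda>X. \<phi> ` X) ` carrier (A CQuot I) = carrier (B CQuot J)"
  proof -
    have "(\<lambda>X. \<phi> ` X) ` carrier (A CQuot I) = (\<lambda>x. J +>\<^bsub>B\<^esub> \<phi> x) ` carrier A"
      unfolding cstar_quot_simps image_image by (intro image_cong refl coset)
    also have "\<dots> = (\<lambda>y. J +>\<^bsub>B\<^esub> y) ` (\<phi> ` carrier A)" by (simp add: image_image)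
    finally show ?thesis unfolding cstar_quot_simps bij_betw_imp_surj_on[OF bij] .
  qed
  ultimately show "(\<lambda>X. \<phi> ` X) \<in> star_iso (A CQuot I) (B CQuot J)"
    by (simp add: star_iso_def bij_betw_def)
qed

section \<open>Foundation sets and the boundary relations\<close>

lemma mem_aff_ideal_iff:
  assumes "x \<in> carrier affN"
  shows "z \<in> aff_ideal x \<longleftrightarrow> (\<exists>y\<in>carrier affN. z = x \<otimes>\<^bsub>affN\<^esub> y)"
  by (auto simp: l_coset_def)

lemma aff_ideal_mono:
  assumes "x \<in> carrier affN" "y \<in> carrier affN" "y \<in> aff_ideal x"
  shows "aff_ideal x \<inter> aff_ideal y = aff_ideal y"
proof -
  interpret monoid affN by (rule monoid_affN)
  obtain u where u: "u \<in> carrier affN" "y = x \<otimes>\<^bsub>affN\<^esub> u" using assms by (auto simp: l_coset_def)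
  have "y \<otimes>\<^bsub>affN\<^esub> w \<in> aff_ideal x" if w: "w \<in> carrier affN" for w
    unfolding mem_aff_ideal_iff[OF assms(1)] u(2) using m_assoc[OF assms(1) u(1) w] m_closed[OF u(1) w] by blast
  then have "aff_ideal y \<subseteq> aff_ideal x"
    unfolding l_coset_def[of affN y] by (intro UN_least) simp
  then show ?thesis by blast
qed

text \<open>
  Once \<open>N\<close> is past \<open>n\<close> and \<open>M\<close> is a multiple of \<open>b\<close>, a common element of the two progressions forces
  \<open>N \<equiv> n\<close> modulo \<open>b\<close>.
\<close>

lemma aff_ideal_meets_residue:
  assumes q: "(n, b) \<in> carrier affN" and M: "1 \<le> M" "b dvd M" and N: "n \<le> N"
    and ne: "aff_ideal (N, M) \<inter> aff_ideal (n, b) \<noteq> {}"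
  shows "(N, M) \<in> aff_ideal (n, b)"
proof -
  have "aff_ideal (n, b) \<inter> aff_ideal (n + (N - n), M) \<noteq> {}" using ne N by (simp add: Int_commute)
  then have "gcd b M dvd N - n" using aff_ideal_inter_empty by blast
  then have "b dvd N - n" using M by (simp add: gcd_nat.absorb1)
  then obtain u where u: "N - n = b * u" by blast
  obtain c where c: "M = b * c" using M by blast
  then have "1 \<le> c" using M by (cases c) auto
  moreover have "N = n + b * u" using u N by simp
  ultimately show ?thesis unfolding mem_aff_ideal using c by blast
qed

lemma foundation_residues:
  assumes "1 \<le> p" shows "foundation_set affN ((\<lambda>k. (k, p)) ` {..<p})"
  unfolding foundation_set_def
proof (intro conjI ballI)
  fix x assume "x \<in> carrier affN"
  then obtain m a where x: "x = (m, a)" "1 \<le> a" by (cases x) auto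
  have "(m, a * p) \<in> aff_ideal (m, a)" unfolding mem_aff_ideal using assms by (intro exI[of _ p] exI[of _ 0]) auto
  moreover have "(m, a * p) \<in> aff_ideal (m mod p, p)"
    unfolding mem_aff_ideal using x by (intro exI[of _ a] exI[of _ "m div p"]) (auto simp: mult.commute)
  ultimately show "\<exists>q\<in>(\<lambda>k. (k, p)) ` {..<p}. aff_ideal x \<inter> aff_ideal q \<noteq> {}"
    using x assms by (intro bexI[of _ "(m mod p, p)"]) (auto simp: Suc_le_eq)
qed (use assms in auto)

lemma foundation_shift: "foundation_set affN {(1, 1)}"
  unfolding foundation_set_def
proof (intro conjI ballI)
  fix x assume "x \<in> carrier affN"
  then obtain m a where x: "x = (m, a)" "1 \<le> a" by (cases x) auto
  have "(m + a, a) \<in> aff_ideal (m, a)" unfolding mem_aff_ideal by (rule exI[of _ 1], rule exI[of _ 1]) simp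
  moreover have "(m + a, a) \<in> aff_ideal (1, 1)"
    unfolding mem_aff_ideal using x by (intro exI[of _ a] exI[of _ "m + a - 1"]) auto
  ultimately show "\<exists>q\<in>{(1, 1)}. aff_ideal x \<inter> aff_ideal q \<noteq> {}" using x by auto
qed auto

context toeplitz_rep
begin

abbreviation "range_proj x \<equiv> aff_iso x \<otimes> (aff_iso x)\<^sup>\<star>"

lemma aff_iso_shift: "aff_iso (m, 1) = S m"
  by (simp add: aff_iso_def)

lemma range_proj_absorb:
  assumes x: "x \<in> carrier affN" "y \<in> carrier affN" and w: "w \<in> carrier A" and I: "ideal I A"
    and mem: "range_proj (x \<otimes>\<^bsub>affN\<^esub> y) \<otimes> w \<in> I"
  shows "range_proj y \<otimes> ((aff_iso x)\<^sup>\<star> \<otimes> w) \<in> I"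
proof -
  interpret I: ideal I A by fact
  have "(aff_iso x)\<^sup>\<star> \<otimes> (range_proj (x \<otimes>\<^bsub>affN\<^esub> y) \<otimes> w) \<in> I" using mem by (rule I.I_l_closed) simp
  moreover have "(aff_iso x)\<^sup>\<star> \<otimes> (range_proj (x \<otimes>\<^bsub>affN\<^esub> y) \<otimes> w) =
      ((aff_iso x)\<^sup>\<star> \<otimes> aff_iso x) \<otimes> (range_proj y \<otimes> ((aff_iso x)\<^sup>\<star> \<otimes> w))"
    using w by (simp add: aff_iso_mult[OF x, symmetric] adj_mult m_assoc)
  ultimately show ?thesis using w by (simp add: aff_iso_isometry[OF x(1)])
qed

text \<open>
  In the quotient the projections \<open>e\<^bsub>(N + k,a)P\<^esub>\<close> with \<open>k < a\<close> add up to \<open>1\<close>; the lemma states this in a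
  form that avoids double sums, namely that \<open>w\<close> vanishes in the quotient as soon as all
  \<open>e\<^bsub>(N + k,a)P\<^esub> w\<close> do.  The induction over the prime factors of \<open>a\<close> uses
  \<open>(i + p * j, p * a) = (i, p) (j, a)\<close>: the hypothesis for \<open>a\<close> is applied to \<open>V\<^bsub>(i,p)\<^esub>\<^sup>* w\<close>, and then
  the covering relation for \<open>p\<close> removes the index \<open>i\<close>.  The shift by \<open>N\<close> is undone because \<open>s\<close> is
  unitary in the quotient.
\<close>

lemma cuntz_ideal_detects:
  assumes I: "ideal I A" and unitary: "s \<otimes> s\<^sup>\<star> \<ominus> \<one> \<in> I"
    and cover: "\<And>p. prime p \<Longrightarrow> (\<Oplus>k\<in>{..<p}. range_proj (k, p)) \<ominus> \<one> \<in> I"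
    and a: "1 \<le> a" and w: "w \<in> carrier A" and mem: "\<And>k. k < a \<Longrightarrow> range_proj (N + k, a) \<otimes> w \<in> I"
  shows "w \<in> I"
proof -
  interpret I: ideal I A by fact
  have mod_one: "w \<in> I" if "e \<ominus> \<one> \<in> I" "e \<otimes> w \<in> I" "e \<in> carrier A" "w \<in> carrier A" for e w
  proof -
    have "(e \<ominus> \<one>) \<otimes> w \<in> I" using that by (intro I.I_r_closed)
    then have "e \<otimes> w \<oplus> \<ominus> ((e \<ominus> \<one>) \<otimes> w) \<in> I" using that by (intro I.a_closed I.a_inv_closed)
    moreover have "e \<otimes> w \<oplus> \<ominus> ((e \<ominus> \<one>) \<otimes> w) = w"
      using that by (simp add: a_minus_def l_distr l_minus minus_add r_neg2)
    ultimately show ?thesis by simp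
  qed
  have shift: "w \<in> I" if "(S N)\<^sup>\<star> \<otimes> w \<in> I" "w \<in> carrier A" for N w
    using that
  proof (induction N arbitrary: w)
    case (Suc N)
    have "(S (Suc N))\<^sup>\<star> \<otimes> w = s\<^sup>\<star> \<otimes> ((S N)\<^sup>\<star> \<otimes> w)" using Suc.prems by (simp add: adj_mult m_assoc)
    then have "s \<otimes> (s\<^sup>\<star> \<otimes> ((S N)\<^sup>\<star> \<otimes> w)) \<in> I" using Suc.prems I.I_l_closed[of _ s] by simp
    then have "(s \<otimes> s\<^sup>\<star>) \<otimes> ((S N)\<^sup>\<star> \<otimes> w) \<in> I" using Suc.prems by (simp add: m_assoc)
    then have "(S N)\<^sup>\<star> \<otimes> w \<in> I" by (rule mod_one[OF unitary]) (use Suc.prems in simp_all)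
    then show ?case using Suc by blast
  qed simp
  have sum_in: "(\<Oplus>k\<in>K. f k) \<in> I" if "finite K" "\<And>k. k \<in> K \<Longrightarrow> f k \<in> I" for K :: "nat set" and f
    using that by (induction K rule: finite_induct) (auto simp: I.a_closed I.Icarr)
  have unshift: "range_proj (k, a) \<otimes> ((S N)\<^sup>\<star> \<otimes> w) \<in> I"
    if "range_proj (N + k, a) \<otimes> w \<in> I" "w \<in> carrier A" "1 \<le> a" for N k a w
    using range_proj_absorb[of "(N, 1)" "(k, a)" w I] that I by (simp add: aff_iso_shift[simplified])
  show ?thesis
    using a w mem
  proof (induction a arbitrary: N w rule: pos_nat_prime_induct)
    case one
    then have "range_proj (0, 1) \<otimes> ((S N)\<^sup>\<star> \<otimes> w) \<in> I" by (intro unshift) auto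
    then have "(S N)\<^sup>\<star> \<otimes> w \<in> I" using one by (simp add: aff_iso_def)
    then show ?case using one shift by blast
  next
    case (prime_mult p a)
    have p: "1 \<le> p" using prime_gt_0_nat[OF prime_mult(1)] by simp
    define u where "u = (S N)\<^sup>\<star> \<otimes> w"
    have u: "u \<in> carrier A" using prime_mult.prems(1) by (simp add: u_def)
    have "(aff_iso (i, p))\<^sup>\<star> \<otimes> u \<in> I" if i: "i < p" for i
    proof (rule prime_mult.IH[where N = 0])
      show "(aff_iso (i, p))\<^sup>\<star> \<otimes> u \<in> carrier A" using u by simp
      fix j assume j: "j < a"
      have "i + p * j < p * a"
      proof -
        have "i + p * j < p * Suc j" using i by simp
        also have "\<dots> \<le> p * a" using j by (intro mult_le_mono2) simp
        finally show ?thesis .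
      qed
      then have "range_proj (i + p * j, p * a) \<otimes> u \<in> I"
        unfolding u_def using p prime_mult.hyps by (intro unshift prime_mult.prems) auto
      then show "range_proj (0 + j, a) \<otimes> ((aff_iso (i, p))\<^sup>\<star> \<otimes> u) \<in> I"
        using range_proj_absorb[of "(i, p)" "(j, a)" u I] p prime_mult(2) u I by simp
    qed
    then have r: "range_proj (i, p) \<otimes> u \<in> I" if "i < p" for i
      using I.I_l_closed[of "(aff_iso (i, p))\<^sup>\<star> \<otimes> u" "aff_iso (i, p)"] that u by (simp add: m_assoc)
    have "(\<Oplus>i\<in>{..<p}. range_proj (i, p)) \<otimes> u = (\<Oplus>i\<in>{..<p}. range_proj (i, p) \<otimes> u)"
      using u by (intro finsum_ldistr) auto
    then have "(\<Oplus>i\<in>{..<p}. range_proj (i, p)) \<otimes> u \<in> I" using r by (auto intro!: sum_in)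
    then have "u \<in> I" by (rule mod_one[OF cover[OF prime_mult(1)]]) (use u in \<open>auto intro!: finsum_closed\<close>)
    then show ?case using shift prime_mult(4) unfolding u_def by blast
  qed
qed

lemma range_proj_commute:
  assumes "x \<in> carrier affN" "y \<in> carrier affN"
  shows "range_proj x \<otimes> range_proj y = range_proj y \<otimes> range_proj x"
  using aff_proj_mult[OF assms] aff_proj_mult[OF assms(2,1)] assms
  by (simp add: aff_proj_ideal Int_commute)

text \<open>
  Range projections commute, so \<open>e\<^bsub>zP\<^esub>\<close> can be moved to the factor \<open>1 - e\<^bsub>qP\<^esub>\<close>, which it annihilates
  because \<open>zP \<subseteq> qP\<close>.
\<close>

lemma range_proj_kills_product:
  assumes z: "z \<in> carrier affN" and ps: "set ps \<subseteq> carrier affN" and q: "q \<in> set ps" "z \<in> aff_ideal q"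
  shows "range_proj z \<otimes> foldr (\<lambda>y x. (\<one> \<ominus> range_proj y) \<otimes> x) ps \<one> = \<zero>"
  using ps q(1)
proof (induction ps)
  case (Cons y ps)
  have y: "y \<in> carrier affN" using Cons by auto
  define w where "w = foldr (\<lambda>y x. (\<one> \<ominus> range_proj y) \<otimes> x) ps \<one>"
  have w: "w \<in> carrier A" unfolding w_def by (induction ps) auto
  show ?case
  proof (cases "y = q")
    case True
    have "range_proj q \<otimes> range_proj z = range_proj z"
      using aff_proj_mult[OF y z] aff_ideal_mono[OF y z] q(2) y z by (simp add: True aff_proj_ideal)
    then have "range_proj z \<otimes> range_proj q = range_proj z" using range_proj_commute[OF y z] True by simp
    then have "range_proj z \<otimes> (\<one> \<ominus> range_proj q) = \<zero>" by (simp add: a_minus_def r_distr r_minus r_neg)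
    then have "range_proj z \<otimes> ((\<one> \<ominus> range_proj q) \<otimes> w) = \<zero>"
      using w mult_assoc_subst[of "range_proj z" "\<one> \<ominus> range_proj q" \<zero> w] by simp
    then show ?thesis by (simp add: w_def True)
  next
    case False
    then have "range_proj z \<otimes> w = \<zero>" using Cons unfolding w_def by auto
    have "range_proj z \<otimes> (\<one> \<ominus> range_proj y) = (\<one> \<ominus> range_proj y) \<otimes> range_proj z"
      using range_proj_commute[OF y z] by (simp add: a_minus_def r_distr l_distr r_minus l_minus)
    then have "range_proj z \<otimes> ((\<one> \<ominus> range_proj y) \<otimes> w) = (\<one> \<ominus> range_proj y) \<otimes> (range_proj z \<otimes> w)"
      using w by (simp add: m_assoc[symmetric])
    then show ?thesis using \<open>range_proj z \<otimes> w = \<zero>\<close> by (simp add: w_def)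
  qed
qed simp

text \<open>
  Every \<open>(N + k, M)\<close>, with \<open>N\<close> and \<open>M\<close> as below, lies in \<open>qP\<close> for some \<open>q\<close> in the foundation set: some
  \<open>qP\<close> meets \<open>(N + k, M)P\<close>, and \<open>aff_ideal_meets_residue\<close> applies.
\<close>

theorem foundation_product_in_cuntz_ideal:
  assumes I: "ideal I A" and unitary: "s \<otimes> s\<^sup>\<star> \<ominus> \<one> \<in> I"
    and cover: "\<And>p. prime p \<Longrightarrow> (\<Oplus>k\<in>{..<p}. range_proj (k, p)) \<ominus> \<one> \<in> I"
    and F: "foundation_set affN (set ps)"
  shows "foldr (\<lambda>y x. (\<one> \<ominus> range_proj y) \<otimes> x) ps \<one> \<in> I"
proof -
  interpret I: ideal I A by fact
  have ps: "set ps \<subseteq> carrier affN" using F by (simp add: foundation_set_def)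
  \<comment> \<open>any upper bound and any positive common multiple would do\<close>
  define N M where "N = sum_list (map fst ps)" and "M = prod_list (map snd ps)"
  have N: "n \<le> N" if "(n, b) \<in> set ps" for n b
    unfolding N_def using that by (intro member_le_sum_list) force+
  have M: "b dvd M" if "(n, b) \<in> set ps" for n b
    unfolding M_def using that by (induction ps) auto
  have M1: "1 \<le> M" unfolding M_def using ps by (induction ps) auto
  show ?thesis
  proof (rule cuntz_ideal_detects[OF I unitary cover M1, where N = N])
    show "foldr (\<lambda>y x. (\<one> \<ominus> range_proj y) \<otimes> x) ps \<one> \<in> carrier A" by (induction ps) auto
    fix k
    have z: "(N + k, M) \<in> carrier affN" using M1 by simp
    then have "\<exists>q\<in>set ps. aff_ideal (N + k, M) \<inter> aff_ideal q \<noteq> {}"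
      using F unfolding foundation_set_def by blast
    then obtain n b where nb: "(n, b) \<in> set ps" "aff_ideal (N + k, M) \<inter> aff_ideal (n, b) \<noteq> {}"
      by auto
    have "(n, b) \<in> carrier affN" using ps nb(1) by blast
    then have "(N + k, M) \<in> aff_ideal (n, b)"
      using M1 M[OF nb(1)] N[OF nb(1)] nb(2) by (intro aff_ideal_meets_residue) auto
    then show "range_proj (N + k, M) \<otimes> foldr (\<lambda>y x. (\<one> \<ominus> range_proj y) \<otimes> x) ps \<one> \<in> I"
      using range_proj_kills_product[OF z ps nb(1)] I.zero_closed by simp
  qed auto
qed

end

context cstar_algebra
begin

lemma orthogonal_product:
  assumes "distinct ks" "\<And>k. k \<in> set ks \<Longrightarrow> e k \<in> carrier A"
    and "\<And>k l. k \<in> set ks \<Longrightarrow> l \<in> set ks \<Longrightarrow> k \<noteq> l \<Longrightarrow> e k \<otimes> e l = \<zero>"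
  shows "foldr (\<lambda>k x. (\<one> \<ominus> e k) \<otimes> x) ks \<one> = \<one> \<ominus> (\<Oplus>k\<in>set ks. e k)"
  using assms
proof (induction ks)
  case Nil
  then show ?case by (simp add: a_minus_def)
next
  case (Cons k ks)
  have e: "e k \<in> carrier A" "\<And>l. l \<in> set ks \<Longrightarrow> e l \<in> carrier A" using Cons by auto
  define t where "t = (\<Oplus>k\<in>set ks. e k)"
  have t: "t \<in> carrier A" unfolding t_def using e by (intro finsum_closed) auto
  have "e k \<otimes> t = (\<Oplus>l\<in>set ks. e k \<otimes> e l)"
    unfolding t_def using e by (intro finsum_rdistr) auto
  also have "\<dots> = (\<Oplus>l\<in>set ks. \<zero>)" using Cons.prems by (intro finsum_cong') auto
  also have "\<dots> = \<zero>" by simp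
  finally have et: "e k \<otimes> t = \<zero>" .
  have "foldr (\<lambda>k x. (\<one> \<ominus> e k) \<otimes> x) (k # ks) \<one> = (\<one> \<ominus> e k) \<otimes> (\<one> \<ominus> t)"
    using Cons unfolding t_def by auto
  also have "\<dots> = \<one> \<ominus> (e k \<oplus> t)"
    using e t et by (simp add: a_minus_def l_distr r_distr l_minus r_minus minus_add a_ac)
  also have "e k \<oplus> t = (\<Oplus>l\<in>set (k # ks). e l)" unfolding t_def using Cons e by simp
  finally show ?case .
qed

end

context
  fixes A :: "('a, 'm) star_algebra_scheme" (structure) and V E J
  assumes rep: "sgrp_rep A affN V E" and J: "ideal J A"
    and found: "\<And>ps. distinct ps \<Longrightarrow> foundation_set affN (set ps) \<Longrightarrow>
      foldr (\<lambda>y x. (\<one> \<ominus> E (aff_ideal y)) \<otimes> x) ps \<one> \<in> J"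
begin

interpretation sgrp_rep A affN V E by (rule rep)
interpretation J: ideal J A by (rule J)

lemma minus_mem_swap: "x \<in> carrier A \<Longrightarrow> \<one> \<ominus> x \<in> J \<Longrightarrow> x \<ominus> \<one> \<in> J"
  using J.a_inv_closed[of "\<one> \<ominus> x"] by (simp add: a_minus_def minus_add a_comm)

lemma boundary_ideal_unitary: "V (1, 1) \<otimes> (V (1, 1))\<^sup>\<star> \<ominus> \<one> \<in> J"
  using found[of "[(1, 1)]"] foundation_shift E_aff_ideal[OF rep, of "(1, 1)"]
  by (intro minus_mem_swap) auto

lemma boundary_ideal_cover:
  assumes p: "1 \<le> p"
  shows "(\<Oplus>k\<in>{..<p}. V (k, p) \<otimes> (V (k, p))\<^sup>\<star>) \<ominus> \<one> \<in> J"
proof (rule minus_mem_swap)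
  let ?e = "\<lambda>k. V (k, p) \<otimes> (V (k, p))\<^sup>\<star>"
  have c: "(k, p) \<in> carrier affN" for k using p by simp
  have e: "E (aff_ideal (k, p)) = ?e k" for k by (rule E_aff_ideal[OF rep c])
  have ecl: "?e k \<in> carrier A" for k using V_closed[OF c] by simp
  show "(\<Oplus>k\<in>{..<p}. ?e k) \<in> carrier A" using ecl by (intro finsum_closed) auto
  have disj: "aff_ideal (k, p) \<inter> aff_ideal (l, p) = {}" if "k < l" "l < p" for k l
  proof -
    have "\<not> p dvd l - k" using that by (auto dest: dvd_imp_le)
    then show ?thesis using aff_ideal_inter_empty[of p p "l - k" k] that by simp
  qed
  have orth: "?e k \<otimes> ?e l = \<zero>" if "k < p" "l < p" "k \<noteq> l" for k l
  proof -
    have "aff_ideal (k, p) \<inter> aff_ideal (l, p) = {}"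
      using disj[of k l] disj[of l k] that by (cases "k < l") auto
    moreover have "aff_ideal (k, p) \<in> constructible_ideals affN" for k
      using c constructible_affN by blast
    ultimately show ?thesis using E_inter[of "aff_ideal (k, p)" "aff_ideal (l, p)"] E_empty by (simp add: e)
  qed
  have "foldr (\<lambda>y x. (\<one> \<ominus> E (aff_ideal y)) \<otimes> x) (map (\<lambda>k. (k, p)) [0..<p]) \<one> \<in> J"
    using foundation_residues[OF p] by (intro found) (auto simp: distinct_map inj_on_def atLeast0LessThan)
  also have "foldr (\<lambda>y x. (\<one> \<ominus> E (aff_ideal y)) \<otimes> x) (map (\<lambda>k. (k, p)) [0..<p]) \<one> =
      foldr (\<lambda>k x. (\<one> \<ominus> ?e k) \<otimes> x) [0..<p] \<one>"
    by (simp add: foldr_map comp_def e)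
  also have "\<dots> = \<one> \<ominus> (\<Oplus>k\<in>set [0..<p]. ?e k)"
    using ecl orth by (intro orthogonal_product) auto
  finally show "\<one> \<ominus> (\<Oplus>k\<in>{..<p}. ?e k) \<in> J" by (simp add: atLeast0LessThan)
qed

end

section \<open>The isomorphism\<close>

lemma (in gen_map) ev_prod_list:
  "(\<And>x. x \<in> set xs \<Longrightarrow> h x \<in> free_star_alg G) \<Longrightarrow>
    ev (prod_list (map h xs)) = foldr (\<lambda>x y. ev (h x) \<otimes> y) xs \<one>"
proof (induction xs)
  case (Cons x xs)
  have "prod_list (map h xs) \<in> free_star_alg G" using Cons.prems by (intro free_prod_list) auto
  then show ?case using Cons by (simp add: ev_mult)
qed (simp add: ev_one)

text \<open>
  The inclusion in \<open>I\<close> rather than the vanishing of the relations: the same computation is used for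
  the generators of the Cuntz ideal and for their images in the other algebra.
\<close>

lemma cuntz_rels_eval:
  fixes B (structure)
  assumes "gen_map B toeplitz_gens f" and rep: "toeplitz_rep B (f GS) (\<lambda>p. f (GV p))"
  shows "free_eval B f ` cuntz_rels \<subseteq> I \<longleftrightarrow>
    f GS \<otimes> adj B (f GS) \<ominus> \<one> \<in> I \<and>
    (\<forall>p. prime p \<longrightarrow> (\<Oplus>k\<in>{..<p}. toeplitz_rep.aff_iso B (f GS) (\<lambda>p. f (GV p)) (k, p) \<otimes>
      adj B (toeplitz_rep.aff_iso B (f GS) (\<lambda>p. f (GV p)) (k, p))) \<ominus> \<one> \<in> I)"
proof -
  interpret gen_map B toeplitz_gens f by fact
  interpret T: toeplitz_rep B "f GS" "\<lambda>p. f (GV p)" by (rule rep)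
  have g [simp]: "GS \<in> toeplitz_gens" "\<And>p. prime p \<Longrightarrow> GV p \<in> toeplitz_gens"
    by (auto simp: toeplitz_gens_def)
  have sum: "ev ((\<Sum>k<p. (fs ^ k * fv p) * fstar (fs ^ k * fv p)) - 1) =
      (\<Oplus>k\<in>{..<p}. T.aff_iso (k, p) \<otimes> adj B (T.aff_iso (k, p))) \<ominus> \<one>" if "prime p" for p
    using that by (simp add: ev T.aff_iso_def T.vn_prime)
  have shift: "ev (fs * fstar fs - 1) = f GS \<otimes> adj B (f GS) \<ominus> \<one>" by (simp add: ev)
  have "free_eval B f ` cuntz_rels \<subseteq> I \<longleftrightarrow> ev (fs * fstar fs - 1) \<in> I \<and>
      (\<forall>p. prime p \<longrightarrow> ev ((\<Sum>k<p. (fs ^ k * fv p) * fstar (fs ^ k * fv p)) - 1) \<in> I)"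
    unfolding cuntz_rels_def by blast
  then show ?thesis by (simp add: sum shift cong: imp_cong)
qed

lemma boundary_rels_eval:
  fixes B (structure)
  assumes "gen_map B (sgrp_gens affN) f"
  shows "free_eval B f ` boundary_rels affN \<subseteq> I \<longleftrightarrow>
    (\<forall>ps. distinct ps \<longrightarrow> foundation_set affN (set ps) \<longrightarrow>
      foldr (\<lambda>y x. (\<one> \<ominus> f (SE (aff_ideal y))) \<otimes> x) ps \<one> \<in> I)"
proof -
  interpret gen_map B "sgrp_gens affN" f by fact
  have "ev (prod_list (map (\<lambda>p. 1 - ge (aff_ideal p)) ps)) =
      foldr (\<lambda>y x. (\<one> \<ominus> f (SE (aff_ideal y))) \<otimes> x) ps \<one>" if "foundation_set affN (set ps)" for ps
  proof -
    have g: "SE (aff_ideal y) \<in> sgrp_gens affN" if "y \<in> set ps" for y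
    proof -
      have "y \<in> carrier affN"
        using that \<open>foundation_set affN (set ps)\<close> by (auto simp: foundation_set_def)
      then have "aff_ideal y \<in> constructible_ideals affN" unfolding constructible_affN by blast
      then show ?thesis by (simp add: sgrp_gens_def)
    qed
    have "ev (prod_list (map (\<lambda>p. 1 - ge (aff_ideal p)) ps)) =
        foldr (\<lambda>p x. ev (1 - ge (aff_ideal p)) \<otimes> x) ps \<one>"
      using g by (intro ev_prod_list) auto
    also have "\<dots> = foldr (\<lambda>y x. (\<one> \<ominus> f (SE (aff_ideal y))) \<otimes> x) ps \<one>"
      using g by (intro foldr_cong refl) (simp add: ev)
    finally show ?thesis .
  qed
  then show ?thesis unfolding boundary_rels_def by (force simp: image_subset_iff)
qed

theorem proposition6p4:
  shows "\<exists>\<phi> \<in> star_iso toeplitz_alg (sgrp_alg affN).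
    \<phi> toeplitz_s = sgrp_v affN (1, 1) \<and>
    (\<forall>p. prime p \<longrightarrow> \<phi> (toeplitz_v p) = sgrp_v affN (0, p)) \<and>
    (\<exists>\<psi> \<in> star_iso cuntz_QN (boundary_quot affN).
      \<forall>x \<in> carrier toeplitz_alg.
        \<psi> (cuntz_ideal +>\<^bsub>toeplitz_alg\<^esub> x) = boundary_ideal affN +>\<^bsub>sgrp_alg affN\<^esub> \<phi> x)"
proof -
  let ?A = toeplitz_alg and ?B = "sgrp_alg affN"
  let ?V = "sgrp_v affN" and ?E = "\<lambda>X. univ_elt (sgrp_gens affN) (sgrp_rels affN) (ge X)"
  let ?tA = "\<lambda>g. univ_elt toeplitz_gens toeplitz_rels (fgen g)"
    and ?tB = "\<lambda>g. univ_elt (sgrp_gens affN) (sgrp_rels affN) (fgen g)"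
  interpret PA: admissible_presentation toeplitz_gens toeplitz_rels
    by unfold_locales (rule toeplitz_admissible)
  interpret PB: admissible_presentation "sgrp_gens affN" "sgrp_rels affN"
    by unfold_locales (rule sgrp_admissible)
  have A: "cstar_algebra ?A" and B: "cstar_algebra ?B"
    by (rule toeplitz_alg_cstar, rule sgrp_alg_cstar)
  interpret A: cstar_algebra ?A by (rule A)
  interpret B: cstar_algebra ?B by (rule B)
  have A_eq: "univ_cstar toeplitz_gens toeplitz_rels = ?A" by (simp add: toeplitz_alg_def)
  have B_eq: "univ_cstar (sgrp_gens affN) (sgrp_rels affN) = ?B" by (simp add: sgrp_alg_def)
  have gens: "GS \<in> toeplitz_gens" "\<And>p. prime p \<Longrightarrow> GV p \<in> toeplitz_gens"
    "\<And>x. x \<in> carrier affN \<Longrightarrow> SV x \<in> sgrp_gens affN"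
    "\<And>X. X \<in> constructible_ideals affN \<Longrightarrow> SE X \<in> sgrp_gens affN"
    by (auto simp: toeplitz_gens_def sgrp_gens_def)
  have tautA: "gen_map ?A toeplitz_gens ?tA" and tautB: "gen_map ?B (sgrp_gens affN) ?tB"
    using PA.taut.gen_map_axioms PB.taut.gen_map_axioms by (simp_all add: A_eq B_eq)
  have repA: "toeplitz_rep ?A toeplitz_s toeplitz_v"
    using toeplitz_rep_iff[OF tautA] PA.taut_rel toeplitz_rels_free
    by (auto simp: A_eq toeplitz_s_def toeplitz_v_def[abs_def])
  have repB: "sgrp_rep ?B affN ?V ?E"
    using sgrp_rep_iff[OF tautB monoid_affN] PB.taut_rel sgrp_rels_free[OF monoid_affN]
    by (auto simp: B_eq sgrp_v_def[abs_def])
  interpret T: toeplitz_rep ?A toeplitz_s toeplitz_v by (rule repA)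
  interpret S: sgrp_rep ?B affN ?V ?E by (rule repB)
  have repA': "sgrp_rep ?A affN T.aff_iso T.aff_proj" by (rule T.sgrp_rep_affN)
  interpret SA: sgrp_rep ?A affN T.aff_iso T.aff_proj by (rule repA')
  have repB': "toeplitz_rep ?B (?V (1, 1)) (\<lambda>p. ?V (0, p))" by (rule toeplitz_rep_affN[OF repB])
  interpret TB: toeplitz_rep ?B "?V (1, 1)" "\<lambda>p. ?V (0, p)" by (rule repB')

  define f where "f g = (case g of GS \<Rightarrow> ?V (1, 1) | GV p \<Rightarrow> ?V (0, p))" for g
  define k where "k g = (case g of SV x \<Rightarrow> T.aff_iso x | SE X \<Rightarrow> T.aff_proj X)" for g
  have gf: "gen_map ?B toeplitz_gens f"
    using B by (auto simp: gen_map_def gen_map_axioms_def f_def toeplitz_gens_def)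
  have gk: "gen_map ?A (sgrp_gens affN) k"
    using A by (auto simp: gen_map_def gen_map_axioms_def k_def sgrp_gens_def)
  have "\<exists>\<phi>\<in>star_hom ?A ?B. (\<forall>x\<in>free_star_alg toeplitz_gens. \<phi> (univ_elt toeplitz_gens toeplitz_rels x) = free_eval ?B f x) \<and>
      (\<forall>a\<in>carrier ?A. cnorm ?B (\<phi> a) \<le> cnorm ?A a)"
    using PA.universal_contractive[OF gf] toeplitz_rep_iff[OF gf] repB' by (simp add: f_def A_eq)
  then obtain \<phi> where \<phi>: "\<phi> \<in> star_hom ?A ?B"
    and \<phi>_ev: "\<And>x. x \<in> free_star_alg toeplitz_gens \<Longrightarrow> \<phi> (univ_elt toeplitz_gens toeplitz_rels x) = free_eval ?B f x"
    and \<phi>_le: "\<And>a. a \<in> carrier ?A \<Longrightarrow> cnorm ?B (\<phi> a) \<le> cnorm ?A a"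
    by blast
  have "\<exists>\<psi>\<in>star_hom ?B ?A. (\<forall>x\<in>free_star_alg (sgrp_gens affN). \<psi> (univ_elt (sgrp_gens affN) (sgrp_rels affN) x) = free_eval ?A k x) \<and>
      (\<forall>b\<in>carrier ?B. cnorm ?A (\<psi> b) \<le> cnorm ?B b)"
    using PB.universal_contractive[OF gk] sgrp_rep_iff[OF gk monoid_affN] repA' by (simp add: k_def B_eq)
  then obtain \<psi> where \<psi>: "\<psi> \<in> star_hom ?B ?A"
    and \<psi>_ev: "\<And>x. x \<in> free_star_alg (sgrp_gens affN) \<Longrightarrow> \<psi> (univ_elt (sgrp_gens affN) (sgrp_rels affN) x) = free_eval ?A k x"
    and \<psi>_le: "\<And>b. b \<in> carrier ?B \<Longrightarrow> cnorm ?A (\<psi> b) \<le> cnorm ?B b"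
    by blast
  note \<phi>_hom = star_hom_simps[OF \<phi>] and \<psi>_hom = star_hom_simps[OF \<psi>]
  have \<phi>_s: "\<phi> toeplitz_s = ?V (1, 1)"
    using \<phi>_ev[of fs] gens(1) gen_map.ev_gen[OF gf] by (simp add: toeplitz_s_def f_def)
  have \<phi>_v: "\<phi> (toeplitz_v p) = ?V (0, p)" if "prime p" for p
    using \<phi>_ev[of "fv p"] gens(2) that gen_map.ev_gen[OF gf] by (simp add: toeplitz_v_def f_def)
  have \<psi>_V: "\<psi> (?V x) = T.aff_iso x" if "x \<in> carrier affN" for x
    using \<psi>_ev[of "gv x"] gens(3)[OF that] gen_map.ev_gen[OF gk] by (simp add: sgrp_v_def k_def)
  have \<psi>_E: "\<psi> (?E X) = T.aff_proj X" if "X \<in> constructible_ideals affN" for X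
    using \<psi>_ev[of "ge X"] gens(4)[OF that] gen_map.ev_gen[OF gk] by (simp add: k_def)

  \<comment> \<open>to compare the generators \<open>SV x\<close> and \<open>SE X\<close>, \<open>\<phi>\<close> has to be known on all \<open>s\<^sup>m v\<^sub>a\<close>, not only on \<open>s\<close> and \<open>v\<^sub>p\<close>\<close>
  have \<phi>_vn: "\<phi> (T.vn a) = ?V (0, a)" if "1 \<le> a" for a
    using that
  proof (induction a rule: pos_nat_prime_induct)
    case one
    show ?case using V_one[OF repB] by (simp add: \<phi>_hom)
  next
    case (prime_mult p a)
    then show ?case using prime_gt_0_nat[of p] by (simp add: T.vn_prime_mult \<phi>_hom \<phi>_v S.V_mult)
  qed
  have \<phi>_aff: "\<phi> (T.aff_iso x) = ?V x" if "x \<in> carrier affN" for x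
  proof -
    obtain m a where x': "x = (m, a)" by fastforce
    then have x: "x = (m, a)" "1 \<le> a" using that by simp_all
    have "\<phi> (T.aff_iso x) = ?V (m, 1) \<otimes>\<^bsub>?B\<^esub> ?V (0, a)"
      using x by (simp add: T.aff_iso_def \<phi>_hom star_hom_pow[OF A B \<phi>] \<phi>_s[simplified] \<phi>_vn V_pow[OF repB, simplified])
    then show ?thesis using x by (simp add: S.V_mult)
  qed
  have \<phi>_proj: "\<phi> (T.aff_proj X) = ?E X" if "X \<in> constructible_ideals affN" for X
    using that unfolding constructible_affN
  proof (elim disjE bexE)
    assume "X = {}"
    then show ?thesis by (simp add: SA.E_empty S.E_empty star_hom_zero_minus(1)[OF A B \<phi>])
  next
    fix x assume x: "x \<in> carrier affN" "X = aff_ideal x"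
    then show ?thesis by (simp add: T.aff_proj_ideal \<phi>_hom \<phi>_aff E_aff_ideal[OF repB])
  qed

  have \<psi>\<phi>: "\<psi> (\<phi> a) = a" if "a \<in> carrier ?A" for a
  proof -
    have "(\<psi> \<circ> \<phi>) a = (\<lambda>x. x) a"
    proof (rule PA.hom_unique[OF A, unfolded A_eq])
      show "\<psi> \<circ> \<phi> \<in> star_hom ?A ?A" by (rule star_hom_comp[OF \<phi> \<psi>])
      show "(\<lambda>x. x) \<in> star_hom ?A ?A" by (rule star_hom_id)
      show "cnorm ?A ((\<psi> \<circ> \<phi>) a) \<le> cnorm ?A a" if "a \<in> carrier ?A" for a
        using \<psi>_le[of "\<phi> a"] \<phi>_le[of a] that by (simp add: \<phi>_hom)
      fix g assume "g \<in> toeplitz_gens"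
      then consider "g = GS" | p where "prime p" "g = GV p" by (auto simp: toeplitz_gens_def)
      then show "(\<psi> \<circ> \<phi>) (?tA g) = ?tA g"
      proof cases
        case 1
        then show ?thesis
          using \<phi>_s \<psi>_V[of "(1, 1)"] by (simp add: toeplitz_s_def[symmetric] T.aff_iso_def)
      next
        case (2 p)
        then show ?thesis
          using \<phi>_v[of p] \<psi>_V[of "(0, p)"] prime_gt_0_nat[of p]
          by (simp add: toeplitz_v_def[symmetric] T.aff_iso_def T.vn_prime)
      qed
    qed (use that in auto)
    then show ?thesis by simp
  qed
  have \<phi>\<psi>: "\<phi> (\<psi> b) = b" if "b \<in> carrier ?B" for b
  proof -
    have "(\<phi> \<circ> \<psi>) b = (\<lambda>x. x) b"
    proof (rule PB.hom_unique[OF B, unfolded B_eq])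
      show "\<phi> \<circ> \<psi> \<in> star_hom ?B ?B" by (rule star_hom_comp[OF \<psi> \<phi>])
      show "(\<lambda>x. x) \<in> star_hom ?B ?B" by (rule star_hom_id)
      show "cnorm ?B ((\<phi> \<circ> \<psi>) b) \<le> cnorm ?B b" if "b \<in> carrier ?B" for b
        using \<phi>_le[of "\<psi> b"] \<psi>_le[of b] that by (simp add: \<psi>_hom)
      fix g assume "g \<in> sgrp_gens affN"
      then show "(\<phi> \<circ> \<psi>) (?tB g) = ?tB g"
        using \<psi>_V \<psi>_E \<phi>_aff \<phi>_proj by (auto simp: sgrp_gens_def sgrp_v_def simp del: affN_simps)
    qed (use that in auto)
    then show ?thesis by simp
  qed
  have iso: "\<phi> \<in> star_iso ?A ?B"
    unfolding star_iso_def using \<phi> \<phi>\<psi> \<psi>\<phi>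
    by (auto intro!: bij_betwI[where g = \<psi>] simp: \<phi>_hom \<psi>_hom)

  have f_eq: "f GS = ?V (1, 1)" "(\<lambda>p. f (GV p)) = (\<lambda>p. ?V (0, p))" by (simp_all add: f_def)
  have t_eq: "?tA GS = toeplitz_s" "(\<lambda>p. ?tA (GV p)) = toeplitz_v"
    by (simp_all add: toeplitz_s_def toeplitz_v_def[abs_def])
  have repf: "toeplitz_rep ?B (f GS) (\<lambda>p. f (GV p))" unfolding f_eq by (rule repB')
  have rept: "toeplitz_rep ?A (?tA GS) (\<lambda>p. ?tA (GV p))" unfolding t_eq by (rule repA)
  let ?SA = "univ_elt toeplitz_gens toeplitz_rels ` cuntz_rels"
    and ?SB = "univ_elt (sgrp_gens affN) (sgrp_rels affN) ` boundary_rels affN"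
  have SA: "?SA \<subseteq> carrier ?A" using PA.elt_closed cuntz_rels_free by (auto simp: A_eq)
  have SB: "?SB \<subseteq> carrier ?B" using PB.elt_closed boundary_rels_free by (force simp: B_eq)
  have SA_ev: "?SA = free_eval ?A ?tA ` cuntz_rels"
    using PA.taut_ev cuntz_rels_free by (intro image_cong refl) (auto simp: A_eq)
  have SB_ev: "?SB = free_eval ?B ?tB ` boundary_rels affN"
    using PB.taut_ev boundary_rels_free by (intro image_cong refl) (force simp: B_eq)
  have \<phi>SA: "\<phi> ` ?SA = free_eval ?B f ` cuntz_rels"
    unfolding image_image using \<phi>_ev cuntz_rels_free by (intro image_cong refl) auto
  have \<psi>SB: "\<psi> ` ?SB = free_eval ?A k ` boundary_rels affN"
    unfolding image_image using \<psi>_ev boundary_rels_free by (intro image_cong refl) blast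
  have into: "\<phi> ` cuntz_ideal \<subseteq> boundary_ideal affN"
    unfolding cuntz_ideal_def boundary_ideal_def
  proof (rule hom_gen_closed_ideal[OF A B \<phi> \<phi>_le SA])
    fix J assume "closed_ideal J ?B" and sub: "?SB \<subseteq> J"
    then have J: "ideal J ?B" by (simp add: closed_ideal_def)
    have found: "foldr (\<lambda>y x. (\<one>\<^bsub>?B\<^esub> \<ominus>\<^bsub>?B\<^esub> ?E (aff_ideal y)) \<otimes>\<^bsub>?B\<^esub> x) ps \<one>\<^bsub>?B\<^esub> \<in> J"
      if "distinct ps" "foundation_set affN (set ps)" for ps
      using sub that unfolding SB_ev boundary_rels_eval[OF tautB] by blast
    have TB: "TB.aff_iso (j, p) = ?V (j, p)" if "prime p" for j p
    proof -
      have "TB.aff_iso (j, p) = ?V (j, 1) \<otimes>\<^bsub>?B\<^esub> ?V (0, p)"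
        by (simp only: TB.aff_iso_def fst_conv snd_conv TB.vn_prime[OF that] V_pow[OF repB])
      then show ?thesis using prime_gt_0_nat[OF that] by (simp add: S.V_mult)
    qed
    show "\<phi> ` ?SA \<subseteq> J"
      unfolding \<phi>SA cuntz_rels_eval[OF gf repf] unfolding f_eq
    proof (intro conjI allI impI)
      show "?V (1, 1) \<otimes>\<^bsub>?B\<^esub> adj ?B (?V (1, 1)) \<ominus>\<^bsub>?B\<^esub> \<one>\<^bsub>?B\<^esub> \<in> J"
        by (rule boundary_ideal_unitary[OF repB J found])
      fix p :: nat assume p: "prime p"
      show "(\<Oplus>\<^bsub>?B\<^esub>j\<in>{..<p}. TB.aff_iso (j, p) \<otimes>\<^bsub>?B\<^esub> adj ?B (TB.aff_iso (j, p))) \<ominus>\<^bsub>?B\<^esub> \<one>\<^bsub>?B\<^esub> \<in> J"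
        unfolding TB[OF p]
        by (rule boundary_ideal_cover[OF repB J found]) (use prime_gt_0_nat[OF p] in auto)
    qed
  qed
  have onto: "\<psi> ` boundary_ideal affN \<subseteq> cuntz_ideal"
    unfolding cuntz_ideal_def boundary_ideal_def
  proof (rule hom_gen_closed_ideal[OF B A \<psi> \<psi>_le SB])
    fix I assume "closed_ideal I ?A" and sub: "?SA \<subseteq> I"
    then have I: "ideal I ?A" by (simp add: closed_ideal_def)
    have rels: "toeplitz_s \<otimes>\<^bsub>?A\<^esub> adj ?A toeplitz_s \<ominus>\<^bsub>?A\<^esub> \<one>\<^bsub>?A\<^esub> \<in> I"
      "\<And>p. prime p \<Longrightarrow> (\<Oplus>\<^bsub>?A\<^esub>j\<in>{..<p}. T.range_proj (j, p)) \<ominus>\<^bsub>?A\<^esub> \<one>\<^bsub>?A\<^esub> \<in> I"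
      using sub unfolding SA_ev cuntz_rels_eval[OF tautA rept] unfolding t_eq by blast+
    show "\<psi> ` ?SB \<subseteq> I"
      unfolding \<psi>SB boundary_rels_eval[OF gk]
    proof (intro allI impI)
      fix ps assume F: "foundation_set affN (set ps)"
      have "foldr (\<lambda>y x. (\<one>\<^bsub>?A\<^esub> \<ominus>\<^bsub>?A\<^esub> k (SE (aff_ideal y))) \<otimes>\<^bsub>?A\<^esub> x) ps \<one>\<^bsub>?A\<^esub> =
          foldr (\<lambda>y x. (\<one>\<^bsub>?A\<^esub> \<ominus>\<^bsub>?A\<^esub> T.range_proj y) \<otimes>\<^bsub>?A\<^esub> x) ps \<one>\<^bsub>?A\<^esub>"
        using F by (intro foldr_cong refl) (auto simp: k_def foundation_set_def T.aff_proj_ideal subset_iff simp del: affN_simps)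
      then show "foldr (\<lambda>y x. (\<one>\<^bsub>?A\<^esub> \<ominus>\<^bsub>?A\<^esub> k (SE (aff_ideal y))) \<otimes>\<^bsub>?A\<^esub> x) ps \<one>\<^bsub>?A\<^esub> \<in> I"
        using T.foundation_product_in_cuntz_ideal[OF I rels F] by simp
    qed
  qed
  have sub: "cuntz_ideal \<subseteq> carrier ?A" "boundary_ideal affN \<subseteq> carrier ?B"
    unfolding cuntz_ideal_def boundary_ideal_def
    by (rule gen_closed_ideal_carrier[OF A.ring_axioms SA], rule gen_closed_ideal_carrier[OF B.ring_axioms SB])
  have ideals: "\<phi> ` cuntz_ideal = boundary_ideal affN"
  proof (rule antisym[OF into])
    show "boundary_ideal affN \<subseteq> \<phi> ` cuntz_ideal"
    proof
      fix b assume b: "b \<in> boundary_ideal affN"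
      then have "\<psi> b \<in> cuntz_ideal" "b = \<phi> (\<psi> b)" using onto sub \<phi>\<psi> by auto
      then show "b \<in> \<phi> ` cuntz_ideal" by blast
    qed
  qed
  have "\<exists>\<psi> \<in> star_iso cuntz_QN (boundary_quot affN).
      \<forall>x \<in> carrier toeplitz_alg.
        \<psi> (cuntz_ideal +>\<^bsub>toeplitz_alg\<^esub> x) = boundary_ideal affN +>\<^bsub>sgrp_alg affN\<^esub> \<phi> x"
    unfolding cuntz_QN_def boundary_quot_def
    using star_iso_quotient[OF A B iso sub(1) ideals] by (intro bexI[of _ "\<lambda>X. \<phi> ` X"]) auto
  then show ?thesis using iso \<phi>_s \<phi>_v by blast
qed

end
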